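(* Let $d\ge 2$ and $k\ge 1$ be integers with $k\le d-1$. Then for every $n\ge 2$ and every base-point-free subspace $U\subset A(n)_d$ of codimension $k$ we have $$\operatorname{codim} U^2\le m(3k,k,k).$$ In particular, this constant is independent of $n$ and $d$.
   Context: $A(n)=\mathbb{C}[x_1,\dots,x_n]$ is the polynomial ring with its standard grading, and $A(n)_d$ is the $\mathbb{C}$-vector space of forms of degree $d$. For a linear subspace $U\subset A(n)_d$, $U^2:=\operatorname{span}(pq : p,q\in U)\subset A(n)_{2d}$. $\operatorname{codim} U$ is the codimension in $A(n)_d$ and $\operatorname{codim} U^2$ is the codimension in $A(n)_{2d}$. $U$ is called base-point-free if there is no point $\xi\in\mathbb{P}^{n-1}(\mathbb{C})$ with $f(\xi)=0$ for all $f\in U$. For integers $n\ge 2$, $d\ge 1$, $k\ge 1$, set $$m(n,d,k):=\max\{\operatorname{codim} U^2 : U\subset A(n)_d \text{ a linear subspace with } \operatorname{codim} U=k\}.$$ *)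

theory Defs
  imports Complex_Main "HOL-Library.Poly_Mapping"
begin

text \<open>
  Complex polynomials in the variables \<open>x\<^sub>0, x\<^sub>1, \<dots>\<close>, as finitely supported maps from exponent
  vectors to coefficients. Here \<open>x\<^sub>i\<close> plays the role of \<open>x\<^sub>i\<^sub>+\<^sub>1\<close> in the usual numbering, so that
  \<open>\<complex>[x\<^sub>1, \<dots>, x\<^sub>n]\<close> consists of the polynomials involving only the indices \<open>i < n\<close>.
\<close>

type_synonym cpoly = "(nat \<Rightarrow>\<^sub>0 nat) \<Rightarrow>\<^sub>0 complex"

definition cscale :: "complex \<Rightarrow> cpoly \<Rightarrow> cpoly" where
  "cscale c p = Poly_Mapping.single 0 c * p"

lemma lookup_cscale: "Poly_Mapping.lookup (cscale c p) m = c * Poly_Mapping.lookup p m"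
  by (simp add: cscale_def mult_map_scale_conv_mult[symmetric] Poly_Mapping.map.rep_eq when_def)

interpretation cpoly: vector_space cscale
  by unfold_locales
     (simp_all add: poly_mapping_eq_iff fun_eq_iff lookup_cscale lookup_add algebra_simps)

definition mon_degree :: "(nat \<Rightarrow>\<^sub>0 nat) \<Rightarrow> nat" where
  "mon_degree m = (\<Sum>i\<in>Poly_Mapping.keys m. Poly_Mapping.lookup m i)"

definition exponents :: "nat \<Rightarrow> nat \<Rightarrow> (nat \<Rightarrow>\<^sub>0 nat) set" where
  "exponents n d = {m. Poly_Mapping.keys m \<subseteq> {..<n} \<and> mon_degree m = d}"

text \<open>\<open>A(n)\<^sub>d\<close>; as usual it contains the zero polynomial.\<close>

definition forms :: "nat \<Rightarrow> nat \<Rightarrow> cpoly set" where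
  "forms n d = {p. Poly_Mapping.keys p \<subseteq> exponents n d}"

definition poly_eval :: "cpoly \<Rightarrow> (nat \<Rightarrow> complex) \<Rightarrow> complex" where
  "poly_eval p \<xi> =
     (\<Sum>m\<in>Poly_Mapping.keys p.
        Poly_Mapping.lookup p m * (\<Prod>i\<in>Poly_Mapping.keys m. \<xi> i ^ Poly_Mapping.lookup m i))"

definition square_space :: "cpoly set \<Rightarrow> cpoly set" where
  "square_space U = cpoly.span {p * q | p q. p \<in> U \<and> q \<in> U}"

text \<open>
  The truncated subtraction is harmless for subspaces \<open>U \<subseteq> forms n d\<close>, because \<open>forms n d\<close> is
  finite-dimensional; see \<open>codim_add_dim\<close> and \<open>square_space_forms\<close> below.
\<close>

definition codim_in :: "cpoly set \<Rightarrow> cpoly set \<Rightarrow> nat" where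
  "codim_in V U = cpoly.dim V - cpoly.dim U"

text \<open>
  A point of \<open>\<P>\<^sup>n\<^sup>-\<^sup>1(\<complex>)\<close> is given by homogeneous coordinates \<open>\<xi> 0, \<dots>, \<xi> (n - 1)\<close>, not all zero.
  The values \<open>\<xi> i\<close> for \<open>i \<ge> n\<close> do not affect the evaluation of elements of \<open>forms n d\<close>.
\<close>

definition base_point_free :: "nat \<Rightarrow> cpoly set \<Rightarrow> bool" where
  "base_point_free n U \<longleftrightarrow>
     \<not> (\<exists>\<xi>. (\<exists>i<n. \<xi> i \<noteq> 0) \<and> (\<forall>f\<in>U. poly_eval f \<xi> = 0))"

definition max_codim_sq :: "nat \<Rightarrow> nat \<Rightarrow> nat \<Rightarrow> nat" where
  "max_codim_sq n d k =
     Max {codim_in (forms n (2 * d)) (square_space U) | U.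
            cpoly.subspace U \<and> U \<subseteq> forms n d \<and> codim_in (forms n d) U = k}"


lemma finite_exponents: "finite (exponents n d)"
proof -
  let ?F = "{f. \<forall>i. (i \<in> {..<n} \<longrightarrow> f i \<in> {..d}) \<and> (i \<notin> {..<n} \<longrightarrow> f i = 0)} :: (nat \<Rightarrow> nat) set"
  have "Poly_Mapping.lookup m \<in> ?F" if m: "m \<in> exponents n d" for m
  proof -
    have "Poly_Mapping.lookup m i \<le> d" for i
    proof (cases "i \<in> Poly_Mapping.keys m")
      case True
      then show ?thesis
        using m member_le_sum[of i "Poly_Mapping.keys m" "Poly_Mapping.lookup m"]
        by (auto simp: exponents_def mon_degree_def)
    qed (simp add: in_keys_iff)
    moreover have "Poly_Mapping.lookup m i = 0" if "i \<notin> {..<n}" for i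
      using m that by (auto simp: exponents_def in_keys_iff)
    ultimately show ?thesis by simp
  qed
  then have "Poly_Mapping.lookup ` exponents n d \<subseteq> ?F" by (rule image_subsetI)
  moreover have "finite ?F"
    by (rule finite_set_of_finite_funs) auto
  ultimately have "finite (Poly_Mapping.lookup ` exponents n d)"
    by (rule finite_subset)
  then show ?thesis
    by (rule finite_imageD) (simp add: inj_on_def Poly_Mapping.poly_mapping.lookup_inject)
qed

lemma subspace_forms: "cpoly.subspace (forms n d)"
proof (rule cpoly.subspaceI)
  show "0 \<in> forms n d" by (simp add: forms_def)
  show "x + y \<in> forms n d" if "x \<in> forms n d" "y \<in> forms n d" for x y
    using that keys_add[of x y] unfolding forms_def by blast
  show "cscale c x \<in> forms n d" if "x \<in> forms n d" for c x
    using that by (auto simp: forms_def in_keys_iff lookup_cscale subset_iff)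
qed

lemma forms_finite_span:
  "forms n d \<subseteq> cpoly.span ((\<lambda>m. Poly_Mapping.single m 1) ` exponents n d)"
proof
  fix p assume p: "p \<in> forms n d"
  have "p = (\<Sum>m\<in>exponents n d. cscale (Poly_Mapping.lookup p m) (Poly_Mapping.single m 1))"
  proof (rule poly_mapping_eqI)
    fix m
    have "Poly_Mapping.lookup p m = 0" if "m \<notin> exponents n d"
      using p that by (auto simp: forms_def in_keys_iff)
    then have "Poly_Mapping.lookup p m =
        (\<Sum>e\<in>exponents n d. if e = m then Poly_Mapping.lookup p e else 0)"
      by (simp add: sum.delta[OF finite_exponents])
    also have "\<dots> =
        (\<Sum>e\<in>exponents n d. Poly_Mapping.lookup (cscale (Poly_Mapping.lookup p e) (Poly_Mapping.single e 1)) m)"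
      by (rule sum.cong) (simp_all add: lookup_cscale lookup_single)
    finally show "Poly_Mapping.lookup p m =
        Poly_Mapping.lookup (\<Sum>e\<in>exponents n d. cscale (Poly_Mapping.lookup p e) (Poly_Mapping.single e 1)) m"
      by (simp only: lookup_sum)
  qed
  also have "\<dots> \<in> cpoly.span ((\<lambda>m. Poly_Mapping.single m 1) ` exponents n d)"
    by (intro cpoly.span_sum cpoly.span_scale cpoly.span_base) auto
  finally show "p \<in> cpoly.span ((\<lambda>m. Poly_Mapping.single m 1) ` exponents n d)" .
qed

lemma forms_independent_finite:
  assumes "cpoly.independent B" "B \<subseteq> forms n d"
  shows "finite B"
  using cpoly.independent_span_bound[OF finite_imageI[OF finite_exponents] assms(1)
      order_trans[OF assms(2) forms_finite_span]] by (rule conjunct1)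

lemma codim_add_dim:
  assumes "U \<subseteq> forms n d"
  shows "codim_in (forms n d) U + cpoly.dim U = cpoly.dim (forms n d)"
proof -
  obtain B where B: "B \<subseteq> forms n d" "cpoly.independent B" "forms n d \<subseteq> cpoly.span B"
      "card B = cpoly.dim (forms n d)"
    by (rule cpoly.basis_exists)
  have "cpoly.dim U \<le> card B"
    using assms B forms_independent_finite[OF B(2,1)] by (intro cpoly.dim_le_card) auto
  with B(4) show ?thesis by (simp add: codim_in_def)
qed

lemma mon_degree_add: "mon_degree (a + b) = mon_degree a + mon_degree b"
proof -
  let ?S = "Poly_Mapping.keys a \<union> Poly_Mapping.keys b"
  have *: "mon_degree m = (\<Sum>i\<in>?S. Poly_Mapping.lookup m i)" if "Poly_Mapping.keys m \<subseteq> ?S" for m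
    unfolding mon_degree_def using that
    by (intro sum.mono_neutral_left) (auto simp: in_keys_iff)
  show ?thesis
    using *[of a] *[of b] *[of "a + b"] keys_add[of a b]
    by (simp add: lookup_add sum.distrib)
qed

lemma forms_mult: "p \<in> forms n d \<Longrightarrow> q \<in> forms n e \<Longrightarrow> p * q \<in> forms n (d + e)"
proof -
  assume p: "p \<in> forms n d" and q: "q \<in> forms n e"
  have "a + b \<in> exponents n (d + e)" if "a \<in> exponents n d" "b \<in> exponents n e" for a b
    using that keys_add[of a b] by (auto simp: exponents_def mon_degree_add)
  then have "{a + b | a b. a \<in> Poly_Mapping.keys p \<and> b \<in> Poly_Mapping.keys q} \<subseteq> exponents n (d + e)"
    using p q unfolding forms_def by blast
  then show ?thesis
    unfolding forms_def mem_Collect_eq by (rule order_trans[OF keys_mult])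
qed

lemma square_space_forms: "U \<subseteq> forms n d \<Longrightarrow> square_space U \<subseteq> forms n (2 * d)"
  unfolding square_space_def
  by (rule cpoly.span_minimal[OF _ subspace_forms]) (auto simp: mult_2 intro!: forms_mult)

text \<open>The maximum in \<open>max_codim_sq\<close> is attained whenever \<open>k \<le> dim A(n)\<^sub>d\<close>.\<close>

lemma max_codim_sq_finite:
  "finite {codim_in (forms n (2 * d)) (square_space U) | U.
      cpoly.subspace U \<and> U \<subseteq> forms n d \<and> codim_in (forms n d) U = k}"
  by (rule finite_subset[of _ "{..cpoly.dim (forms n (2 * d))}"]) (auto simp: codim_in_def)

lemma max_codim_sq_nonempty:
  assumes "k \<le> cpoly.dim (forms n d)"
  shows "\<exists>U. cpoly.subspace U \<and> U \<subseteq> forms n d \<and> codim_in (forms n d) U = k"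
proof -
  obtain B where B: "B \<subseteq> forms n d" "cpoly.independent B" "forms n d \<subseteq> cpoly.span B"
      "card B = cpoly.dim (forms n d)"
    by (rule cpoly.basis_exists)
  obtain C where C: "C \<subseteq> B" "card C = cpoly.dim (forms n d) - k"
    using obtain_subset_with_card_n[of "cpoly.dim (forms n d) - k" B] B(4) by auto
  have "cpoly.dim (cpoly.span C) = cpoly.dim (forms n d) - k"
    using C cpoly.independent_mono[OF B(2) C(1)] cpoly.dim_span_eq_card_independent by simp
  moreover have "cpoly.span C \<subseteq> forms n d"
    using B C by (intro cpoly.span_minimal subspace_forms) auto
  ultimately show ?thesis
    using assms by (intro exI[of _ "cpoly.span C"]) (simp add: codim_in_def)
qed

end

theory Submission
  imports Defs "HOL-Computational_Algebra.Fundamental_Theorem_Algebra"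
begin

text \<open>
  Write \<open>A\<^sub>j\<close> for the forms of degree \<open>j\<close> in \<open>n\<close> variables. If \<open>U \<subseteq> A\<^sub>d\<close> has codimension at most \<open>d\<close>,
  a generic linear form \<open>l\<close> satisfies \<open>A\<^sub>d = U + l A\<^sub>d\<^sub>-\<^sub>1\<close>. Division by \<open>l\<close> then turns multiplication by the
  variables into commuting endomorphisms of \<open>A\<^sub>d / U\<close> as soon as \<open>A\<^sub>1 U\<close> has no smaller codimension than \<open>U\<close>,
  and a common eigenvalue gives a base point. So for base-point-free \<open>U\<close> of codimension \<open>k\<close> the
  codimensions of \<open>U\<close>, \<open>A\<^sub>1 U\<close>, \<open>A\<^sub>2 U\<close>, \<open>\<dots>\<close> strictly decrease to \<open>0\<close>; in particular
  \<open>A\<^sub>d\<^sub>-\<^sub>1 U = A\<^sub>2\<^sub>d\<^sub>-\<^sub>1\<close> if \<open>k < d\<close>.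

  Next, choose \<open>k\<close> linear forms whose \<open>d\<close>-th powers span \<open>A\<^sub>d\<close> modulo \<open>U\<close>. On the subring they generate,
  \<open>U\<close> has at most \<open>k\<close> base points, and since none of them comes from a base point of \<open>U\<close>, each is
  destroyed by adjoining one more linear form. Thus \<open>2 k \<le> 3 k\<close> linear forms generate a subring \<open>B\<close> with
  \<open>A\<^sub>d = U + B\<^sub>d\<close> in which \<open>U \<inter> B\<^sub>d\<close> is base-point-free of codimension \<open>k\<close>. From
  \<open>B\<^sub>2\<^sub>d\<^sub>-\<^sub>1 = B\<^sub>d\<^sub>-\<^sub>1 (U \<inter> B\<^sub>d)\<close> one deduces \<open>A\<^sub>2\<^sub>d = U\<^sup>2 + B\<^sub>2\<^sub>d\<close>, which reduces the problem to \<open>3 k\<close> variables.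

  Finally, passing to leading monomials replaces \<open>U\<close> by a set of monomials and \<open>U\<^sup>2\<close> by a set containing
  its sumset. Compressing along the pairs \<open>(x\<^sub>i, z)\<close> for a fixed variable \<open>z\<close> does not enlarge the sumset
  (in each fibre, \<open>|A + B| \<ge> |A| + |B| - 1\<close>), and for a compressed set every missing monomial is
  divisible by \<open>z ^ (d - k)\<close>. Dividing by this power lowers the degree from \<open>d\<close> to \<open>k\<close>.
\<close>

section \<open>Linear algebra of forms\<close>

lemma cscale_mult_left: "cscale c (p * q) = cscale c p * q"
  by (simp add: cscale_def mult_ac)

lemma cscale_mult_right: "cscale c (p * q) = p * cscale c q"
  by (simp add: cscale_def mult_ac)

lemma subspace_mult_vimage:
  assumes "cpoly.subspace H" shows "cpoly.subspace {p. q * p \<in> H}"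
  using assms by (auto intro!: cpoly.subspaceI
      simp: cpoly.subspace_0 distrib_left cpoly.subspace_add cpoly.subspace_scale cscale_mult_right[symmetric])

lemma subspace_mult_image:
  assumes "cpoly.subspace F" shows "cpoly.subspace ((*) p ` F)"
proof (rule cpoly.subspaceI)
  show "0 \<in> (*) p ` F" using cpoly.subspace_0[OF assms] by (auto intro: image_eqI[of _ _ 0])
  show "x + y \<in> (*) p ` F" if xy: "x \<in> (*) p ` F" "y \<in> (*) p ` F" for x y
  proof -
    obtain a b where "x = p * a" "y = p * b" "a \<in> F" "b \<in> F" using xy by auto
    then show ?thesis using cpoly.subspace_add[OF assms, of a b]
      by (auto simp: distrib_left intro: image_eqI[of _ _ "a + b"])
  qed
  show "cscale c x \<in> (*) p ` F" if "x \<in> (*) p ` F" for c x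
    using that cpoly.subspace_scale[OF assms] by (auto simp: cscale_mult_right)
qed

lemma span_of_subspace: "cpoly.subspace V \<Longrightarrow> cpoly.span V = V"
  by (simp only: cpoly.span_eq_iff)

lemma span_Un_subspaces:
  assumes "cpoly.subspace U" "cpoly.subspace V"
  shows "cpoly.span (U \<union> V) = {u + v | u v. u \<in> U \<and> v \<in> V}"
  unfolding cpoly.span_Un using assms cpoly.span_eq_iff[of U] cpoly.span_eq_iff[of V] by metis

lemma in_span_Un_mult_iff:
  assumes "cpoly.subspace U" "cpoly.subspace F"
  shows "x \<in> cpoly.span (U \<union> (*) p ` F) \<longleftrightarrow> (\<exists>u\<in>U. \<exists>g\<in>F. x = u + p * g)"
  using span_Un_subspaces[OF assms(1) subspace_mult_image[OF assms(2)], of p] by auto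

lemma finite_basis_forms:
  assumes "V \<subseteq> forms n d"
  obtains B where "B \<subseteq> V" "cpoly.independent B" "V \<subseteq> cpoly.span B" "finite B" "card B = cpoly.dim V"
proof -
  obtain B where B: "B \<subseteq> V" "cpoly.independent B" "V \<subseteq> cpoly.span B" "card B = cpoly.dim V"
    by (rule cpoly.basis_exists)
  with forms_independent_finite[of B n d] assms that show ?thesis by blast
qed

lemma dim_le_dim_add_card:
  assumes "V \<subseteq> forms n d" "finite S" "M \<subseteq> cpoly.span (V \<union> S)"
  shows "cpoly.dim M \<le> cpoly.dim V + card S"
proof -
  obtain B where B: "B \<subseteq> V" "V \<subseteq> cpoly.span B" "finite B" "card B = cpoly.dim V"
    using finite_basis_forms[OF assms(1)] by metis
  have "V \<union> S \<subseteq> cpoly.span (B \<union> S)"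
    using B(2) cpoly.span_mono[of B "B \<union> S"] cpoly.span_superset[of "B \<union> S"] by blast
  then have "cpoly.span (V \<union> S) \<subseteq> cpoly.span (B \<union> S)"
    by (rule cpoly.span_minimal) simp
  then have "cpoly.dim M \<le> card (B \<union> S)"
    using assms B by (intro cpoly.dim_le_card) auto
  also have "\<dots> \<le> cpoly.dim V + card S"
    using card_Un_le[of B S] B by simp
  finally show ?thesis .
qed

lemma dim_mono_forms:
  assumes "V \<subseteq> M" "M \<subseteq> forms n d"
  shows "cpoly.dim V \<le> cpoly.dim M"
  using dim_le_dim_add_card[of M n d "{}" V] assms cpoly.span_superset[of M] by auto

text \<open>Turns a codimension into a concrete finite set: later bounds transport such an
  \<open>S\<close> along a linear map and then apply \<open>dim_le_dim_add_card\<close>.\<close>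

lemma complement_exists:
  assumes "V \<subseteq> M" "M \<subseteq> forms n d"
  obtains S where "S \<subseteq> M" "finite S" "card S = cpoly.dim M - cpoly.dim V" "M \<subseteq> cpoly.span (V \<union> S)"
proof -
  obtain B where B: "B \<subseteq> V" "cpoly.independent B" "V \<subseteq> cpoly.span B" "finite B" "card B = cpoly.dim V"
    using finite_basis_forms[of V n d] assms by blast
  obtain B' where B': "B \<subseteq> B'" "B' \<subseteq> M" "cpoly.independent B'" "M \<subseteq> cpoly.span B'"
    using cpoly.maximal_independent_subset_extend[of B M] B assms by (metis order_trans)
  have fin: "finite B'" using forms_independent_finite[OF B'(3)] B'(2) assms by blast
  have "card B' = cpoly.dim M" using cpoly.basis_card_eq_dim B' by blast
  then have "card (B' - B) = cpoly.dim M - cpoly.dim V"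
    using card_Diff_subset[OF B(4) B'(1)] B(5) by simp
  moreover have "M \<subseteq> cpoly.span (V \<union> (B' - B))"
    using B'(4) cpoly.span_mono[of B' "V \<union> (B' - B)"] B(1) by blast
  ultimately show ?thesis using that[of "B' - B"] fin B'(2) by blast
qed

lemma subspace_dim_equal:
  assumes "cpoly.subspace V" "V \<subseteq> M" "M \<subseteq> forms n d" "cpoly.dim M \<le> cpoly.dim V"
  shows "V = M"
proof -
  obtain S where "finite S" "card S = cpoly.dim M - cpoly.dim V" "M \<subseteq> cpoly.span (V \<union> S)"
    using complement_exists[OF assms(2,3)] by metis
  then have "M \<subseteq> cpoly.span V" using assms(4) by simp
  then show ?thesis using assms cpoly.span_eq_iff by blast
qed

lemma dim_less_forms:
  assumes "cpoly.subspace V" "V \<subset> M" "M \<subseteq> forms n d"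
  shows "cpoly.dim V < cpoly.dim M"
  using subspace_dim_equal[OF assms(1), of M n d] assms by (metis leI psubset_eq)

section \<open>Spans of products of two sets of polynomials\<close>

definition sprod :: "cpoly set \<Rightarrow> cpoly set \<Rightarrow> cpoly set" where
  "sprod X Y = cpoly.span {p * q | p q. p \<in> X \<and> q \<in> Y}"

lemma subspace_sprod [simp]: "cpoly.subspace (sprod X Y)"
  by (simp add: sprod_def)

lemma sprodI: "p \<in> X \<Longrightarrow> q \<in> Y \<Longrightarrow> p * q \<in> sprod X Y"
  unfolding sprod_def by (rule cpoly.span_base) auto

lemma sprod_subset:
  assumes "cpoly.subspace H" "\<And>p q. p \<in> X \<Longrightarrow> q \<in> Y \<Longrightarrow> p * q \<in> H"
  shows "sprod X Y \<subseteq> H"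
  unfolding sprod_def by (rule cpoly.span_minimal) (use assms in auto)

lemma square_space_eq_sprod: "square_space U = sprod U U"
  by (simp add: square_space_def sprod_def)

lemma sprod_forms: "X \<subseteq> forms n a \<Longrightarrow> Y \<subseteq> forms n b \<Longrightarrow> sprod X Y \<subseteq> forms n (a + b)"
  by (rule sprod_subset[OF subspace_forms]) (auto intro: forms_mult)

lemma span_mult_subset:
  assumes "cpoly.subspace H" "\<And>p. p \<in> S \<Longrightarrow> p * q \<in> H" "p \<in> cpoly.span S"
  shows "p * q \<in> H"
proof -
  have "cpoly.span S \<subseteq> {p. q * p \<in> H}"
    using assms(2) by (intro cpoly.span_minimal subspace_mult_vimage[OF assms(1)]) (auto simp: mult.commute)
  then show ?thesis using assms(3) by (auto simp: mult.commute)
qed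

section \<open>Variables, exponent vectors and products of spaces of forms\<close>

definition Var :: "nat \<Rightarrow> cpoly" where
  "Var i = Poly_Mapping.single (Poly_Mapping.single i 1) 1"

lemma mon_degree_zero [simp]: "mon_degree 0 = 0"
  by (simp add: mon_degree_def)

lemma mon_degree_single [simp]: "mon_degree (Poly_Mapping.single i a) = a"
  by (simp add: mon_degree_def)

lemma single_in_exponents: "i < n \<Longrightarrow> Poly_Mapping.single i a \<in> exponents n a"
  by (auto simp: exponents_def)

lemma exponents_add: "a \<in> exponents n d \<Longrightarrow> b \<in> exponents n e \<Longrightarrow> a + b \<in> exponents n (d + e)"
  using keys_add[of a b] by (auto simp: exponents_def mon_degree_add)

lemma exponents_0: "exponents n 0 = {0}"
proof -
  have "m = 0" if "mon_degree m = 0" for m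
    using that by (auto simp: mon_degree_def in_keys_iff intro!: poly_mapping_eqI)
  then show ?thesis by (auto simp: exponents_def)
qed

lemma exponents_remove:
  assumes "m \<in> exponents n d" "0 < Poly_Mapping.lookup m i"
  obtains m' where "i < n" "0 < d" "m' \<in> exponents n (d - 1)" "m = Poly_Mapping.single i 1 + m'"
proof -
  let ?m' = "m - Poly_Mapping.single i 1"
  have eq: "m = Poly_Mapping.single i 1 + ?m'"
    using assms(2) by (auto intro!: poly_mapping_eqI simp: lookup_add lookup_minus lookup_single when_def)
  have "i \<in> Poly_Mapping.keys m" using assms(2) by (simp add: in_keys_iff)
  then have i: "i < n" using assms(1) by (auto simp: exponents_def)
  have d: "d = 1 + mon_degree ?m'"
    using arg_cong[OF eq, of mon_degree] assms(1) by (simp add: mon_degree_add exponents_def)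
  have "Poly_Mapping.keys ?m' \<subseteq> Poly_Mapping.keys m"
    by (auto simp: in_keys_iff lookup_minus)
  then have "?m' \<in> exponents n (d - 1)" using assms(1) d by (auto simp: exponents_def)
  then show ?thesis using that i d eq by simp
qed

lemma exponents_SucE:
  assumes "m \<in> exponents n (Suc d)"
  obtains i m' where "i < n" "m' \<in> exponents n d" "m = Poly_Mapping.single i 1 + m'"
proof -
  have "m \<noteq> 0" using assms by (auto simp: exponents_def)
  then obtain i where "0 < Poly_Mapping.lookup m i"
    using poly_mapping_eqI[of m 0] by auto
  then show ?thesis using exponents_remove[OF assms, of i] that by (metis diff_Suc_1)
qed

lemma single_forms: "m \<in> exponents n d \<Longrightarrow> Poly_Mapping.single m c \<in> forms n d"
  by (auto simp: forms_def)

lemma Var_forms: "i < n \<Longrightarrow> Var i \<in> forms n 1"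
  by (simp add: Var_def single_forms single_in_exponents)

lemma forms_subset_subspaceI:
  assumes "cpoly.subspace H" "\<And>m. m \<in> exponents n d \<Longrightarrow> Poly_Mapping.single m 1 \<in> H"
  shows "forms n d \<subseteq> H"
  using forms_finite_span[of n d] cpoly.span_minimal[OF _ assms(1), of "(\<lambda>m. Poly_Mapping.single m 1) ` exponents n d"]
    assms(2) by blast

lemma single_1_add: "Poly_Mapping.single (a + b) 1 = (Poly_Mapping.single a 1 * Poly_Mapping.single b 1 :: cpoly)"
  by (simp add: mult_single)

lemma forms_Suc_subsetI:
  assumes "cpoly.subspace H" "\<And>i p. i < n \<Longrightarrow> p \<in> forms n d \<Longrightarrow> Var i * p \<in> H"
  shows "forms n (Suc d) \<subseteq> H"
proof (rule forms_subset_subspaceI[OF assms(1)])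
  fix m assume "m \<in> exponents n (Suc d)"
  then obtain i m' where "i < n" "m' \<in> exponents n d" "m = Poly_Mapping.single i 1 + m'"
    by (rule exponents_SucE)
  then show "Poly_Mapping.single m 1 \<in> H"
    using assms(2)[of i "Poly_Mapping.single m' 1"] by (simp add: single_1_add Var_def single_forms)
qed

lemma exponents_split:
  assumes "m \<in> exponents n (a + b)"
  obtains u v where "m = u + v" "u \<in> exponents n a" "v \<in> exponents n b"
proof -
  have "\<exists>u v. m = u + v \<and> u \<in> exponents n a \<and> v \<in> exponents n b"
    using assms
  proof (induction a arbitrary: m)
    case 0 then show ?case by (auto simp: exponents_0 intro!: exI[of _ 0])
  next
    case (Suc a)
    then obtain i m' where m': "i < n" "m' \<in> exponents n (a + b)" "m = Poly_Mapping.single i 1 + m'"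
      by (auto elim: exponents_SucE)
    from Suc.IH[OF this(2)] obtain u v where "m' = u + v" "u \<in> exponents n a" "v \<in> exponents n b" by blast
    then show ?case using m' exponents_add[OF single_in_exponents[of i n 1], of u a]
      by (intro exI[of _ "Poly_Mapping.single i 1 + u"] exI[of _ v]) (auto simp: add.assoc)
  qed
  then show ?thesis using that by blast
qed

lemma sprod_forms_forms: "sprod (forms n a) (forms n b) = forms n (a + b)"
proof (rule antisym)
  show "forms n (a + b) \<subseteq> sprod (forms n a) (forms n b)"
  proof (rule forms_subset_subspaceI[OF subspace_sprod])
    show "Poly_Mapping.single m 1 \<in> sprod (forms n a) (forms n b)" if "m \<in> exponents n (a + b)" for m
      using that by (metis exponents_split single_1_add single_forms sprodI)
  qed
qed (rule sprod_forms; simp)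

lemma sprod_forms_subsetI:
  assumes "cpoly.subspace H" "\<And>p q. p \<in> forms n a \<Longrightarrow> q \<in> forms n b \<Longrightarrow> p * q \<in> H"
  shows "forms n (a + b) \<subseteq> H"
  unfolding sprod_forms_forms[symmetric] using assms by (rule sprod_subset)

lemma forms_0_iff: "p \<in> forms n 0 \<longleftrightarrow> (\<exists>c. p = Poly_Mapping.single 0 c)"
proof
  assume "p \<in> forms n 0"
  then have "Poly_Mapping.lookup p m = 0" if "m \<noteq> 0" for m
    using that by (auto simp: forms_def exponents_0 in_keys_iff)
  then have "p = Poly_Mapping.single 0 (Poly_Mapping.lookup p 0)"
    by (auto intro!: poly_mapping_eqI simp: lookup_single when_def)
  then show "\<exists>c. p = Poly_Mapping.single 0 c" by blast
qed (auto simp: single_forms exponents_0)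

lemma one_forms: "1 \<in> forms n 0"
  unfolding forms_0_iff by (metis single_one)

lemma forms_power: "p \<in> forms n a \<Longrightarrow> p ^ j \<in> forms n (a * j)"
  by (induction j) (auto simp: one_forms intro: forms_mult)

lemma exponents_mono: "n \<le> N \<Longrightarrow> exponents n d \<subseteq> exponents N d"
  by (auto simp: exponents_def)

lemma forms_mono: "n \<le> N \<Longrightarrow> forms n d \<subseteq> forms N d"
  using exponents_mono[of n N d] by (auto simp: forms_def)

section \<open>Evaluation and substitution\<close>

lemma cpoly_sum_monomials:
  fixes p :: cpoly
  shows "p = (\<Sum>m\<in>Poly_Mapping.keys p. Poly_Mapping.single m (Poly_Mapping.lookup p m))"
proof (rule poly_mapping_eqI)
  fix m
  show "Poly_Mapping.lookup p m =
      Poly_Mapping.lookup (\<Sum>m\<in>Poly_Mapping.keys p. Poly_Mapping.single m (Poly_Mapping.lookup p m)) m"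
    by (simp add: lookup_sum lookup_single when_def sum.delta in_keys_iff)
qed

lemma cpoly_induct [case_names single add]:
  fixes p :: cpoly
  assumes "\<And>m c. P (Poly_Mapping.single m c)" "\<And>p q. P p \<Longrightarrow> P q \<Longrightarrow> P (p + q)"
  shows "P p"
proof -
  have "P (\<Sum>m\<in>S. Poly_Mapping.single m (f m))" if "finite S" for S :: "(nat \<Rightarrow>\<^sub>0 nat) set" and f
    using that
  proof (induction S)
    case empty show ?case using assms(1)[of 0 0] by simp
  qed (simp add: assms)
  from this[OF finite_keys] show ?thesis by (subst cpoly_sum_monomials) 
qed

definition monomial_value :: "(nat \<Rightarrow> 'a::comm_ring_1) \<Rightarrow> (nat \<Rightarrow>\<^sub>0 nat) \<Rightarrow> 'a" where
  "monomial_value b m = (\<Prod>i\<in>Poly_Mapping.keys m. b i ^ Poly_Mapping.lookup m i)"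

lemma monomial_value_superset:
  assumes "finite S" "Poly_Mapping.keys m \<subseteq> S"
  shows "monomial_value b m = (\<Prod>i\<in>S. b i ^ Poly_Mapping.lookup m i)"
  unfolding monomial_value_def using assms by (intro prod.mono_neutral_left) (auto simp: in_keys_iff)

lemma monomial_value_add: "monomial_value b (m + m') = monomial_value b m * monomial_value b m'"
proof -
  let ?S = "Poly_Mapping.keys m \<union> Poly_Mapping.keys m'"
  have "monomial_value b k = (\<Prod>i\<in>?S. b i ^ Poly_Mapping.lookup k i)" if "Poly_Mapping.keys k \<subseteq> ?S" for k
    using that by (intro monomial_value_superset) auto
  from this[of m] this[of m'] this[of "m + m'"] show ?thesis
    using keys_add[of m m'] by (simp add: lookup_add power_add prod.distrib)
qed

lemma monomial_value_0 [simp]: "monomial_value b 0 = 1"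
  by (simp add: monomial_value_def)

lemma monomial_value_single [simp]: "monomial_value b (Poly_Mapping.single i a) = b i ^ a"
  by (cases "a = 0") (simp_all add: monomial_value_def)

lemma monomial_value_cong:
  "(\<And>i. i \<in> Poly_Mapping.keys m \<Longrightarrow> b i = b' i) \<Longrightarrow> monomial_value b m = monomial_value b' m"
  by (simp add: monomial_value_def)

text \<open>\<open>h\<close> embeds the coefficients in the target ring. The identity gives
  evaluation at a complex point, the embedding of constants into \<open>cpoly\<close> gives
  substitution of polynomials for the variables.\<close>

locale evaluation_hom =
  fixes h :: "complex \<Rightarrow> 'a::comm_ring_1"
  assumes h_add: "h (x + y) = h x + h y" and h_mult: "h (x * y) = h x * h y" and h_1: "h 1 = 1"
begin

lemma h_0: "h 0 = 0"
  using h_add[of 0 0] by simp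

definition ev :: "(nat \<Rightarrow> 'a) \<Rightarrow> cpoly \<Rightarrow> 'a" where
  "ev b p = (\<Sum>m\<in>Poly_Mapping.keys p. h (Poly_Mapping.lookup p m) * monomial_value b m)"

lemma ev_superset:
  assumes "finite S" "Poly_Mapping.keys p \<subseteq> S"
  shows "ev b p = (\<Sum>m\<in>S. h (Poly_Mapping.lookup p m) * monomial_value b m)"
  unfolding ev_def using assms by (intro sum.mono_neutral_left) (auto simp: in_keys_iff h_0)

lemma ev_add: "ev b (p + q) = ev b p + ev b q"
proof -
  let ?S = "Poly_Mapping.keys p \<union> Poly_Mapping.keys q"
  have "ev b r = (\<Sum>m\<in>?S. h (Poly_Mapping.lookup r m) * monomial_value b m)" if "Poly_Mapping.keys r \<subseteq> ?S" for r
    using that by (intro ev_superset) auto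
  from this[of p] this[of q] this[of "p + q"] show ?thesis
    using keys_add[of p q] by (simp add: lookup_add h_add distrib_right sum.distrib)
qed

lemma ev_single: "ev b (Poly_Mapping.single m c) = h c * monomial_value b m"
  by (cases "c = 0") (simp_all add: ev_def h_0)

lemma ev_mult: "ev b (p * q) = ev b p * ev b q"
proof (induction p rule: cpoly_induct)
  case (single m c)
  show ?case
  proof (induction q rule: cpoly_induct)
    case (single m' c')
    show ?case by (simp add: mult_single ev_single h_mult monomial_value_add mult_ac)
  qed (simp add: distrib_left ev_add)
qed (simp add: distrib_right ev_add)

lemma ev_cscale: "ev b (cscale c p) = h c * ev b p"
  by (simp add: cscale_def ev_mult ev_single)

lemma ev_0 [simp]: "ev b 0 = 0"
  by (simp add: ev_def)

lemma ev_1 [simp]: "ev b 1 = 1"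
  using ev_single[of b 0 1] by (simp add: h_1)

lemma ev_sum: "ev b (sum f S) = (\<Sum>x\<in>S. ev b (f x))"
  by (induction S rule: infinite_finite_induct) (auto simp: ev_add)

lemma ev_minus: "ev b (p - q) = ev b p - ev b q"
  using ev_add[of b "p - q" q] by simp

lemma ev_power: "ev b (p ^ j) = ev b p ^ j"
  by (induction j) (simp_all add: ev_mult)

lemma ev_cong:
  assumes "p \<in> forms n d" "\<And>i. i < n \<Longrightarrow> b i = b' i"
  shows "ev b p = ev b' p"
  unfolding ev_def
  using assms by (intro sum.cong refl arg_cong2[of _ _ _ _ "(*)"] monomial_value_cong)
    (auto simp: forms_def exponents_def subset_iff)

lemma ev_Var [simp]: "ev b (Var i) = b i"
  by (simp add: Var_def ev_single h_1)

end

interpretation point: evaluation_hom "\<lambda>c. c"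
  by unfold_locales auto

lemma poly_eval_eq_ev: "poly_eval p \<xi> = point.ev \<xi> p"
  by (simp add: poly_eval_def point.ev_def monomial_value_def)

interpretation subst: evaluation_hom "Poly_Mapping.single 0 :: complex \<Rightarrow> cpoly"
  by unfold_locales (simp_all add: single_add mult_single)

lemma subst_cscale: "subst.ev b (cscale c p) = cscale c (subst.ev b p)"
  unfolding subst.ev_cscale by (simp add: cscale_def)

lemma monomial_value_forms:
  assumes "\<And>i. i < N \<Longrightarrow> b i \<in> forms n 1" "m \<in> exponents N d"
  shows "monomial_value b m \<in> forms n d"
  using assms(2)
proof (induction d arbitrary: m)
  case 0 then show ?case by (simp add: exponents_0 one_forms)
next
  case (Suc d)
  then obtain i m' where "i < N" "m' \<in> exponents N d" "m = Poly_Mapping.single i 1 + m'"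
    by (auto elim: exponents_SucE)
  then show ?case using forms_mult[OF assms(1) Suc.IH, of i m'] by (simp add: monomial_value_add)
qed

lemma subst_forms:
  assumes "\<And>i. i < N \<Longrightarrow> b i \<in> forms n 1" "p \<in> forms N d"
  shows "subst.ev b p \<in> forms n d"
  unfolding subst.ev_def cscale_def[symmetric]
  using assms by (intro cpoly.subspace_sum cpoly.subspace_scale subspace_forms monomial_value_forms[of N])
    (auto simp: forms_def)

text \<open>With \<open>c = 0\<close> this says that a form of positive degree vanishes at the
  origin, which is how the base points constructed below are seen to be nonzero.\<close>

lemma ev_homogeneous:
  assumes "p \<in> forms n d"
  shows "point.ev (\<lambda>i. c * \<xi> i) p = c ^ d * point.ev \<xi> p"
proof -
  have "monomial_value (\<lambda>i. c * \<xi> i) m = c ^ d * monomial_value \<xi> m" if "m \<in> exponents n d" for m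
  proof -
    have "monomial_value (\<lambda>i. c * \<xi> i) m = (\<Prod>i\<in>Poly_Mapping.keys m. c ^ Poly_Mapping.lookup m i) * monomial_value \<xi> m"
      by (simp add: monomial_value_def power_mult_distrib prod.distrib)
    also have "(\<Prod>i\<in>Poly_Mapping.keys m. c ^ Poly_Mapping.lookup m i) = c ^ d"
      using that by (simp add: exponents_def mon_degree_def flip: power_sum)
    finally show ?thesis .
  qed
  moreover have "Poly_Mapping.keys p \<subseteq> exponents n d" using assms by (simp add: forms_def)
  ultimately show ?thesis
    unfolding point.ev_def sum_distrib_left by (intro sum.cong) (auto simp: mult_ac subset_iff)
qed

section \<open>Regular linear forms\<close>

text \<open>The coefficient vectors run along the curve (1, t, t^2, ...). This one-parameter family
  plays the role of a generic linear form.\<close>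

definition lin :: "nat \<Rightarrow> complex \<Rightarrow> cpoly" where
  "lin n t = (\<Sum>i<n. cscale (t ^ i) (Var i))"

lemma lin_forms: "lin n t \<in> forms n 1"
  unfolding lin_def by (intro cpoly.subspace_sum cpoly.subspace_scale subspace_forms) (metis Var_forms lessThan_iff)

text \<open>A polynomial in t with infinitely many zeros vanishes, here modulo \<open>H\<close>.
  Subtracting the value at one \<open>s\<close> and dividing by \<open>t - s\<close> leaves a
  shorter polynomial with values in \<open>H\<close> on the rest of \<open>T\<close>.\<close>

lemma coefficients_in_subspace:
  assumes "cpoly.subspace H" "infinite T" "\<And>t. t \<in> T \<Longrightarrow> (\<Sum>j<D. cscale (t ^ j) (v j)) \<in> H" "j < D"
  shows "v j \<in> H"
  using assms(2-4)
proof (induction D arbitrary: v T j)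
  case 0 then show ?case by simp
next
  case (Suc D)
  obtain s where s: "s \<in> T" using Suc.prems(1) by (metis finite.emptyI ex_in_conv)
  \<comment> \<open>Horner's recursion for the quotient starts with 0 at the top index;
    \<open>u\<close> is \<open>w\<close> read downwards from there, so that primitive recursion
    applies.\<close>
  define u where "u = rec_nat 0 (\<lambda>m r. v (D - m) + cscale s r)"
  define w where "w i = u (D - i)" for i
  have wD: "w D = 0" by (simp add: w_def u_def)
  have w: "w i = v (Suc i) + cscale s (w (Suc i))" if "i < D" for i
  proof -
    have "D - i = Suc (D - Suc i)" "D - (D - Suc i) = Suc i" using that by auto
    moreover have "u (Suc m) = v (D - m) + cscale s (u m)" for m by (simp add: u_def)
    ultimately show ?thesis by (simp add: w_def)
  qed
  text \<open>Division of \<open>\<Sum>j\<le>D. t\<^sup>j v\<^sub>j\<close> by \<open>t - s\<close>: quotient coefficients \<open>w i\<close>, remainder the value at \<open>s\<close>.\<close>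
  have horner: "(\<Sum>j<Suc D. cscale (t ^ j) (v j)) = v 0 + cscale s (w 0) + cscale (t - s) (\<Sum>i<D. cscale (t ^ i) (w i))" for t
  proof -
    have "cscale (t - s) (\<Sum>i<D. cscale (t ^ i) (w i)) = (\<Sum>i<D. cscale (t ^ Suc i) (w i) - cscale s (cscale (t ^ i) (w i)))"
      by (simp add: cpoly.scale_sum_right cpoly.scale_left_diff_distrib left_diff_distrib)
    also have "\<dots> = (\<Sum>i<D. cscale (t ^ Suc i) (v (Suc i)) + (cscale s (cscale (t ^ Suc i) (w (Suc i))) - cscale s (cscale (t ^ i) (w i))))"
    proof (rule sum.cong[OF refl])
      fix i assume "i \<in> {..<D}"
      then have "w i = v (Suc i) + cscale s (w (Suc i))" using w by simp
      then have "cscale (t ^ Suc i) (w i) = cscale (t ^ Suc i) (v (Suc i)) + cscale s (cscale (t ^ Suc i) (w (Suc i)))"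
        by (simp add: cpoly.scale_right_distrib mult_ac)
      then show "cscale (t ^ Suc i) (w i) - cscale s (cscale (t ^ i) (w i)) =
         cscale (t ^ Suc i) (v (Suc i)) + (cscale s (cscale (t ^ Suc i) (w (Suc i))) - cscale s (cscale (t ^ i) (w i)))"
        by simp
    qed
    also have "\<dots> = (\<Sum>i<D. cscale (t ^ Suc i) (v (Suc i))) + (cscale s (cscale (t ^ D) (w D)) - cscale s (cscale (t ^ 0) (w 0)))"
      by (simp only: sum.distrib sum_lessThan_telescope[of "\<lambda>i. cscale s (cscale (t ^ i) (w i))"])
    finally show ?thesis
      unfolding sum.lessThan_Suc_shift wD by simp
  qed
  have wH: "w i \<in> H" if "i < D" for i
  proof (rule Suc.IH[of "T - {s}"])
    show "infinite (T - {s})" using Suc.prems(1) by simp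
    fix t assume t: "t \<in> T - {s}"
    have "cscale (t - s) (\<Sum>i<D. cscale (t ^ i) (w i)) =
        (\<Sum>j<Suc D. cscale (t ^ j) (v j)) - (\<Sum>j<Suc D. cscale (s ^ j) (v j))"
      unfolding horner by simp
    also have "\<dots> \<in> H" using Suc.prems(2) s t cpoly.subspace_diff[OF assms(1)] by blast
    finally have "cscale (inverse (t - s)) (cscale (t - s) (\<Sum>i<D. cscale (t ^ i) (w i))) \<in> H"
      by (rule cpoly.subspace_scale[OF assms(1)])
    then show "(\<Sum>i<D. cscale (t ^ i) (w i)) \<in> H" using t by simp
  qed (use that in auto)
  have wH': "w i \<in> H" if "i \<le> D" for i
    using wH wD cpoly.subspace_0[OF assms(1)] that by (cases "i = D") auto
  have "v 0 + cscale s (w 0) \<in> H" using horner[of s] Suc.prems(2)[OF s] by simp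
  then have v0: "v 0 \<in> H"
    using cpoly.subspace_diff[OF assms(1) _ cpoly.subspace_scale[OF assms(1) wH'[of 0]], of "v 0 + cscale s (w 0)" s] by simp
  have "v (Suc i) \<in> H" if "i < D" for i
    using w[OF that] cpoly.subspace_diff[OF assms(1) wH'[of i] cpoly.subspace_scale[OF assms(1) wH'[of "Suc i"]], of s] that
    by simp
  then show ?case using v0 Suc.prems(3) by (cases j) auto
qed

text \<open>Induction on the codimension, by contradiction. If only finitely many \<open>t\<close>
  are good, one builds products P of j forms \<open>lin n t\<close> such that U + P A_(d-j) is
  larger than U and still has codimension at least j. For j = d this forces U to have codimension
  above d.\<close>

lemma infinitely_many_regular_lin:
  assumes "cpoly.subspace U" "U \<subseteq> forms n d" "cpoly.dim (forms n d) \<le> cpoly.dim U + d"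
  shows "infinite {t. forms n d \<subseteq> cpoly.span (U \<union> (*) (lin n t) ` forms n (d - 1))}"
  using assms
proof (induction "cpoly.dim (forms n d) - cpoly.dim U" arbitrary: U rule: less_induct)
  case less
  let ?A = "forms n"
  define G where "G = {t. ?A d \<subseteq> cpoly.span (U \<union> (*) (lin n t) ` ?A (d - 1))}"
  show ?case unfolding G_def[symmetric]
  proof
    assume fin: "finite G"
    have "\<exists>P\<in>?A j. \<not> (*) P ` ?A (d - j) \<subseteq> U \<and>
            cpoly.dim (cpoly.span (U \<union> (*) P ` ?A (d - j))) + j \<le> cpoly.dim (?A d)" if "j \<le> d" for j
      using that
    proof (induction j)
      case 0
      have "\<not> ?A d \<subseteq> U"
      proof
        assume "?A d \<subseteq> U"
        then have "G = UNIV" unfolding G_def using cpoly.span_superset by blast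
        then show False using fin infinite_UNIV_char_0 by metis
      qed
      moreover have "U \<union> ?A d = ?A d" using less.prems(2) by blast
      ultimately show ?case by (intro bexI[of _ 1]) (auto simp: one_forms)
    next
      case (Suc j)
      then obtain P where P: "P \<in> ?A j" "\<not> (*) P ` ?A (d - j) \<subseteq> U"
        "cpoly.dim (cpoly.span (U \<union> (*) P ` ?A (d - j))) + j \<le> cpoly.dim (?A d)" by auto
      define U' where "U' = cpoly.span (U \<union> (*) P ` ?A (d - j))"
      have sub: "(*) Q ` ?A (d - i) \<subseteq> ?A d" if "Q \<in> ?A i" "i \<le> d" for Q i
        using forms_mult[OF that(1), of _ "d - i"] that(2) by auto
      have U': "cpoly.subspace U'" "U' \<subseteq> ?A d" "U \<subset> U'"
        using less.prems(2) sub[OF P(1)] Suc.prems P(2) cpoly.span_superset[of "U \<union> (*) P ` ?A (d - j)"]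
        unfolding U'_def by (auto intro!: cpoly.span_minimal[OF _ subspace_forms])
      have dimU: "cpoly.dim U < cpoly.dim U'" "cpoly.dim U' \<le> cpoly.dim (?A d)"
        using dim_less_forms[OF less.prems(1) U'(3,2)] dim_mono_forms[OF U'(2)] by auto
      \<comment> \<open>\<open>U'\<close> has smaller codimension than \<open>U\<close>, so
        infinitely many \<open>t\<close> are good for it.\<close>
      have inf: "infinite {t. ?A d \<subseteq> cpoly.span (U' \<union> (*) (lin n t) ` ?A (d - 1))}"
        by (rule less.hyps) (use U' dimU less.prems(3) in auto)
      \<comment> \<open>For almost all t the product P l_t still leads out of U: otherwise
        extracting coefficients in t puts every P x_i q, and hence P A_(d-j), into U.\<close>
      have "finite {t. (*) (P * lin n t) ` ?A (d - Suc j) \<subseteq> U}" (is "finite ?K")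
      proof (rule ccontr)
        assume K: "infinite ?K"
        have "Var i * q \<in> {f. P * f \<in> U}" if "i < n" "q \<in> ?A (d - Suc j)" for i q
        proof -
          have "P * Var i * q \<in> U"
          proof (rule coefficients_in_subspace[OF less.prems(1) K _ that(1), of "\<lambda>i. P * Var i * q"])
            fix t assume "t \<in> ?K"
            then have "P * lin n t * q \<in> U" using that(2) by blast
            then show "(\<Sum>i<n. cscale (t ^ i) (P * Var i * q)) \<in> U"
              by (simp add: lin_def sum_distrib_left sum_distrib_right cscale_def mult_ac)
          qed
          then show ?thesis by (simp add: mult.assoc)
        qed
        then have "?A (Suc (d - Suc j)) \<subseteq> {f. P * f \<in> U}"
          by (intro forms_Suc_subsetI subspace_mult_vimage[OF less.prems(1)])
        then show False using P(2) Suc.prems by (auto simp: Suc_diff_Suc)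
      qed
      then have "finite (G \<union> ?K)" using fin by blast
      then obtain t where "t \<in> {t. ?A d \<subseteq> cpoly.span (U' \<union> (*) (lin n t) ` ?A (d - 1))} - (G \<union> ?K)"
        by (metis Diff_infinite_finite inf infinite_imp_nonempty ex_in_conv)
      then have t: "?A d \<subseteq> cpoly.span (U' \<union> (*) (lin n t) ` ?A (d - 1))" "t \<notin> G" "t \<notin> ?K"
        unfolding Diff_iff Un_iff mem_Collect_eq de_Morgan_disj by blast+
      define Q where "Q = P * lin n t"
      have Q: "Q \<in> ?A (Suc j)" using forms_mult[OF P(1) lin_forms[of n t]] by (simp add: Q_def)
      define U'' where "U'' = cpoly.span (U \<union> (*) Q ` ?A (d - Suc j))"
      have QP: "Q * f \<in> (*) P ` ?A (d - j)" if "f \<in> ?A (d - Suc j)" for f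
      proof -
        have "lin n t * f \<in> ?A (1 + (d - Suc j))" by (rule forms_mult[OF lin_forms that])
        moreover have "1 + (d - Suc j) = d - j" using Suc.prems by simp
        ultimately show ?thesis by (auto simp: Q_def mult.assoc)
      qed
      have QL: "Q * f \<in> (*) (lin n t) ` ?A (d - 1)" if "f \<in> ?A (d - Suc j)" for f
      proof -
        have "P * f \<in> ?A (j + (d - Suc j))" by (rule forms_mult[OF P(1) that])
        moreover have "j + (d - Suc j) = d - 1" using Suc.prems by simp
        ultimately show ?thesis by (auto simp: Q_def mult_ac intro!: image_eqI[of _ _ "P * f"])
      qed
      have "U'' \<subseteq> U'" unfolding U''_def U'_def using QP by (intro cpoly.span_mono) blast
      \<comment> \<open>Q is a multiple of l_t, so equality would give A_d = U' + l_t A_(d-1) inside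
        U + l_t A_(d-1), making \<open>t\<close> good for \<open>U\<close>.\<close>
      moreover have "U'' \<noteq> U'"
      proof
        assume eq: "U'' = U'"
        have "U \<union> (*) Q ` ?A (d - Suc j) \<subseteq> U \<union> (*) (lin n t) ` ?A (d - 1)" using QL by blast
        then have "U'' \<subseteq> cpoly.span (U \<union> (*) (lin n t) ` ?A (d - 1))"
          unfolding U''_def by (rule cpoly.span_mono)
        then have "U' \<union> (*) (lin n t) ` ?A (d - 1) \<subseteq> cpoly.span (U \<union> (*) (lin n t) ` ?A (d - 1))"
          using eq cpoly.span_superset[of "U \<union> (*) (lin n t) ` ?A (d - 1)"] by blast
        then have "cpoly.span (U' \<union> (*) (lin n t) ` ?A (d - 1)) \<subseteq> cpoly.span (U \<union> (*) (lin n t) ` ?A (d - 1))"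
          by (rule cpoly.span_minimal) simp
        then show False using t unfolding G_def by blast
      qed
      ultimately have "cpoly.dim U'' < cpoly.dim U'"
        using U'(2) by (intro dim_less_forms) (auto simp: U''_def)
      then have "cpoly.dim U'' + Suc j \<le> cpoly.dim (?A d)" using P(3) by (simp add: U'_def)
      moreover have "\<not> (*) Q ` ?A (d - Suc j) \<subseteq> U" using t(3) by (simp add: Q_def)
      ultimately show ?case using Q unfolding U''_def by blast
    qed
    from this[of d] obtain P where P: "P \<in> ?A d" "\<not> (*) P ` ?A 0 \<subseteq> U"
      "cpoly.dim (cpoly.span (U \<union> (*) P ` ?A 0)) + d \<le> cpoly.dim (?A d)" by auto
    have "cpoly.span (U \<union> (*) P ` ?A 0) \<subseteq> ?A d"
      using less.prems(2) forms_mult[OF P(1), of _ 0] by (auto intro!: cpoly.span_minimal[OF _ subspace_forms])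
    moreover have "U \<subset> cpoly.span (U \<union> (*) P ` ?A 0)"
      using P(2) cpoly.span_superset[of "U \<union> (*) P ` ?A 0"] by blast
    ultimately have "cpoly.dim U < cpoly.dim (cpoly.span (U \<union> (*) P ` ?A 0))"
      using dim_less_forms[OF less.prems(1)] by blast
    then show False using P(3) less.prems(3) by simp
  qed
qed

section \<open>Base-point-free subspaces of small codimension\<close>

lemma span_Un_image_lessThan:
  assumes "cpoly.subspace V" "x \<in> cpoly.span (V \<union> g ` {..<j::nat})"
  shows "\<exists>v\<in>V. \<exists>a. x = v + (\<Sum>i<j. cscale (a i) (g i))"
  using assms(2)
proof (induction j arbitrary: x)
  case 0
  then have "x \<in> V" using span_of_subspace[OF assms(1)] by simp
  then show ?case by (intro bexI[of _ x]) auto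
next
  case (Suc j)
  have "V \<union> g ` {..<Suc j} = insert (g j) (V \<union> g ` {..<j})" by (auto simp: lessThan_Suc)
  then obtain k where "x - cscale k (g j) \<in> cpoly.span (V \<union> g ` {..<j})"
    using Suc.prems by (auto simp: cpoly.span_breakdown_eq)
  from Suc.IH[OF this] obtain v a where va: "v \<in> V" "x - cscale k (g j) = v + (\<Sum>i<j. cscale (a i) (g i))" by blast
  have "x = v + (\<Sum>i<Suc j. cscale ((a(j := k)) i) (g i))"
    using va(2) by (simp add: algebra_simps)
  then show ?case using va(1) by blast
qed

text \<open>An eigenvector of "x divided by l" on M/V. As l need not be injective modulo V, this is
  no map; instead a sequence \<open>f j\<close> of successive quotients is chosen. Finite dimension
  makes the l f_j dependent modulo V, and dividing the first relation by X - \<mu> for a root \<mu>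
  leaves the coefficients of the eigenvector.\<close>

lemma pencil_eigenvector:
  fixes l x :: cpoly
  assumes V: "cpoly.subspace V" "V \<subseteq> M" "M \<noteq> V" and M: "cpoly.subspace M" "M \<subseteq> forms n d"
    and M0: "cpoly.subspace M0" and into: "\<And>f. f \<in> M0 \<Longrightarrow> l * f \<in> M" "\<And>f. f \<in> M0 \<Longrightarrow> x * f \<in> M"
    and surj: "\<And>y. y \<in> M \<Longrightarrow> \<exists>f\<in>M0. y - l * f \<in> V"
  shows "\<exists>\<mu>. \<exists>g\<in>M0. l * g \<notin> V \<and> (x - Poly_Mapping.single 0 \<mu> * l) * g \<in> V"
proof -
  have "\<forall>f\<in>M0. \<exists>g\<in>M0. x * f - l * g \<in> V" using surj into(2) by blast
  then obtain nxt where nxt: "\<And>f. f \<in> M0 \<Longrightarrow> nxt f \<in> M0 \<and> x * f - l * nxt f \<in> V"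
    by (metis (no_types, lifting))
  obtain y where y: "y \<in> M" "y \<notin> V" using V by blast
  obtain f0 where f0: "f0 \<in> M0" "y - l * f0 \<in> V" using surj[OF y(1)] by blast
  have lf0: "l * f0 \<notin> V"
    using cpoly.subspace_add[OF V(1) f0(2), of "l * f0"] y(2) by auto
  define f where "f j = (nxt ^^ j) f0" for j
  have fM: "f j \<in> M0" for j by (induction j) (auto simp: f_def f0 nxt)
  have step: "x * f j - l * f (Suc j) \<in> V" for j using nxt[OF fM[of j]] by (simp add: f_def)
  define g where "g j = l * f j" for j
  define E where "E j = cpoly.span (V \<union> g ` {..<j})" for j :: nat
  have EM: "E j \<subseteq> M" for j
    unfolding E_def g_def using V(2) fM into(1) by (intro cpoly.span_minimal[OF _ M(1)]) auto
  have ex: "\<exists>j. g j \<in> E j"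
  proof (rule ccontr)
    assume neg: "\<nexists>j. g j \<in> E j"
    have "j \<le> cpoly.dim (E j)" for j
    proof (induction j)
      case (Suc j)
      have "E j \<subseteq> E (Suc j)" unfolding E_def by (intro cpoly.span_mono) auto
      moreover have "g j \<in> E (Suc j)" unfolding E_def by (intro cpoly.span_base) auto
      ultimately have "E j \<subset> E (Suc j)" using neg by blast
      then have "cpoly.dim (E j) < cpoly.dim (E (Suc j))"
        using EM M(2) by (intro dim_less_forms[of _ _ n d]) (auto simp: E_def)
      then show ?case using Suc by simp
    qed simp
    from this[of "Suc (cpoly.dim M)"] show False
      using dim_mono_forms[OF EM M(2), of "Suc (cpoly.dim M)"] by simp
  qed
  define j where "j = (LEAST j. g j \<in> E j)"
  have gj: "g j \<in> E j" unfolding j_def using ex by (rule LeastI_ex)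
  have min: "g i \<notin> E i" if "i < j" for i using that unfolding j_def by (rule not_less_Least)
  have "E 0 = V" unfolding E_def using span_of_subspace[OF V(1)] by simp
  moreover have "g 0 = l * f0" by (simp add: g_def f_def)
  ultimately have "j \<noteq> 0" using gj lf0 by metis
  then obtain k where k: "j = Suc k" using not0_implies_Suc by blast
  obtain v a where va: "v \<in> V" "g j = v + (\<Sum>i<j. cscale (a i) (g i))"
    using span_Un_image_lessThan[OF V(1) gj[unfolded E_def]] by blast
  \<comment> \<open>The relation as a monic polynomial, the index i standing for the i-th iterate of
    x/l.\<close>
  define P where "P = monom 1 j - (\<Sum>i<j. monom (a i) i)"
  have coeffP: "poly.coeff P i = (if i = j then 1 else if i < j then - a i else 0)" for i
  proof -
    have "poly.coeff (\<Sum>i<j. monom (a i) i) i = (\<Sum>x<j. if x = i then a x else 0)"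
      unfolding coeff_sum by (intro sum.cong) auto
    also have "\<dots> = (if i < j then a i else 0)" by simp
    finally have "poly.coeff P i = (if j = i then 1 else 0) - (if i < j then a i else 0)"
      unfolding P_def coeff_diff coeff_monom by (rule arg_cong)
    then show ?thesis by (cases "i = j"; cases "i < j"; simp)
  qed
  have "degree P \<noteq> 0" using le_degree[of P j] coeffP[of j] \<open>j \<noteq> 0\<close> by simp
  then have "\<not> constant (poly P)" by (simp add: constant_degree)
  then obtain \<mu> where "poly P \<mu> = 0" using fundamental_theorem_of_algebra by blast
  then obtain Q where Q: "P = [:- \<mu>, 1:] * Q" by (auto simp: poly_eq_0_iff_dvd elim: dvdE)
  have PQ: "poly.coeff P (Suc i) = poly.coeff Q i - \<mu> * poly.coeff Q (Suc i)"
    "poly.coeff P 0 = - \<mu> * poly.coeff Q 0" for i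
    by (simp_all add: Q)
  have "P \<noteq> 0" using coeffP[of j] by auto
  then have "Q \<noteq> 0" using Q by auto
  have "degree P = j" using le_degree[of P j] coeffP by (intro antisym degree_le) auto
  moreover have "degree P = degree [:- \<mu>, 1:] + degree Q"
    unfolding Q by (rule degree_mult_eq) (use \<open>Q \<noteq> 0\<close> in auto)
  ultimately have degQ: "degree Q = k" using k by simp
  have Qj: "poly.coeff Q j = 0" using degQ k by (simp add: coeff_eq_0)
  \<comment> \<open>\<open>Q\<close> is monic of degree \<open>k = j - 1\<close>, so l h contains g
    k with coefficient 1 and avoids V by minimality of \<open>j\<close>.\<close>
  have Qk: "poly.coeff Q k = 1" using PQ(1)[of k] coeffP[of j] Qj k by simp
  define h where "h = (\<Sum>i<j. cscale (poly.coeff Q i) (f i))"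
  have hM: "h \<in> M0" unfolding h_def using fM by (intro cpoly.subspace_sum cpoly.subspace_scale M0)
  have lh: "l * h = (\<Sum>i<j. cscale (poly.coeff Q i) (g i))"
    by (simp add: h_def g_def sum_distrib_left cscale_mult_right)
  have "l * h \<notin> V"
  proof
    assume "l * h \<in> V"
    moreover have "(\<Sum>i<k. cscale (poly.coeff Q i) (g i)) \<in> E k"
      unfolding E_def by (intro cpoly.span_sum cpoly.span_scale cpoly.span_base) auto
    moreover have "V \<subseteq> E k" unfolding E_def using cpoly.span_superset by blast
    ultimately have "l * h - (\<Sum>i<k. cscale (poly.coeff Q i) (g i)) \<in> E k"
      unfolding E_def by (intro cpoly.span_diff) auto
    moreover have "l * h = (\<Sum>i<k. cscale (poly.coeff Q i) (g i)) + g k" using lh Qk k by simp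
    ultimately show False using min[of k] k by simp
  qed
  moreover have "(x - Poly_Mapping.single 0 \<mu> * l) * h \<in> V"
  proof -
    \<comment> \<open>P = (X - \<mu>) Q, read along the sequence g with X shifting the index; by the
      relation the left side is the element \<open>v\<close> of V.\<close>
    have "(\<Sum>i\<le>j. cscale (poly.coeff P i) (g i)) =
        cscale (- \<mu> * poly.coeff Q 0) (g 0) + (\<Sum>i<j. cscale (poly.coeff Q i - \<mu> * poly.coeff Q (Suc i)) (g (Suc i)))"
      unfolding lessThan_Suc_atMost[symmetric] sum.lessThan_Suc_shift by (simp add: PQ)
    also have "\<dots> = (\<Sum>i<j. cscale (poly.coeff Q i) (g (Suc i))) - cscale \<mu> (\<Sum>i<Suc j. cscale (poly.coeff Q i) (g i))"
      unfolding sum.lessThan_Suc_shift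
      by (simp add: cpoly.scale_left_diff_distrib sum_subtractf cpoly.scale_right_distrib cpoly.scale_sum_right)
    also have "(\<Sum>i<Suc j. cscale (poly.coeff Q i) (g i)) = l * h" by (simp add: Qj lh)
    finally have e1: "(\<Sum>i\<le>j. cscale (poly.coeff P i) (g i)) = (\<Sum>i<j. cscale (poly.coeff Q i) (g (Suc i))) - cscale \<mu> (l * h)" .
    have "(\<Sum>i\<le>j. cscale (poly.coeff P i) (g i)) = g j - (\<Sum>i<j. cscale (a i) (g i))"
      unfolding lessThan_Suc_atMost[symmetric] by (simp add: coeffP sum_negf)
    then have e2: "(\<Sum>i\<le>j. cscale (poly.coeff P i) (g i)) = v" using va(2) by simp
    have "(x - Poly_Mapping.single 0 \<mu> * l) * h = (\<Sum>i<j. cscale (poly.coeff Q i) (x * f i)) - cscale \<mu> (l * h)"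
      unfolding left_diff_distrib cscale_def[of \<mu>] mult.assoc
      by (simp add: h_def sum_distrib_left cscale_mult_right)
    also have "\<dots> = (\<Sum>i<j. cscale (poly.coeff Q i) (x * f i - g (Suc i))) + v"
      using e1 e2 by (simp add: cpoly.scale_right_diff_distrib sum_subtractf)
    also have "\<dots> \<in> V"
      using step va(1) by (intro cpoly.subspace_add cpoly.subspace_sum cpoly.subspace_scale V) (simp_all add: g_def)
    finally show ?thesis .
  qed
  ultimately show ?thesis using hM by blast
qed

text \<open>Rank-nullity: by \<open>stab\<close>, sending the class of l f to that of y f is well
  defined on M/V. It kills the nonzero class of l g, so its image has smaller dimension than
  M/V.\<close>

lemma pencil_not_surjective:
  fixes l y :: cpoly
  assumes V: "cpoly.subspace V" "V \<subseteq> M" and M: "cpoly.subspace M" "M \<subseteq> forms n d"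
    and M0: "cpoly.subspace M0" and into: "\<And>f. f \<in> M0 \<Longrightarrow> l * f \<in> M"
    and surj: "\<And>z. z \<in> M \<Longrightarrow> \<exists>f\<in>M0. z - l * f \<in> V"
    and stab: "\<And>f. f \<in> M0 \<Longrightarrow> l * f \<in> V \<Longrightarrow> y * f \<in> V"
    and g: "g \<in> M0" "l * g \<notin> V" "y * g \<in> V"
  shows "\<not> M \<subseteq> cpoly.span (V \<union> (*) y ` M0)"
proof
  assume sub: "M \<subseteq> cpoly.span (V \<union> (*) y ` M0)"
  define W where "W = cpoly.span (insert (l * g) V)"
  have W: "W \<subseteq> M" unfolding W_def using V(2) into[OF g(1)] by (intro cpoly.span_minimal[OF _ M(1)]) auto
  have "V \<subset> W" unfolding W_def using cpoly.span_superset[of "insert (l * g) V"] g(2) by blast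
  then have dimW: "cpoly.dim V < cpoly.dim W" using W M(2) V(1) by (intro dim_less_forms[of _ _ n d]) auto
  obtain S where S: "S \<subseteq> M" "finite S" "card S = cpoly.dim M - cpoly.dim W" "M \<subseteq> cpoly.span (W \<union> S)"
    using complement_exists[OF W M(2)] by metis
  have "\<forall>s\<in>S. \<exists>f\<in>M0. s - l * f \<in> V" using S(1) surj by blast
  then obtain r where r: "\<And>s. s \<in> S \<Longrightarrow> r s \<in> M0 \<and> s - l * r s \<in> V" by metis
  define H where "H = cpoly.span (V \<union> (\<lambda>s. y * r s) ` S)"
  have VH: "V \<subseteq> H" unfolding H_def using cpoly.span_superset by blast
  have sH: "cpoly.subspace H" by (simp add: H_def)
  \<comment> \<open>The elements with some quotient by l that y carries into H. \<open>K\<close>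
    contains V, l g and \<open>S\<close>, hence all of M.\<close>
  define K where "K = {z. \<exists>f\<in>M0. z - l * f \<in> V \<and> y * f \<in> H}"
  have K: "cpoly.subspace K"
  proof (rule cpoly.subspaceI)
    show "0 \<in> K" unfolding K_def using cpoly.subspace_0 V(1) M0 sH by (intro CollectI bexI[of _ 0]) auto
    show "z + z' \<in> K" if zK: "z \<in> K" "z' \<in> K" for z z'
    proof -
      obtain f f' where f: "f \<in> M0" "z - l * f \<in> V" "y * f \<in> H" "f' \<in> M0" "z' - l * f' \<in> V" "y * f' \<in> H"
        using zK unfolding K_def by blast
      have "(z + z') - l * (f + f') = (z - l * f) + (z' - l * f')" by (simp add: distrib_left)
      then have "(z + z') - l * (f + f') \<in> V" using cpoly.subspace_add[OF V(1) f(2,5)] by metis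
      moreover have "y * (f + f') \<in> H" using cpoly.subspace_add[OF sH f(3,6)] by (simp add: distrib_left)
      ultimately show ?thesis unfolding K_def using cpoly.subspace_add[OF M0 f(1,4)] by blast
    qed
    show "cscale c z \<in> K" if zK: "z \<in> K" for c z
    proof -
      obtain f where f: "f \<in> M0" "z - l * f \<in> V" "y * f \<in> H" using zK unfolding K_def by blast
      have "cscale c (z - l * f) \<in> V" "cscale c (y * f) \<in> H" "cscale c f \<in> M0"
        using f cpoly.subspace_scale V(1) sH M0 by auto
      then show ?thesis unfolding K_def
        by (intro CollectI bexI[of _ "cscale c f"]) (auto simp: cscale_mult_right cpoly.scale_right_diff_distrib)
    qed
  qed
  have "V \<subseteq> K" unfolding K_def using cpoly.subspace_0[OF M0] cpoly.subspace_0[OF sH] by (auto intro!: bexI[of _ 0])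
  moreover have "l * g \<in> K" unfolding K_def using g VH cpoly.subspace_0[OF V(1)] by (auto intro!: bexI[of _ g])
  ultimately have WK: "W \<subseteq> K" unfolding W_def by (intro cpoly.span_minimal[OF _ K]) auto
  have "y * r s \<in> H" if "s \<in> S" for s unfolding H_def using that by (intro cpoly.span_base) blast
  then have "S \<subseteq> K" unfolding K_def using r by auto
  then have MK: "M \<subseteq> K" using S(4) cpoly.span_minimal[OF _ K, of "W \<union> S"] WK by blast
  have "y * f \<in> H" if f: "f \<in> M0" for f
  proof -
    obtain f' where f': "f' \<in> M0" "l * f - l * f' \<in> V" "y * f' \<in> H"
      using MK into[OF f] unfolding K_def by blast
    have "y * (f - f') \<in> V" using stab[of "f - f'"] f' f cpoly.subspace_diff[OF M0] by (simp add: right_diff_distrib)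
    then have "y * (f - f') + y * f' \<in> H" using cpoly.subspace_add[OF sH _ f'(3)] VH by blast
    then show ?thesis by (simp add: right_diff_distrib)
  qed
  then have "V \<union> (*) y ` M0 \<subseteq> H" using VH by blast
  then have "M \<subseteq> H" using sub cpoly.span_minimal[OF _ sH] by blast
  then have "cpoly.dim M \<le> cpoly.dim V + card ((\<lambda>s. y * r s) ` S)"
    using V(2) M(2) S(2) by (intro dim_le_dim_add_card[of V n d]) (auto simp: H_def)
  also have "\<dots> \<le> cpoly.dim V + card S" using card_image_le[OF S(2)] by simp
  finally show False using S(3) dimW dim_mono_forms[OF W M(2)] by linarith
qed

text \<open>By \<open>reg\<close> and \<open>inj\<close> each x_i/l is an endomorphism of A_d/U, and
  these commute. On A_d/V, for V maximal among proper invariant subspaces containing U, they act as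
  scalars \<mu>_i. So A_d/V is spanned by l^d, and the quotient map is evaluation at \<mu>, which
  therefore vanishes on U.\<close>

lemma base_point_of_regular_lin:
  assumes U: "cpoly.subspace U" "U \<subseteq> forms n d" "U \<noteq> forms n d" and d: "d \<ge> 1" and l: "l \<in> forms n 1"
    and reg: "forms n d \<subseteq> cpoly.span (U \<union> (*) l ` forms n (d - 1))"
    and inj: "\<And>f. f \<in> forms n d \<Longrightarrow> l * f \<in> sprod (forms n 1) U \<Longrightarrow> f \<in> U"
  shows "\<not> base_point_free n U"
proof -
  let ?A = "forms n d" and ?B = "forms n (d - 1)"
  have AB: "p * f \<in> ?A" if "p \<in> forms n 1" "f \<in> ?B" for p f
    using forms_mult[OF that] d by simp
  have regD: "\<exists>f\<in>?B. y - l * f \<in> U" if y: "y \<in> ?A" for y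
  proof -
    obtain u f where "u \<in> U" "f \<in> ?B" "y = u + l * f"
      using y reg in_span_Un_mult_iff[OF U(1) subspace_forms, of y l n "d - 1"] by blast
    then show ?thesis by (intro bexI[of _ f]) simp_all
  qed
  \<comment> \<open>Invariance of V/U under all x_i/l, phrased without choosing quotients.\<close>
  define stable where "stable V \<longleftrightarrow> cpoly.subspace V \<and> U \<subseteq> V \<and> V \<subset> ?A \<and>
      (\<forall>f\<in>?B. \<forall>i<n. l * f \<in> V \<longrightarrow> Var i * f \<in> V)" for V
  have VarU: "Var i * f \<in> U" if "f \<in> ?B" "i < n" "l * f \<in> U" for f i
  proof -
    have "Var i * (l * f) \<in> sprod (forms n 1) U" using that by (intro sprodI Var_forms)
    then show ?thesis using inj[of "Var i * f"] AB[OF Var_forms that(1)] that(2) by (simp add: mult_ac)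
  qed
  then have "stable U" using U by (auto simp: stable_def)
  moreover have "\<forall>V. stable V \<longrightarrow> cpoly.dim V < Suc (cpoly.dim ?A)"
    by (auto simp: stable_def less_Suc_eq_le intro: dim_mono_forms)
  ultimately obtain V where V: "stable V" "\<And>V'. stable V' \<Longrightarrow> cpoly.dim V' \<le> cpoly.dim V"
    using ex_has_greatest_nat[of stable U "cpoly.dim" "Suc (cpoly.dim ?A)"] by blast
  have V1: "cpoly.subspace V" "U \<subseteq> V" "V \<subset> ?A" and V2: "\<And>f i. f \<in> ?B \<Longrightarrow> i < n \<Longrightarrow> l * f \<in> V \<Longrightarrow> Var i * f \<in> V"
    using V(1) by (auto simp: stable_def)
  have regV: "\<exists>f\<in>?B. y - l * f \<in> V" if "y \<in> ?A" for y using regD[OF that] V1(2) by blast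
  have ex: "\<exists>\<mu>. \<forall>f\<in>?B. Var i * f - cscale \<mu> (l * f) \<in> V" if i: "i < n" for i
  proof -
    obtain \<mu> g where g: "g \<in> ?B" "l * g \<notin> V" "(Var i - Poly_Mapping.single 0 \<mu> * l) * g \<in> V"
      using pencil_eigenvector[of V ?A n d ?B l "Var i"] V1 subspace_forms AB l regV Var_forms[OF i] by blast
    define y where "y = Var i - Poly_Mapping.single 0 \<mu> * l"
    have y_eq: "y * f = Var i * f - cscale \<mu> (l * f)" for f
      by (simp add: y_def left_diff_distrib cscale_def mult.assoc)
    have yA: "y * f \<in> ?A" if "f \<in> ?B" for f
      unfolding y_eq using AB[OF l that] AB[OF Var_forms[OF i] that]
      by (intro cpoly.subspace_diff cpoly.subspace_scale subspace_forms)
    have yV: "y * f \<in> V" if "f \<in> ?B" "l * f \<in> V" for f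
      unfolding y_eq using V2[OF that(1) i that(2)] that(2) V1(1)
      by (intro cpoly.subspace_diff cpoly.subspace_scale)
    \<comment> \<open>V plus the image of x_i/l - \<mu>. It is proper because of the eigenvector and
      invariant because the operators commute, so maximality gives V' = V.\<close>
    define V' where "V' = cpoly.span (V \<union> (*) y ` ?B)"
    have notA: "\<not> ?A \<subseteq> V'"
      unfolding V'_def
      by (rule pencil_not_surjective[of V ?A n d ?B l y g])
         (use V1 subspace_forms AB l regV yV g in \<open>auto simp: y_def\<close>)
    have V'A: "V' \<subseteq> ?A" unfolding V'_def using V1(3) yA by (intro cpoly.span_minimal[OF _ subspace_forms]) auto
    have VV': "V \<subseteq> V'" unfolding V'_def using cpoly.span_superset by blast
    have sV': "cpoly.subspace V'" by (simp add: V'_def)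
    have "Var j * f \<in> V'" if f: "f \<in> ?B" "l * f \<in> V'" and j: "j < n" for f j
    proof -
      obtain v g0 where v: "v \<in> V" "g0 \<in> ?B" "l * f = v + y * g0"
        using f(2) in_span_Un_mult_iff[OF V1(1) subspace_forms, of "l * f" y n "d - 1"] unfolding V'_def by blast
      obtain v0 where v0: "v0 \<in> ?B" "v - l * v0 \<in> U" using regD[of v] v(1) V1(3) by blast
      obtain g1 where g1: "g1 \<in> ?B" "Var i * g0 - l * g1 \<in> U" using regD[OF AB[OF Var_forms[OF i] v(2)]] by blast
      obtain g2 where g2: "g2 \<in> ?B" "Var j * g0 - l * g2 \<in> U" using regD[OF AB[OF Var_forms[OF j] v(2)]] by blast
      text \<open>The endomorphisms of \<open>forms n d / U\<close> given by \<open>x\<^sub>i\<close> and \<open>x\<^sub>j\<close> divided by \<open>l\<close> commute.\<close>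
      have comm: "Var j * g1 - Var i * g2 \<in> U"
      proof (rule inj)
        show "Var j * g1 - Var i * g2 \<in> ?A"
          using AB[OF Var_forms[OF j] g1(1)] AB[OF Var_forms[OF i] g2(1)] by (rule cpoly.subspace_diff[OF subspace_forms])
        have "l * (Var j * g1 - Var i * g2) = Var i * (Var j * g0 - l * g2) - Var j * (Var i * g0 - l * g1)"
          by (simp add: algebra_simps)
        also have "\<dots> \<in> sprod (forms n 1) U"
          by (rule cpoly.subspace_diff[OF subspace_sprod sprodI[OF Var_forms[OF i] g2(2)] sprodI[OF Var_forms[OF j] g1(2)]])
        finally show "l * (Var j * g1 - Var i * g2) \<in> sprod (forms n 1) U" .
      qed
      \<comment> \<open>\<open>f\<close> differs from v0 + g1 - \<mu> g0 by an \<open>r\<close> with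
        l r in U. Then x_j r is in U, and x_j f can be rewritten through v0, g1 and g2.\<close>
      define r where "r = f - v0 - g1 + cscale \<mu> g0"
      have rB: "r \<in> ?B" unfolding r_def using f(1) v0(1) g1(1) v(2)
        by (intro cpoly.subspace_diff cpoly.subspace_add cpoly.subspace_scale subspace_forms)
      have "l * r = (v - l * v0) + (Var i * g0 - l * g1)"
        using v(3) unfolding r_def y_eq by (simp add: right_diff_distrib distrib_left cscale_mult_right)
      also have "\<dots> \<in> U" using v0(2) g1(2) U(1) by (intro cpoly.subspace_add)
      finally have rU: "Var j * r \<in> U" using VarU[OF rB j] by blast
      have "v - (v - l * v0) \<in> V" 
        by (rule cpoly.subspace_diff[OF V1(1) v(1) subsetD[OF V1(2) v0(2)]])
      then have v0V: "Var j * v0 \<in> V" using V2[OF v0(1) j] by simp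
      have "Var j * f = Var j * r + Var j * v0 + (Var j * g1 - Var i * g2) - cscale \<mu> (Var j * g0 - l * g2) + y * g2"
        unfolding r_def y_eq
        by (simp add: right_diff_distrib distrib_left cscale_mult_right cpoly.scale_right_diff_distrib)
      also have "\<dots> \<in> V'"
      proof -
        have y: "y * g2 \<in> V'" unfolding V'_def using g2(1) by (intro cpoly.span_base) blast
        have mem: "Var j * r \<in> V'" "Var j * v0 \<in> V'" "Var j * g1 - Var i * g2 \<in> V'" "Var j * g0 - l * g2 \<in> V'"
          using rU v0V comm g2(2) V1(2) VV' by auto
        show ?thesis
          by (rule cpoly.subspace_add[OF sV' cpoly.subspace_diff[OF sV' cpoly.subspace_add[OF sV'
              cpoly.subspace_add[OF sV' mem(1,2)] mem(3)] cpoly.subspace_scale[OF sV' mem(4)]] y])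
      qed
      finally show ?thesis .
    qed
    then have "stable V'" unfolding stable_def using sV' VV' V1(2) V'A notA by blast
    then have eq: "V = V'" using V(2) VV' V'A V1(1) by (intro subspace_dim_equal[of _ _ n d]) auto
    have "Var i * f - cscale \<mu> (l * f) \<in> V'" if "f \<in> ?B" for f
      unfolding V'_def y_eq[symmetric] using that by (intro cpoly.span_base) blast
    then show ?thesis using eq by metis
  qed
  then obtain \<mu> where \<mu>: "\<And>i f. i < n \<Longrightarrow> f \<in> ?B \<Longrightarrow> Var i * f - cscale (\<mu> i) (l * f) \<in> V" by metis
  \<comment> \<open>Exchanges the variables x_i of m for \<mu>_i l, one at a time.\<close>
  have mono: "Poly_Mapping.single m 1 * l ^ (d - j) - cscale (monomial_value \<mu> m) (l ^ d) \<in> V"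
    if "m \<in> exponents n j" "j \<le> d" for m j
    using that
  proof (induction j arbitrary: m)
    case 0 then show ?case using cpoly.subspace_0[OF V1(1)] by (simp add: exponents_0)
  next
    case (Suc j)
    then obtain i m' where m': "i < n" "m' \<in> exponents n j" "m = Poly_Mapping.single i 1 + m'"
      by (auto elim: exponents_SucE)
    define f where "f = Poly_Mapping.single m' 1 * l ^ (d - Suc j)"
    have "f \<in> forms n (j + 1 * (d - Suc j))"
      unfolding f_def by (intro forms_mult single_forms m' forms_power l)
    moreover have "j + 1 * (d - Suc j) = d - 1" using Suc.prems by simp
    ultimately have f: "f \<in> ?B" by simp
    have "l * f = Poly_Mapping.single m' 1 * l ^ Suc (d - Suc j)" by (simp add: f_def mult_ac)
    then have lf: "l * f = Poly_Mapping.single m' 1 * l ^ (d - j)" using Suc.prems by (simp add: Suc_diff_Suc)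
    have "Poly_Mapping.single m 1 * l ^ (d - Suc j) - cscale (monomial_value \<mu> m) (l ^ d) =
      (Var i * f - cscale (\<mu> i) (l * f)) + cscale (\<mu> i) (l * f - cscale (monomial_value \<mu> m') (l ^ d))"
      by (simp add: f_def m'(3) single_1_add Var_def mult.assoc monomial_value_add cpoly.scale_right_diff_distrib)
    also have "\<dots> \<in> V"
      unfolding lf using \<mu>[OF m'(1) f] Suc.IH[OF m'(2)] Suc.prems
      by (intro cpoly.subspace_add cpoly.subspace_scale V1(1)) (auto simp: lf)
    finally show ?case .
  qed
  have ev: "f - cscale (point.ev \<mu> f) (l ^ d) \<in> V" if f: "f \<in> ?A" for f
  proof -
    have "?A \<subseteq> {f. f - cscale (point.ev \<mu> f) (l ^ d) \<in> V}"
    proof (rule forms_subset_subspaceI)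
      show "cpoly.subspace {f. f - cscale (point.ev \<mu> f) (l ^ d) \<in> V}"
      proof (rule cpoly.subspaceI; clarsimp)
        show "0 \<in> V" using cpoly.subspace_0[OF V1(1)] .
        fix x y c
        assume x: "x - cscale (point.ev \<mu> x) (l ^ d) \<in> V"
        { assume y: "y - cscale (point.ev \<mu> y) (l ^ d) \<in> V"
          show "x + y - cscale (point.ev \<mu> (x + y)) (l ^ d) \<in> V"
            using cpoly.subspace_add[OF V1(1) x y] by (simp add: point.ev_add cpoly.scale_left_distrib algebra_simps) }
        show "cscale c x - cscale (point.ev \<mu> (cscale c x)) (l ^ d) \<in> V"
          using cpoly.subspace_scale[OF V1(1) x, of c] by (simp add: point.ev_cscale cpoly.scale_right_diff_distrib)
      qed
      show "Poly_Mapping.single m 1 \<in> {f. f - cscale (point.ev \<mu> f) (l ^ d) \<in> V}" if "m \<in> exponents n d" for m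
        using mono[OF that] by (simp add: point.ev_single)
    qed
    then show ?thesis using f by blast
  qed
  have lV: "l ^ d \<notin> V"
  proof
    assume lV: "l ^ d \<in> V"
    have "?A \<subseteq> V"
    proof
      fix f assume "f \<in> ?A"
      from cpoly.subspace_add[OF V1(1) ev[OF this] cpoly.subspace_scale[OF V1(1) lV, of "point.ev \<mu> f"]]
      show "f \<in> V" by simp
    qed
    then show False using V1(3) by blast
  qed
  have key: "cscale c (l ^ d) \<in> V \<Longrightarrow> c = 0" for c
    using cpoly.subspace_scale[OF V1(1), of "cscale c (l ^ d)" "inverse c"] lV by (cases "c = 0") auto
  have "point.ev \<mu> f = 0" if "f \<in> U" for f
  proof (rule key)
    have "f - (f - cscale (point.ev \<mu> f) (l ^ d)) \<in> V"
      by (rule cpoly.subspace_diff[OF V1(1) subsetD[OF V1(2) that] ev[OF subsetD[OF U(2) that]]])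
    then show "cscale (point.ev \<mu> f) (l ^ d) \<in> V" by simp
  qed
  \<comment> \<open>At the origin l^d evaluates to 0, which would put l^d itself into V.\<close>
  moreover have "\<exists>i<n. \<mu> i \<noteq> 0"
  proof (rule ccontr)
    assume neg: "\<not> (\<exists>i<n. \<mu> i \<noteq> 0)"
    have lA: "l ^ d \<in> ?A" using forms_power[OF l, of d] by simp
    have "point.ev \<mu> (l ^ d) = point.ev (\<lambda>i. 0 * \<mu> i) (l ^ d)"
      using neg by (intro point.ev_cong[OF lA]) auto
    also have "\<dots> = 0" using ev_homogeneous[OF lA, of 0 \<mu>] d by simp
    finally have "l ^ d \<in> V" using ev[OF lA] by simp
    then show False using lV by simp
  qed
  ultimately show ?thesis unfolding base_point_free_def poly_eval_eq_ev by blast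
qed

text \<open>For regular l one has A_(d+1) = A_1 U + l A_d, so l maps A_d/U onto A_(d+1)/A_1 U. If
  the codimension did not drop, this surjection would be injective, and
  \<open>base_point_of_regular_lin\<close> would yield a base point.\<close>

lemma codim_forms_1_mult_less:
  assumes U: "cpoly.subspace U" "U \<subseteq> forms n d" "base_point_free n U" and d: "d \<ge> 1"
    and codim: "cpoly.dim (forms n d) \<le> cpoly.dim U + d" and "U \<noteq> forms n d"
  shows "codim_in (forms n (Suc d)) (sprod (forms n 1) U) < codim_in (forms n d) U"
proof (rule ccontr)
  let ?U1 = "sprod (forms n 1) U"
  assume neg: "\<not> codim_in (forms n (Suc d)) ?U1 < codim_in (forms n d) U"
  have U1: "?U1 \<subseteq> forms n (Suc d)" using sprod_forms[OF order_refl U(2), of 1] by simp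
  obtain t where t: "forms n d \<subseteq> cpoly.span (U \<union> (*) (lin n t) ` forms n (d - 1))"
    using infinite_imp_nonempty[OF infinitely_many_regular_lin[OF U(1,2) codim]] by blast
  define l where "l = lin n t"
  have l: "l \<in> forms n 1" by (simp add: l_def lin_forms[simplified])
  have "f \<in> U" if f: "f \<in> forms n d" "l * f \<in> ?U1" for f
  proof (rule ccontr)
    assume fU: "f \<notin> U"
    define W where "W = cpoly.span (insert f U)"
    have W: "W \<subseteq> forms n d" unfolding W_def using f(1) U(2) by (intro cpoly.span_minimal[OF _ subspace_forms]) auto
    have "U \<subset> W" unfolding W_def using cpoly.span_superset[of "insert f U"] fU by blast
    then have dimW: "cpoly.dim U < cpoly.dim W" using W U(1) by (intro dim_less_forms[of _ _ n d]) auto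
    obtain S where S: "S \<subseteq> forms n d" "finite S" "card S = cpoly.dim (forms n d) - cpoly.dim W"
      "forms n d \<subseteq> cpoly.span (W \<union> S)"
      using complement_exists[OF W order_refl] by metis
    define H where "H = cpoly.span (?U1 \<union> (*) l ` S)"
    have sH: "cpoly.subspace H" by (simp add: H_def)
    have U1H: "?U1 \<subseteq> H" unfolding H_def using cpoly.span_superset by blast
    have pre: "cpoly.subspace {g. l * g \<in> H}" by (rule subspace_mult_vimage[OF sH])
    have "insert f U \<subseteq> {g. l * g \<in> H}" using f(2) U1H sprodI[OF l] by blast
    then have "W \<subseteq> {g. l * g \<in> H}" unfolding W_def by (rule cpoly.span_minimal[OF _ pre])
    moreover have "S \<subseteq> {g. l * g \<in> H}" unfolding H_def by (auto intro: cpoly.span_base)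
    ultimately have lH: "forms n d \<subseteq> {g. l * g \<in> H}"
      using S(4) cpoly.span_minimal[OF _ pre, of "W \<union> S"] by blast
    have "forms n (Suc d) \<subseteq> H"
    proof (rule forms_Suc_subsetI[OF sH])
      fix i p assume i: "i < n" and p: "p \<in> forms n d"
      obtain u g where ug: "u \<in> U" "g \<in> forms n (d - 1)" "p = u + l * g"
        using p t in_span_Un_mult_iff[OF U(1) subspace_forms, of p l n "d - 1"] unfolding l_def by blast
      have "Var i * g \<in> forms n d" using forms_mult[OF Var_forms[OF i] ug(2)] d by simp
      then have "l * (Var i * g) \<in> H" using lH by blast
      moreover have "Var i * u \<in> H" using U1H sprodI[OF Var_forms[OF i] ug(1)] by blast
      ultimately show "Var i * p \<in> H" using cpoly.subspace_add[OF sH] ug(3) by (simp add: distrib_left mult_ac)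
    qed
    then have "cpoly.dim (forms n (Suc d)) \<le> cpoly.dim ?U1 + card ((*) l ` S)"
      unfolding H_def using S(2) by (intro dim_le_dim_add_card[OF U1]) auto
    then have "cpoly.dim (forms n (Suc d)) \<le> cpoly.dim ?U1 + card S"
      using card_image_le[OF S(2), of "(*) l"] by simp
    moreover have "cpoly.dim W \<le> cpoly.dim (forms n d)" by (rule dim_mono_forms[OF W order_refl])
    ultimately show False using neg S(3) dimW unfolding codim_in_def by linarith
  qed
  then show False
    using base_point_of_regular_lin[OF U(1,2) \<open>U \<noteq> forms n d\<close> d l] t U(3) unfolding l_def by blast
qed

lemma base_point_free_sprod:
  assumes "base_point_free n U"
  shows "base_point_free n (sprod (forms n 1) U)"
  unfolding base_point_free_def
proof clarify
  fix \<xi> i assume i: "i < n" "\<xi> i \<noteq> 0" and 0: "\<forall>f\<in>sprod (forms n 1) U. poly_eval f \<xi> = 0"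
  obtain f where f: "f \<in> U" "poly_eval f \<xi> \<noteq> 0" using assms i unfolding base_point_free_def by blast
  have "poly_eval (Var i * f) \<xi> = 0" using 0 sprodI[OF Var_forms[OF i(1)] f(1)] by blast
  then show False using f(2) i(2) by (simp add: poly_eval_eq_ev point.ev_mult)
qed

text \<open>Multiplication by A_1 preserves base-point-freeness and lowers a positive codimension.
  The condition that the codimension is at most the degree persists, since the degree grows.\<close>

lemma base_point_free_generates:
  assumes U: "cpoly.subspace U" "U \<subseteq> forms n d" "base_point_free n U" and d: "d \<ge> 1"
    and codim: "codim_in (forms n d) U \<le> j" "codim_in (forms n d) U \<le> d"
  shows "sprod (forms n j) U = forms n (j + d)"
proof -
  let ?c = "codim_in (forms n d) U"
  define W where "W = rec_nat U (\<lambda>_. sprod (forms n 1))"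
  have W0: "W 0 = U" and WS: "W (Suc j) = sprod (forms n 1) (W j)" for j by (simp_all add: W_def)
  have W: "cpoly.subspace (W j) \<and> W j \<subseteq> forms n (d + j) \<and> base_point_free n (W j) \<and>
     codim_in (forms n (d + j)) (W j) \<le> ?c - j" for j
  proof (induction j)
    case 0 then show ?case using U by (simp add: W0)
  next
    case (Suc j)
    have sub: "W (Suc j) \<subseteq> forms n (d + Suc j)"
      using sprod_forms[of "forms n 1" n 1 "W j" "d + j"] Suc by (simp add: WS)
    have "codim_in (forms n (d + Suc j)) (W (Suc j)) \<le> ?c - Suc j"
    proof (cases "W j = forms n (d + j)")
      case True
      then have "W (Suc j) = forms n (d + Suc j)" using sprod_forms_forms[of n 1 "d + j"] by (simp add: WS)
      then show ?thesis by (simp add: codim_in_def)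
    next
      case False
      have "cpoly.dim (forms n (d + j)) \<le> cpoly.dim (W j) + (d + j)"
        using Suc codim(2) unfolding codim_in_def by linarith
      from codim_forms_1_mult_less[of "W j" n "d + j", OF _ _ _ _ this False]
      have "codim_in (forms n (d + Suc j)) (W (Suc j)) < codim_in (forms n (d + j)) (W j)"
        using Suc d by (simp add: WS)
      then show ?thesis using Suc by linarith
    qed
    then show ?case using sub Suc base_point_free_sprod by (simp add: WS)
  qed
  have "W j \<subseteq> sprod (forms n j) U" for j
  proof (induction j)
    case 0
    show ?case using sprodI[OF one_forms, of _ U] by (auto simp: W0)
  next
    case (Suc j)
    have "sprod (forms n 1) (W j) \<subseteq> sprod (forms n (Suc j)) U"
    proof (rule sprod_subset[OF subspace_sprod])
      fix p q assume p: "p \<in> forms n 1" and "q \<in> W j"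
      then have "q \<in> cpoly.span {p * q | p q. p \<in> forms n j \<and> q \<in> U}" using Suc by (auto simp: sprod_def)
      then have "q * p \<in> sprod (forms n (Suc j)) U"
      proof (rule span_mult_subset[OF subspace_sprod, rotated])
        fix r assume "r \<in> {p * q | p q. p \<in> forms n j \<and> q \<in> U}"
        then obtain a u where "r = a * u" "a \<in> forms n j" "u \<in> U" by blast
        then show "r * p \<in> sprod (forms n (Suc j)) U"
          using sprodI[OF forms_mult[OF p, of a j], of u U] by (simp add: mult_ac)
      qed
      then show "p * q \<in> sprod (forms n (Suc j)) U" by (simp add: mult.commute)
    qed
    then show ?case by (simp add: WS)
  qed
  moreover have "W j = forms n (d + j)"
    using W[of j] codim(1) by (intro subspace_dim_equal[of _ _ n "d + j"]) (auto simp: codim_in_def)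
  ultimately show ?thesis using sprod_forms[OF order_refl U(2), of j] by (metis add.commute antisym)
qed

section \<open>Reduction of the number of variables\<close>

lemma of_nat_mult_cpoly: "of_nat c * p = cscale (of_nat c) (p :: cpoly)"
  by (simp add: cscale_def)

text \<open>Polarisation: a variable is split off a power by taking the coefficient of t in (t x_i +
  b)^e, which is e x_i b^(e-1).\<close>

lemma forms_subset_span_powers: "forms n d \<subseteq> cpoly.span {b ^ d | b. b \<in> forms n 1}"
proof -
  define H where "H = cpoly.span {b ^ d | b. b \<in> forms n 1}"
  have H: "cpoly.subspace H" by (simp add: H_def)
  have mono: "Poly_Mapping.single m 1 * b ^ (d - j) \<in> H" if "m \<in> exponents n j" "j \<le> d" "b \<in> forms n 1" for m j b
    using that
  proof (induction j arbitrary: m b)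
    case 0
    then show ?case unfolding H_def by (auto simp: exponents_0 intro!: cpoly.span_base)
  next
    case (Suc j)
    then obtain i m' where m': "i < n" "m' \<in> exponents n j" "m = Poly_Mapping.single i 1 + m'"
      by (auto elim: exponents_SucE)
    define e where "e = d - j"
    have e: "e = Suc (d - Suc j)" using Suc.prems(2) by (simp add: e_def)
    define v where "v r = cscale (of_nat (e choose r)) (Poly_Mapping.single m' 1 * Var i ^ r * b ^ (e - r))" for r
    have "v 1 \<in> H"
    proof (rule coefficients_in_subspace[OF H infinite_UNIV_char_0])
      fix t :: complex
      have "cscale t (Var i) + b \<in> forms n 1"
        by (intro cpoly.subspace_add cpoly.subspace_scale subspace_forms Var_forms m' Suc.prems)
      then have "Poly_Mapping.single m' 1 * (cscale t (Var i) + b) ^ e \<in> H"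
        unfolding e_def using Suc.prems by (intro Suc.IH m') auto
      moreover have "cscale t (Var i) ^ r = cscale (t ^ r) (Var i ^ r)" for r
        by (induction r) (simp_all add: cscale_mult_left[symmetric] cscale_mult_right[symmetric] mult.commute)
      then have "Poly_Mapping.single m' 1 * (cscale t (Var i) + b) ^ e = (\<Sum>r<Suc e. cscale (t ^ r) (v r))"
        unfolding binomial_ring sum_distrib_left v_def lessThan_Suc_atMost
        by (intro sum.cong refl) (simp add: of_nat_mult_cpoly cscale_mult_left[symmetric] cscale_mult_right[symmetric] mult_ac)
      ultimately show "(\<Sum>r<Suc e. cscale (t ^ r) (v r)) \<in> H" by simp
    qed (use e in simp)
    then have "cscale (inverse (of_nat e)) (v 1) \<in> H" by (rule cpoly.subspace_scale[OF H])
    moreover have "(of_nat e :: complex) \<noteq> 0" using e by (metis of_nat_neq_0)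
    ultimately have "Poly_Mapping.single m' 1 * Var i * b ^ (e - 1) \<in> H" by (simp add: v_def)
    then show ?case using e by (simp add: m'(3) single_1_add Var_def mult_ac)
  qed
  show ?thesis unfolding H_def[symmetric]
  proof (rule forms_subset_subspaceI[OF H])
    \<comment> \<open>All variables are split off and the remaining power has exponent 0, so
      \<open>b = 0\<close> serves.\<close>
    show "Poly_Mapping.single m 1 \<in> H" if "m \<in> exponents n d" for m
      using mono[OF that _ cpoly.subspace_0[OF subspace_forms]] by simp
  qed
qed

text \<open>As d-th powers span A_d, a basis of U extends to one of A_d by powers alone; their
  number is the codimension.\<close>

lemma exists_power_complement:
  assumes "cpoly.subspace U" "U \<subseteq> forms n d" "codim_in (forms n d) U = k"
  obtains l where "\<And>i. i < k \<Longrightarrow> l i \<in> forms n 1" "\<And>f. f \<in> forms n d \<Longrightarrow> \<exists>c. f - (\<Sum>i<k. cscale (c i) (l i ^ d)) \<in> U"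
proof -
  let ?P = "{b ^ d | b. b \<in> forms n 1}"
  obtain B where B: "B \<subseteq> U" "cpoly.independent B" "U \<subseteq> cpoly.span B" "finite B" "card B = cpoly.dim U"
    by (rule finite_basis_forms[OF assms(2)])
  have P: "?P \<subseteq> forms n d" using forms_power[of _ n 1 d] by auto
  obtain B' where B': "B \<subseteq> B'" "B' \<subseteq> B \<union> ?P" "cpoly.independent B'" "B \<union> ?P \<subseteq> cpoly.span B'"
    using cpoly.maximal_independent_subset_extend[of B "B \<union> ?P"] B(2) by blast
  have B'f: "B' \<subseteq> forms n d" using B'(2) B(1) assms(2) P by blast
  have "?P \<subseteq> cpoly.span B'" using B'(4) by blast
  then have "forms n d \<subseteq> cpoly.span B'"
    using forms_subset_span_powers[of n d] cpoly.span_minimal[of ?P "cpoly.span B'"] by auto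
  then have "card B' = cpoly.dim (forms n d)" using B'f B'(3) by (intro cpoly.basis_card_eq_dim)
  then have card: "card (B' - B) = k" "finite (B' - B)"
    using card_Diff_subset[OF B(4) B'(1)] B(5) assms(3) forms_independent_finite[OF B'(3) B'f] by (auto simp: codim_in_def)
  then obtain h where h: "bij_betw h {..<k} (B' - B)"
    using ex_bij_betw_nat_finite[OF card(2)] by (auto simp: atLeast0LessThan)
  have "\<exists>b. b \<in> forms n 1 \<and> h i = b ^ d" if "i < k" for i
    using bij_betwE[OF h] that B'(2) by blast
  then obtain l where l: "\<And>i. i < k \<Longrightarrow> l i \<in> forms n 1 \<and> h i = l i ^ d" by metis
  show ?thesis
  proof (rule that)
    show "l i \<in> forms n 1" if "i < k" for i using l that by blast
    fix f assume f: "f \<in> forms n d"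
    have "B' \<subseteq> U \<union> h ` {..<k}" using h B(1) by (auto simp: bij_betw_def)
    then have "f \<in> cpoly.span (U \<union> h ` {..<k})"
      using cpoly.span_mono[of B' "U \<union> h ` {..<k}"] f \<open>forms n d \<subseteq> cpoly.span B'\<close> by blast
    then obtain u c where "u \<in> U" "f = u + (\<Sum>i<k. cscale (c i) (h i))"
      using span_Un_image_lessThan[OF assms(1)] by blast
    then show "\<exists>c. f - (\<Sum>i<k. cscale (c i) (l i ^ d)) \<in> U"
      using l by (intro exI[of _ c]) simp
  qed
qed

text \<open>
  The substitution \<open>x\<^sub>i \<mapsto> l i\<close> for \<open>i < k\<close> maps onto \<open>forms n d\<close> modulo \<open>U\<close>. A base point \<open>\<xi>\<close> of the
  preimage of \<open>U\<close> under it (predicate \<open>bp\<close>) therefore induces a functional \<open>\<phi> \<xi>\<close> on \<open>forms n d / U\<close>,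
  which is evaluation at a point only if that point is a base point of \<open>U\<close>.
\<close>

locale power_complement =
  fixes n d k :: nat and U :: "cpoly set" and l :: "nat \<Rightarrow> cpoly" and c :: "cpoly \<Rightarrow> nat \<Rightarrow> complex"
  assumes U: "cpoly.subspace U" "U \<subseteq> forms n d" and d: "d \<ge> 1" and kd: "k \<le> d"
    and codim: "codim_in (forms n d) U = k"
    and bpf: "base_point_free n U"
    and l: "\<And>i. i < k \<Longrightarrow> l i \<in> forms n 1"
    and c: "\<And>f. f \<in> forms n d \<Longrightarrow> f - (\<Sum>i<k. cscale (c f i) (l i ^ d)) \<in> U"
begin

definition bp :: "(nat \<Rightarrow> complex) \<Rightarrow> bool" where
  "bp \<xi> \<longleftrightarrow> (\<forall>g\<in>forms k d. subst.ev l g \<in> U \<longrightarrow> point.ev \<xi> g = 0)"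

definition \<phi> :: "(nat \<Rightarrow> complex) \<Rightarrow> cpoly \<Rightarrow> complex" where
  "\<phi> \<xi> f = (\<Sum>i<k. c f i * \<xi> i ^ d)"

text \<open>A preimage of f modulo U under the substitution.\<close>

definition rep :: "cpoly \<Rightarrow> cpoly" where
  "rep f = (\<Sum>i<k. cscale (c f i) (Var i ^ d))"

lemma rep_forms: "k \<le> N \<Longrightarrow> rep f \<in> forms N d"
  unfolding rep_def using forms_power[OF Var_forms, of _ N d]
  by (intro cpoly.subspace_sum cpoly.subspace_scale subspace_forms) auto

lemma ev_rep: "point.ev \<xi> (rep f) = \<phi> \<xi> f"
  by (simp add: rep_def \<phi>_def point.ev_sum point.ev_cscale point.ev_power)

lemma subst_rep:
  assumes "\<And>i. i < k \<Longrightarrow> b i = l i"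
  shows "subst.ev b (rep f) = (\<Sum>i<k. cscale (c f i) (l i ^ d))"
  using assms by (simp add: rep_def subst.ev_sum subst_cscale subst.ev_power)

text \<open>\<open>c\<close> is a mere choice of coefficients and need not be linear. For a base
  point the value is the same for every preimage \<open>g\<close> of f modulo U, and linearity of
  \<phi> follows from this.\<close>

lemma \<phi>_eq:
  assumes "bp \<xi>" "f \<in> forms n d" "g \<in> forms k d" "f - subst.ev l g \<in> U"
  shows "\<phi> \<xi> f = point.ev \<xi> g"
proof -
  have "subst.ev l (g - rep f) = (f - (\<Sum>i<k. cscale (c f i) (l i ^ d))) - (f - subst.ev l g)"
    by (simp add: subst.ev_minus subst_rep)
  also have "\<dots> \<in> U" using cpoly.subspace_diff[OF U(1) c[OF assms(2)] assms(4)] .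
  finally have "point.ev \<xi> (g - rep f) = 0"
    using assms(1) cpoly.subspace_diff[OF subspace_forms assms(3) rep_forms[OF order_refl]] unfolding bp_def by blast
  then show ?thesis by (simp add: point.ev_minus ev_rep)
qed

lemma c_rep: "f \<in> forms n d \<Longrightarrow> f - subst.ev l (rep f) \<in> U"
  using c by (simp add: subst_rep)

lemma \<phi>_add:
  assumes "bp \<xi>" "f \<in> forms n d" "f' \<in> forms n d"
  shows "\<phi> \<xi> (f + f') = \<phi> \<xi> f + \<phi> \<xi> f'"
proof -
  have "(f + f') - subst.ev l (rep f + rep f') = (f - subst.ev l (rep f)) + (f' - subst.ev l (rep f'))"
    by (simp add: subst.ev_add)
  then have "(f + f') - subst.ev l (rep f + rep f') \<in> U"
    using cpoly.subspace_add[OF U(1) c_rep[OF assms(2)] c_rep[OF assms(3)]] by metis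
  from \<phi>_eq[OF assms(1) cpoly.subspace_add[OF subspace_forms assms(2,3)] cpoly.subspace_add[OF subspace_forms] this]
  show ?thesis by (simp add: rep_forms point.ev_add ev_rep)
qed

lemma \<phi>_scale:
  assumes "bp \<xi>" "f \<in> forms n d"
  shows "\<phi> \<xi> (cscale a f) = a * \<phi> \<xi> f"
proof -
  have "cscale a f - subst.ev l (cscale a (rep f)) = cscale a (f - subst.ev l (rep f))"
    by (simp add: subst_cscale cpoly.scale_right_diff_distrib)
  then have "cscale a f - subst.ev l (cscale a (rep f)) \<in> U"
    using cpoly.subspace_scale[OF U(1) c_rep[OF assms(2)]] by metis
  from \<phi>_eq[OF assms(1) cpoly.subspace_scale[OF subspace_forms assms(2)] cpoly.subspace_scale[OF subspace_forms] this]
  show ?thesis by (simp add: rep_forms point.ev_cscale ev_rep)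
qed

lemma \<phi>_U: "bp \<xi> \<Longrightarrow> u \<in> U \<Longrightarrow> \<phi> \<xi> u = 0"
  using \<phi>_eq[of \<xi> u 0] U(2) cpoly.subspace_0[OF subspace_forms] by auto

lemma \<phi>_power:
  assumes "bp \<xi>" "j < k"
  shows "\<phi> \<xi> (l j ^ d) = \<xi> j ^ d"
proof -
  have "l j ^ d \<in> forms n d" "Var j ^ d \<in> forms k d"
    using forms_power[OF l[OF assms(2)], of d] forms_power[OF Var_forms[OF assms(2)], of d] by auto
  then show ?thesis
    using \<phi>_eq[OF assms(1), of "l j ^ d" "Var j ^ d"] cpoly.subspace_0[OF U(1)]
    by (simp add: subst.ev_power point.ev_power)
qed

text \<open>Otherwise \<open>b \<mapsto> \<phi> \<xi> (l j ^ (d - 1) * b) / \<xi> j ^ (d - 1)\<close> is a linear functional whose \<open>d\<close>-th power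
  is \<open>\<phi> \<xi>\<close> on \<open>d\<close>-th powers, so it is a base point of \<open>U\<close> extending \<open>\<xi>\<close>.\<close>

lemma exists_separating_form:
  assumes bp: "bp \<xi>" and j: "j < k" "\<xi> j \<noteq> 0"
  shows "\<exists>b\<in>forms n 1. \<phi> \<xi> (l j ^ (d - 1) * b) ^ d \<noteq> \<xi> j ^ ((d - 1) * d) * \<phi> \<xi> (b ^ d)"
proof (rule ccontr)
  assume "\<not> ?thesis"
  then have eq: "\<phi> \<xi> (l j ^ (d - 1) * b) ^ d = \<xi> j ^ ((d - 1) * d) * \<phi> \<xi> (b ^ d)" if "b \<in> forms n 1" for b
    using that by blast
  define \<tau> where "\<tau> b = \<phi> \<xi> (l j ^ (d - 1) * b) / \<xi> j ^ (d - 1)" for b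
  have lb: "l j ^ (d - 1) * b \<in> forms n d" if "b \<in> forms n 1" for b
    using forms_mult[OF forms_power[OF l[OF j(1)], of "d - 1"] that] d by simp
  have \<tau>: "\<tau> b ^ d = \<phi> \<xi> (b ^ d)" if "b \<in> forms n 1" for b
    using eq[OF that] j(2) by (simp add: \<tau>_def power_divide power_mult[symmetric])
  define \<eta> where "\<eta> i = \<tau> (Var i)" for i
  have "forms n 1 \<subseteq> {b. b \<in> forms n 1 \<and> \<tau> b = point.ev \<eta> b}"
  proof (rule forms_subset_subspaceI)
    show "cpoly.subspace {b. b \<in> forms n 1 \<and> \<tau> b = point.ev \<eta> b}"
    proof (rule cpoly.subspaceI; clarify)
      show "0 \<in> forms n 1 \<and> \<tau> 0 = point.ev \<eta> 0"
        using \<phi>_scale[OF bp, of 0 0] cpoly.subspace_0[OF subspace_forms] by (simp add: \<tau>_def)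
      fix x y a
      assume x: "x \<in> forms n 1" "\<tau> x = point.ev \<eta> x"
      { assume y: "y \<in> forms n 1" "\<tau> y = point.ev \<eta> y"
        show "x + y \<in> forms n 1 \<and> \<tau> (x + y) = point.ev \<eta> (x + y)"
          using x y cpoly.subspace_add[OF subspace_forms x(1) y(1)] \<phi>_add[OF bp lb[OF x(1)] lb[OF y(1)]]
          by (simp add: \<tau>_def distrib_left point.ev_add add_divide_distrib) }
      show "cscale a x \<in> forms n 1 \<and> \<tau> (cscale a x) = point.ev \<eta> (cscale a x)"
        using x cpoly.subspace_scale[OF subspace_forms x(1)] \<phi>_scale[OF bp lb[OF x(1)], of a]
        by (simp add: \<tau>_def cscale_mult_right point.ev_cscale flip: times_divide_eq_right)
    qed
    fix m assume "m \<in> exponents n 1"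
    then obtain i where "i < n" "m = Poly_Mapping.single i 1"
      using exponents_SucE[of m n 0] by (auto simp: exponents_0)
    then show "Poly_Mapping.single m 1 \<in> {b. b \<in> forms n 1 \<and> \<tau> b = point.ev \<eta> b}"
      using Var_forms[of i n] by (simp add: \<eta>_def Var_def point.ev_single)
  qed
  then have \<tau>ev: "\<tau> b = point.ev \<eta> b" if "b \<in> forms n 1" for b using that by blast
  \<comment> \<open>Both sides are linear in f and agree on d-th powers, which span.\<close>
  have "forms n d \<subseteq> {f. f \<in> forms n d \<and> \<phi> \<xi> f = point.ev \<eta> f}"
  proof (rule order_trans[OF forms_subset_span_powers], rule cpoly.span_minimal)
    show "{b ^ d | b. b \<in> forms n 1} \<subseteq> {f. f \<in> forms n d \<and> \<phi> \<xi> f = point.ev \<eta> f}"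
    proof clarify
      fix b assume b: "b \<in> forms n 1"
      show "b ^ d \<in> forms n d \<and> \<phi> \<xi> (b ^ d) = point.ev \<eta> (b ^ d)"
        using forms_power[OF b, of d] \<tau>[OF b] \<tau>ev[OF b] by (simp add: point.ev_power)
    qed
    show "cpoly.subspace {f. f \<in> forms n d \<and> \<phi> \<xi> f = point.ev \<eta> f}"
    proof (rule cpoly.subspaceI; clarify)
      show "0 \<in> forms n d \<and> \<phi> \<xi> 0 = point.ev \<eta> 0"
        using \<phi>_scale[OF bp, of 0 0] cpoly.subspace_0[OF subspace_forms] by simp
      fix x y a
      assume x: "x \<in> forms n d" "\<phi> \<xi> x = point.ev \<eta> x"
      { assume y: "y \<in> forms n d" "\<phi> \<xi> y = point.ev \<eta> y"
        show "x + y \<in> forms n d \<and> \<phi> \<xi> (x + y) = point.ev \<eta> (x + y)"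
          using x y cpoly.subspace_add[OF subspace_forms x(1) y(1)] \<phi>_add[OF bp x(1) y(1)] by (simp add: point.ev_add) }
      show "cscale a x \<in> forms n d \<and> \<phi> \<xi> (cscale a x) = point.ev \<eta> (cscale a x)"
        using x cpoly.subspace_scale[OF subspace_forms x(1)] \<phi>_scale[OF bp x(1), of a] by (simp add: point.ev_cscale)
    qed
  qed
  then have ev: "\<phi> \<xi> f = point.ev \<eta> f" if "f \<in> forms n d" for f using that by blast
  have "\<forall>u\<in>U. poly_eval u \<eta> = 0" using \<phi>_U[OF bp] ev U(2) unfolding poly_eval_eq_ev by (metis subsetD)
  moreover have "\<exists>i<n. \<eta> i \<noteq> 0"
  proof (rule ccontr)
    assume neg: "\<not> (\<exists>i<n. \<eta> i \<noteq> 0)"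
    have lA: "l j ^ d \<in> forms n d" using forms_power[OF l[OF j(1)], of d] by simp
    have "point.ev \<eta> (l j ^ d) = point.ev (\<lambda>i. 0 * \<eta> i) (l j ^ d)" using neg by (intro point.ev_cong[OF lA]) auto
    also have "\<dots> = 0" using ev_homogeneous[OF lA, of 0 \<eta>] d by simp
    finally show False using ev[OF lA] \<phi>_power[OF bp j(1)] j(2) by simp
  qed
  ultimately show False using bpf unfolding base_point_free_def by blast
qed

text \<open>The factor may be 0, so symmetry requires the left vector to be nonzero in its first k
  coordinates.\<close>

definition parallel :: "(nat \<Rightarrow> complex) \<Rightarrow> (nat \<Rightarrow> complex) \<Rightarrow> bool" where
  "parallel \<xi> \<xi>' \<longleftrightarrow> (\<exists>a. \<forall>i<k. \<xi> i = a * \<xi>' i)"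

lemma separating_linear_form:
  assumes "\<not> parallel \<xi> \<xi>'" "\<exists>i<k. \<xi>' i \<noteq> 0"
  shows "\<exists>h\<in>forms k 1. point.ev \<xi>' h = 0 \<and> point.ev \<xi> h \<noteq> 0"
proof -
  obtain i where i: "i < k" "\<xi>' i \<noteq> 0" using assms(2) by blast
  then obtain j where j: "j < k" "\<xi> j \<noteq> \<xi> i / \<xi>' i * \<xi>' j" using assms(1) unfolding parallel_def by blast
  show ?thesis
    by (rule bexI[of _ "cscale (\<xi>' i) (Var j) - cscale (\<xi>' j) (Var i)"])
       (use i j in \<open>auto simp: point.ev_minus point.ev_cscale field_simps
          intro!: cpoly.subspace_diff cpoly.subspace_scale subspace_forms Var_forms[simplified]\<close>)
qed

text \<open>Given k + 1 such points, \<open>k \<le> d\<close> leaves room for forms of degree d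
  vanishing at all but one of them. Their images are independent modulo U, so U would have
  codimension above k.\<close>

lemma card_base_points:
  assumes "\<And>a. a < m \<Longrightarrow> bp (\<Xi> a)" "\<And>a. a < m \<Longrightarrow> \<exists>i<k. \<Xi> a i \<noteq> 0"
    and "\<And>a b. a < m \<Longrightarrow> b < m \<Longrightarrow> a \<noteq> b \<Longrightarrow> \<not> parallel (\<Xi> a) (\<Xi> b)"
  shows "m \<le> k"
proof (rule ccontr)
  assume "\<not> m \<le> k"
  then have km: "k < m" by simp
  have "\<exists>f\<in>forms k d. point.ev (\<Xi> a) f \<noteq> 0 \<and> (\<forall>b\<le>k. b \<noteq> a \<longrightarrow> point.ev (\<Xi> b) f = 0)" if a: "a \<le> k" for a
  proof -
    have "\<exists>h\<in>forms k 1. point.ev (\<Xi> b) h = 0 \<and> point.ev (\<Xi> a) h \<noteq> 0" if "b \<le> k" "b \<noteq> a" for b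
      using separating_linear_form[of "\<Xi> a" "\<Xi> b"] assms(2)[of b] assms(3)[of a b] a that km by auto
    then obtain h where h: "\<And>b. b \<le> k \<Longrightarrow> b \<noteq> a \<Longrightarrow> h b \<in> forms k 1 \<and> point.ev (\<Xi> b) (h b) = 0 \<and> point.ev (\<Xi> a) (h b) \<noteq> 0"
      by metis
    obtain j where j: "j < k" "\<Xi> a j \<noteq> 0" using assms(2)[of a] a km by auto
    have prodf: "(\<Prod>b\<in>S. h b) \<in> forms k (card S)" "point.ev \<xi> (\<Prod>b\<in>S. h b) = (\<Prod>b\<in>S. point.ev \<xi> (h b))"
      if "finite S" "S \<subseteq> {..k} - {a}" for S \<xi>
    proof -
      show "(\<Prod>b\<in>S. h b) \<in> forms k (card S)" using that
      proof (induction S)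
        case empty then show ?case by (simp add: one_forms)
      next
        case (insert x S)
        then have "h x \<in> forms k 1" using h[of x] by auto
        from forms_mult[OF this insert.IH] insert show ?case by simp
      qed
      show "point.ev \<xi> (\<Prod>b\<in>S. h b) = (\<Prod>b\<in>S. point.ev \<xi> (h b))"
        using that(1) by (induction S) (auto simp: point.ev_mult)
    qed
    define S where "S = {..k} - {a}"
    \<comment> \<open>One linear factor for each of the k other points, filled up to degree d by a
      variable that is nonzero at the a-th point.\<close>
    define f where "f = (\<Prod>b\<in>S. h b) * Var j ^ (d - k)"
    have S: "finite S" "card S = k" using a by (auto simp: S_def)
    have "f \<in> forms k (k + 1 * (d - k))"
      unfolding f_def using forms_mult[OF prodf(1) forms_power[OF Var_forms[OF j(1)]], of S "d - k"] S by (simp add: S_def)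
    then have "f \<in> forms k d" using kd by simp
    moreover have "point.ev (\<Xi> a) f \<noteq> 0"
    proof -
      have "(\<Prod>b\<in>S. point.ev (\<Xi> a) (h b)) \<noteq> 0" using h S(1) by (auto simp: S_def)
      then show ?thesis using j prodf(2)[OF S(1)] by (simp add: f_def point.ev_mult point.ev_power S_def)
    qed
    moreover have "point.ev (\<Xi> b) f = 0" if "b \<le> k" "b \<noteq> a" for b
    proof -
      have "(\<Prod>b'\<in>S. point.ev (\<Xi> b) (h b')) = 0"
        using h[OF that] that S(1) by (intro prod_zero) (auto simp: S_def)
      then show ?thesis using prodf(2)[OF S(1)] by (simp add: f_def point.ev_mult S_def)
    qed
    ultimately show ?thesis by blast
  qed
  then obtain F where F: "\<And>a. a \<le> k \<Longrightarrow> F a \<in> forms k d \<and> point.ev (\<Xi> a) (F a) \<noteq> 0 \<and> (\<forall>b\<le>k. b \<noteq> a \<longrightarrow> point.ev (\<Xi> b) (F a) = 0)"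
    by metis
  define W where "W j = cpoly.span (U \<union> (\<lambda>i. subst.ev l (F i)) ` {..<j})" for j :: nat
  have WA: "W j \<subseteq> forms n d" if "j \<le> Suc k" for j
    unfolding W_def using U(2) F subst_forms[of k l n] l that by (intro cpoly.span_minimal subspace_forms) auto
  have "cpoly.dim U + j \<le> cpoly.dim (W j)" if "j \<le> Suc k" for j
    using that
  proof (induction j)
    case 0
    then show ?case by (simp add: W_def)
  next
    case (Suc j)
    \<comment> \<open>A dependence would give a form that maps into U without vanishing at the base
      point \<Xi> j.\<close>
    have "subst.ev l (F j) \<notin> W j"
    proof
      assume "subst.ev l (F j) \<in> W j"
      then obtain u a where ua: "u \<in> U" "subst.ev l (F j) = u + (\<Sum>i<j. cscale (a i) (subst.ev l (F i)))"
        using span_Un_image_lessThan[OF U(1)] unfolding W_def by blast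
      define g where "g = F j - (\<Sum>i<j. cscale (a i) (F i))"
      have "g \<in> forms k d" unfolding g_def using F Suc.prems
        by (intro cpoly.subspace_diff cpoly.subspace_sum cpoly.subspace_scale subspace_forms) auto
      moreover have "subst.ev l g = u" using ua(2) by (simp add: g_def subst.ev_minus subst.ev_sum subst_cscale)
      ultimately have "point.ev (\<Xi> j) g = 0" using assms(1)[of j] ua(1) Suc.prems km unfolding bp_def by auto
      moreover have "point.ev (\<Xi> j) g = point.ev (\<Xi> j) (F j)"
        using F Suc.prems by (simp add: g_def point.ev_minus point.ev_sum point.ev_cscale)
      ultimately show False using F[of j] Suc.prems by simp
    qed
    moreover have "W j \<subseteq> W (Suc j)" "subst.ev l (F j) \<in> W (Suc j)"
      unfolding W_def by (auto intro!: cpoly.span_mono intro: cpoly.span_base)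
    ultimately have "cpoly.dim (W j) < cpoly.dim (W (Suc j))"
      using WA[OF Suc.prems] by (intro dim_less_forms[of _ _ n d]) (auto simp: W_def)
    then show ?case using Suc by simp
  qed
  from this[of "Suc k"] have "cpoly.dim U + Suc k \<le> cpoly.dim (forms n d)"
    using dim_mono_forms[OF WA[of "Suc k"] order_refl] by simp
  then show False using codim_add_dim[OF U(2)] codim by simp
qed

lemma \<phi>_scale_point:
  assumes "\<And>i. i < k \<Longrightarrow> \<zeta> i = a * \<xi> i"
  shows "\<phi> \<zeta> f = a ^ d * \<phi> \<xi> f"
  using assms by (simp add: \<phi>_def sum_distrib_left power_mult_distrib mult_ac)

text \<open>\<open>card_base_points\<close> bounds the length of lists of pairwise non-parallel base
  points. In a longest one, maximality makes every further base point a nonzero multiple of a listed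
  one.\<close>

lemma exists_base_point_list:
  obtains \<Xi> m where "m \<le> k" "\<And>a. a < m \<Longrightarrow> bp (\<Xi> a)" "\<And>a. a < m \<Longrightarrow> \<exists>i<k. \<Xi> a i \<noteq> 0"
    "\<And>\<zeta>. bp \<zeta> \<Longrightarrow> \<exists>i<k. \<zeta> i \<noteq> 0 \<Longrightarrow> \<exists>a<m. \<exists>s. s \<noteq> 0 \<and> (\<forall>i<k. \<zeta> i = s * \<Xi> a i)"
proof -
  define Q where "Q m \<longleftrightarrow> (\<exists>\<Xi>. (\<forall>a<m. bp (\<Xi> a) \<and> (\<exists>i<k. \<Xi> a i \<noteq> 0)) \<and>
     (\<forall>a<m. \<forall>b<m. a \<noteq> b \<longrightarrow> \<not> parallel (\<Xi> a) (\<Xi> b)))" for m :: nat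
  have bound: "m \<le> k" if "Q m" for m
    using that card_base_points unfolding Q_def by blast
  have "Q 0" unfolding Q_def by simp
  define m where "m = (GREATEST m. Q m)"
  have "Q m" unfolding m_def by (rule GreatestI_nat[of Q 0 k]) (use \<open>Q 0\<close> bound in auto)
  then obtain \<Xi> where X: "\<And>a. a < m \<Longrightarrow> bp (\<Xi> a) \<and> (\<exists>i<k. \<Xi> a i \<noteq> 0)"
    "\<And>a b. a < m \<Longrightarrow> b < m \<Longrightarrow> a \<noteq> b \<Longrightarrow> \<not> parallel (\<Xi> a) (\<Xi> b)" unfolding Q_def by blast
  have sym: "parallel \<xi> \<xi>'" if par: "parallel \<xi>' \<xi>" and nz: "\<exists>i<k. \<xi>' i \<noteq> 0" for \<xi> \<xi>'
  proof -
    obtain a where a: "\<forall>i<k. \<xi>' i = a * \<xi> i" using par unfolding parallel_def by blast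
    then have "a \<noteq> 0" using nz by auto
    then show ?thesis using a unfolding parallel_def by (intro exI[of _ "inverse a"]) auto
  qed
  show ?thesis
  proof (rule that[of m \<Xi>])
    fix \<zeta> assume z: "bp \<zeta>" "\<exists>i<k. \<zeta> i \<noteq> 0"
    have "\<exists>a<m. parallel \<zeta> (\<Xi> a)"
    proof (rule ccontr)
      assume neg: "\<not> (\<exists>a<m. parallel \<zeta> (\<Xi> a))"
      define \<Xi>' where "\<Xi>' = \<Xi>(m := \<zeta>)"
      have "\<forall>a<Suc m. bp (\<Xi>' a) \<and> (\<exists>i<k. \<Xi>' a i \<noteq> 0)"
        using X(1) z by (auto simp: \<Xi>'_def less_Suc_eq)
      moreover have "\<not> parallel (\<Xi>' a) (\<Xi>' b)" if "a < Suc m" "b < Suc m" "a \<noteq> b" for a b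
        using that X neg sym[of "\<Xi> a" \<zeta>] by (auto simp: \<Xi>'_def less_Suc_eq)
      ultimately have "Q (Suc m)" unfolding Q_def by blast
      then have "Suc m \<le> m" unfolding m_def by (rule Greatest_le_nat) (use bound in auto)
      then show False by simp
    qed
    then obtain a s where a: "a < m" "\<forall>i<k. \<zeta> i = s * \<Xi> a i" unfolding parallel_def by blast
    then have "s \<noteq> 0" using z(2) by auto
    then show "\<exists>a<m. \<exists>s. s \<noteq> 0 \<and> (\<forall>i<k. \<zeta> i = s * \<Xi> a i)" using a by blast
  qed (use X(1) bound[OF \<open>Q m\<close>] in auto)
qed

text \<open>To the k forms \<open>l\<close>, one form from \<open>exists_separating_form\<close> is
  appended for each of the at most k listed points. A base point of the preimage of U restricts to a
  multiple of a listed point, and its coordinate at the appended form would force exactly the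
  equality that this form violates.\<close>

lemma exists_substitution:
  assumes "2 * k \<le> N"
  shows "\<exists>b. (\<forall>i. b i \<in> forms n 1) \<and> (\<forall>f\<in>forms n d. \<exists>g\<in>forms N d. f - subst.ev b g \<in> U) \<and>
    base_point_free N {g \<in> forms N d. subst.ev b g \<in> U}"
proof -
  obtain \<Xi> m where X: "m \<le> k" "\<And>a. a < m \<Longrightarrow> bp (\<Xi> a)" "\<And>a. a < m \<Longrightarrow> \<exists>i<k. \<Xi> a i \<noteq> 0"
    "\<And>\<zeta>. bp \<zeta> \<Longrightarrow> \<exists>i<k. \<zeta> i \<noteq> 0 \<Longrightarrow> \<exists>a<m. \<exists>s. s \<noteq> 0 \<and> (\<forall>i<k. \<zeta> i = s * \<Xi> a i)"
    by (rule exists_base_point_list) blast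
  have "\<exists>j b. j < k \<and> \<Xi> a j \<noteq> 0 \<and> b \<in> forms n 1 \<and>
      \<phi> (\<Xi> a) (l j ^ (d - 1) * b) ^ d \<noteq> \<Xi> a j ^ ((d - 1) * d) * \<phi> (\<Xi> a) (b ^ d)" if "a < m" for a
    using exists_separating_form[OF X(2)[OF that]] X(3)[OF that] by blast
  then obtain J bb where J: "\<And>a. a < m \<Longrightarrow> J a < k \<and> \<Xi> a (J a) \<noteq> 0 \<and> bb a \<in> forms n 1 \<and>
      \<phi> (\<Xi> a) (l (J a) ^ (d - 1) * bb a) ^ d \<noteq> \<Xi> a (J a) ^ ((d - 1) * d) * \<phi> (\<Xi> a) (bb a ^ d)"
    by metis
  \<comment> \<open>Positions from \<open>k + m\<close> on are filled with 0, so that any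
    \<open>N\<close> of size at least 2 k is covered.\<close>
  define b where "b i = (if i < k then l i else if i < k + m then bb (i - k) else 0)" for i
  have bl: "b i = l i" if "i < k" for i using that by (simp add: b_def)
  have b: "b i \<in> forms n 1" for i
    using l[of i] J[of "i - k"] cpoly.subspace_0[OF subspace_forms] by (auto simp: b_def)
  have kN: "k \<le> N" using assms by simp
  define U' where "U' = {g \<in> forms N d. subst.ev b g \<in> U}"
  \<comment> \<open>Modulo \<open>U'\<close> every form becomes one in the first k variables, so
    evaluation at a base point of \<open>U'\<close> is governed by \<phi>.\<close>
  have repU': "g - rep (subst.ev b g) \<in> U'" if "g \<in> forms N d" for g
    unfolding U'_def
    using that rep_forms[OF kN] c[OF subst_forms[of N b n g d]] b
    by (auto simp: subst.ev_minus subst_rep[OF bl] intro: cpoly.subspace_diff[OF subspace_forms])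
  have "base_point_free N U'"
    unfolding base_point_free_def
  proof clarify
    fix \<zeta> i assume i: "i < N" "\<zeta> i \<noteq> 0" and "\<forall>f\<in>U'. poly_eval f \<zeta> = 0"
    then have van: "point.ev \<zeta> g = 0" if "g \<in> U'" for g using that by (simp add: poly_eval_eq_ev)
    have ev: "point.ev \<zeta> g = \<phi> \<zeta> (subst.ev b g)" if "g \<in> forms N d" for g
      using van[OF repU'[OF that]] by (simp add: point.ev_minus ev_rep)
    have Vf: "Var i ^ d \<in> forms N d" if "i < N" for i
      using forms_power[OF Var_forms[OF that], of d] by simp
    have "bp \<zeta>" unfolding bp_def
    proof (intro ballI impI)
      fix g assume g: "g \<in> forms k d" "subst.ev l g \<in> U"
      have "subst.ev b g = subst.ev l g" using bl by (intro subst.ev_cong[OF g(1)])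
      then show "point.ev \<zeta> g = 0" using g forms_mono[OF kN] by (intro van) (auto simp: U'_def)
    qed
    moreover have "\<exists>i<k. \<zeta> i \<noteq> 0"
    proof (rule ccontr)
      assume "\<not> (\<exists>i<k. \<zeta> i \<noteq> 0)"
      then have "\<phi> \<zeta> f = 0" for f using d by (simp add: \<phi>_def power_0_left)
      then have "\<zeta> i ^ d = 0" using ev[OF Vf[OF i(1)]] by (simp add: point.ev_power)
      then show False using i(2) by simp
    qed
    ultimately obtain a s where a: "a < m" "s \<noteq> 0" "\<And>i. i < k \<Longrightarrow> \<zeta> i = s * \<Xi> a i" using X(4) by blast
    define j where "j = J a"
    have j: "j < k" using J[OF a(1)] by (simp add: j_def)
    have ka: "k + a < N" using a(1) X(1) assms by simp
    have bka: "b (k + a) = bb a" using a(1) by (simp add: b_def)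
    have 1: "\<zeta> (k + a) ^ d = s ^ d * \<phi> (\<Xi> a) (bb a ^ d)"
      using ev[OF Vf[OF ka]] \<phi>_scale_point[OF a(3)] by (simp add: point.ev_power subst.ev_power bka)
    have "Var j ^ (d - 1) * Var (k + a) \<in> forms N (1 * (d - 1) + 1)"
      using j kN ka by (intro forms_mult forms_power Var_forms) auto
    then have "Var j ^ (d - 1) * Var (k + a) \<in> forms N d" using d by simp
    from ev[OF this] have 2: "\<zeta> j ^ (d - 1) * \<zeta> (k + a) = s ^ d * \<phi> (\<Xi> a) (l j ^ (d - 1) * bb a)"
      using \<phi>_scale_point[OF a(3)] by (simp add: point.ev_power subst.ev_power point.ev_mult subst.ev_mult bka bl[OF j])
    \<comment> \<open>Comparing d-th powers eliminates the coordinate of \<zeta> at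
      \<open>k + a\<close> from \<open>1\<close> and \<open>2\<close>; then (s^d)^d cancels.\<close>
    have "(s ^ d * \<phi> (\<Xi> a) (l j ^ (d - 1) * bb a)) ^ d = (\<zeta> j ^ (d - 1) * \<zeta> (k + a)) ^ d"
      using 2 by simp
    also have "\<dots> = (s ^ (d - 1)) ^ d * \<Xi> a j ^ ((d - 1) * d) * (s ^ d * \<phi> (\<Xi> a) (bb a ^ d))"
      by (simp add: power_mult_distrib 1 a(3)[OF j] power_mult)
    also have "\<dots> = (s ^ d) ^ d * (\<Xi> a j ^ ((d - 1) * d) * \<phi> (\<Xi> a) (bb a ^ d))"
    proof -
      have "(s ^ (d - 1)) ^ d * s ^ d = (s ^ d) ^ d"
        using d by (simp add: power_mult_distrib[symmetric] power_Suc2[symmetric] del: power_Suc)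
      then show ?thesis by (simp add: mult_ac)
    qed
    finally have "\<phi> (\<Xi> a) (l j ^ (d - 1) * bb a) ^ d = \<Xi> a j ^ ((d - 1) * d) * \<phi> (\<Xi> a) (bb a ^ d)"
      using a(2) by (simp add: power_mult_distrib)
    then show False using J[OF a(1)] by (simp add: j_def)
  qed
  moreover have "\<exists>g\<in>forms N d. f - subst.ev b g \<in> U" if "f \<in> forms n d" for f
    using rep_forms[OF kN, of f] c[OF that] by (intro bexI[of _ "rep f"]) (simp_all add: subst_rep[OF bl])
  ultimately show ?thesis using b unfolding U'_def by blast
qed

end

section \<open>Pulling U back along a linear substitution\<close>

lemma subspace_subst_image:
  assumes "cpoly.subspace F" shows "cpoly.subspace (subst.ev b ` F)"
proof (rule cpoly.subspaceI)
  show "0 \<in> subst.ev b ` F" using cpoly.subspace_0[OF assms] by (auto intro: image_eqI[of _ _ 0])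
  show "x + y \<in> subst.ev b ` F" if xy: "x \<in> subst.ev b ` F" "y \<in> subst.ev b ` F" for x y
  proof -
    obtain p q where "x = subst.ev b p" "y = subst.ev b q" "p \<in> F" "q \<in> F" using xy by auto
    then show ?thesis using cpoly.subspace_add[OF assms, of p q]
      by (auto simp: subst.ev_add intro: image_eqI[of _ _ "p + q"])
  qed
  show "cscale c x \<in> subst.ev b ` F" if "x \<in> subst.ev b ` F" for c x
    using that cpoly.subspace_scale[OF assms] by (auto simp: subst_cscale[symmetric])
qed

lemma subspace_subst_vimage:
  assumes "cpoly.subspace H" shows "cpoly.subspace {p. subst.ev b p \<in> H}"
  using assms by (auto intro!: cpoly.subspaceI
      simp: cpoly.subspace_0 subst.ev_add cpoly.subspace_add cpoly.subspace_scale subst_cscale)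

locale substitution =
  fixes n d N :: nat and U :: "cpoly set" and b :: "nat \<Rightarrow> cpoly"
  assumes U: "cpoly.subspace U" "U \<subseteq> forms n d" and d: "d \<ge> 1"
    and b: "\<And>i. b i \<in> forms n 1"
    and reg: "\<And>f. f \<in> forms n d \<Longrightarrow> \<exists>g\<in>forms N d. f - subst.ev b g \<in> U"
begin

definition U' :: "cpoly set" where
  "U' = {g \<in> forms N d. subst.ev b g \<in> U}"

lemma U': "cpoly.subspace U'" "U' \<subseteq> forms N d"
proof -
  have "U' = forms N d \<inter> {g. subst.ev b g \<in> U}" by (auto simp: U'_def)
  then show "cpoly.subspace U'"
    using cpoly.subspace_inter[OF subspace_forms subspace_subst_vimage[OF U(1)]] by simp
qed (auto simp: U'_def)

lemma \<sigma>_forms: "p \<in> forms N j \<Longrightarrow> subst.ev b p \<in> forms n j"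
  by (rule subst_forms[OF b])

text \<open>The substitution induces an isomorphism of the two quotients, injective by the
  definition of \<open>U'\<close> and surjective by \<open>reg\<close>. Each inequality carries a
  complement across in one direction.\<close>

lemma codim_U': "codim_in (forms N d) U' = codim_in (forms n d) U"
proof (rule antisym)
  obtain S where S: "S \<subseteq> forms n d" "finite S" "card S = cpoly.dim (forms n d) - cpoly.dim U"
    "forms n d \<subseteq> cpoly.span (U \<union> S)"
    using complement_exists[OF U(2) order_refl] by metis
  have "\<forall>s\<in>S. \<exists>g\<in>forms N d. s - subst.ev b g \<in> U" using reg S(1) by blast
  then obtain r where r: "\<And>s. s \<in> S \<Longrightarrow> r s \<in> forms N d \<and> s - subst.ev b (r s) \<in> U" by metis
  define H where "H = cpoly.span (U' \<union> r ` S)"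
  have sH: "cpoly.subspace H" by (simp add: H_def)
  have H: "H \<subseteq> forms N d" unfolding H_def using U'(2) r by (intro cpoly.span_minimal subspace_forms) auto
  have U'H: "U' \<subseteq> H" unfolding H_def using cpoly.span_superset by blast
  have sub: "cpoly.subspace {u + v | u v. u \<in> U \<and> v \<in> subst.ev b ` H}"
    by (rule cpoly.subspace_sums[OF U(1) subspace_subst_image[OF sH]])
  have "U \<union> S \<subseteq> {u + v | u v. u \<in> U \<and> v \<in> subst.ev b ` H}"
  proof (intro Un_least subsetI)
    fix x assume "x \<in> U"
    then show "x \<in> {u + v | u v. u \<in> U \<and> v \<in> subst.ev b ` H}"
      using cpoly.subspace_0[OF subspace_subst_image[OF sH, of b]] by (intro CollectI exI[of _ x] exI[of _ 0]) simp
  next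
    fix s assume s: "s \<in> S"
    have "r s \<in> H" unfolding H_def using s by (intro cpoly.span_base) blast
    then show "s \<in> {u + v | u v. u \<in> U \<and> v \<in> subst.ev b ` H}"
      using r[OF s] by (intro CollectI exI[of _ "s - subst.ev b (r s)"] exI[of _ "subst.ev b (r s)"]) simp
  qed
  then have span: "forms n d \<subseteq> {u + v | u v. u \<in> U \<and> v \<in> subst.ev b ` H}"
    using S(4) cpoly.span_minimal[OF _ sub] by blast
  have "forms N d \<subseteq> H"
  proof
    fix p assume p: "p \<in> forms N d"
    obtain u h where uh: "u \<in> U" "h \<in> H" "subst.ev b p = u + subst.ev b h" using span \<sigma>_forms[OF p] by blast
    then have "p - h \<in> U'" unfolding U'_def using cpoly.subspace_diff[OF subspace_forms p, of h] H
      by (auto simp: subst.ev_minus)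
    then have "p - h + h \<in> H" using cpoly.subspace_add[OF sH _ uh(2)] U'H by blast
    then show "p \<in> H" by simp
  qed
  then have "cpoly.dim (forms N d) \<le> cpoly.dim U' + card (r ` S)"
    using U'(2) S(2) by (intro dim_le_dim_add_card[of U' N d]) (auto simp: H_def)
  then show "codim_in (forms N d) U' \<le> codim_in (forms n d) U"
    using card_image_le[OF S(2), of r] S(3) by (simp add: codim_in_def)
next
  obtain S where S: "S \<subseteq> forms N d" "finite S" "card S = cpoly.dim (forms N d) - cpoly.dim U'"
    "forms N d \<subseteq> cpoly.span (U' \<union> S)"
    using complement_exists[OF U'(2) order_refl] by metis
  define H where "H = cpoly.span (U \<union> subst.ev b ` S)"
  have sH: "cpoly.subspace H" by (simp add: H_def)
  have UH: "U \<subseteq> H" "subst.ev b ` S \<subseteq> H" unfolding H_def by (auto intro: cpoly.span_base)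
  have "U' \<union> S \<subseteq> {p. subst.ev b p \<in> H}" using UH by (auto simp: U'_def)
  then have "forms N d \<subseteq> {p. subst.ev b p \<in> H}" using S(4) cpoly.span_minimal[OF _ subspace_subst_vimage[OF sH]] by blast
  moreover have "f \<in> H" if "f \<in> forms n d" "g \<in> forms N d" "f - subst.ev b g \<in> U" "subst.ev b g \<in> H" for f g
    using cpoly.subspace_add[OF sH subsetD[OF UH(1) that(3)] that(4)] by simp
  ultimately have "forms n d \<subseteq> H" using reg by blast
  then have "cpoly.dim (forms n d) \<le> cpoly.dim U + card (subst.ev b ` S)"
    using U(2) S(2) by (intro dim_le_dim_add_card[of U n d]) (auto simp: H_def)
  then show "codim_in (forms n d) U \<le> codim_in (forms N d) U'"
    using card_image_le[OF S(2), of "subst.ev b"] S(3) by (simp add: codim_in_def)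
qed

text \<open>The part of A_(2d) reached by U^2 and the substitution; the aim is that it contains all
  of A_(2d).\<close>

definition E :: "cpoly set" where
  "E = cpoly.span (square_space U \<union> subst.ev b ` forms N (2 * d))"

lemma subspace_E: "cpoly.subspace E"
  by (simp add: E_def)

lemma E_square: "u \<in> U \<Longrightarrow> u' \<in> U \<Longrightarrow> u * u' \<in> E"
  unfolding E_def square_space_eq_sprod by (intro cpoly.span_base UnI1 sprodI)

lemma E_\<sigma>: "p \<in> forms N (2 * d) \<Longrightarrow> subst.ev b p \<in> E"
  unfolding E_def by (intro cpoly.span_base UnI2 imageI)

text \<open>Write \<sigma> for the substitution. If f = u + \<sigma> g and f' = u' + \<sigma> g'
  with u, u' in U, then f f' = u u' + f' \<sigma> g + f \<sigma> g' - \<sigma>(g g').\<close>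

lemma E_mult:
  assumes "f \<in> forms n d" "f' \<in> forms n d"
    and "\<And>g. g \<in> forms N d \<Longrightarrow> f' * subst.ev b g \<in> E" "\<And>g. g \<in> forms N d \<Longrightarrow> f * subst.ev b g \<in> E"
  shows "f * f' \<in> E"
proof -
  obtain g where g: "g \<in> forms N d" "f - subst.ev b g \<in> U" using reg[OF assms(1)] by blast
  obtain g' where g': "g' \<in> forms N d" "f' - subst.ev b g' \<in> U" using reg[OF assms(2)] by blast
  have "subst.ev b (g * g') \<in> E" using forms_mult[OF g(1) g'(1)] by (intro E_\<sigma>) (simp add: mult_2)
  moreover have "f * f' = (f - subst.ev b g) * (f' - subst.ev b g') + f' * subst.ev b g + f * subst.ev b g' - subst.ev b (g * g')"
    by (simp add: subst.ev_mult algebra_simps)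
  ultimately show ?thesis
    using E_square[OF g(2) g'(2)] assms(3)[OF g(1)] assms(4)[OF g'(1)]
    by (metis cpoly.subspace_add cpoly.subspace_diff subspace_E)
qed

text \<open>Induction on the degree of f. If f is linear, \<open>gen\<close> writes p through
  products q u with u in \<open>U'\<close>, and the degree d form f \<sigma> q is reduced modulo U.
  Otherwise f and p are both split so that the product regroups into two factors of degree d, and
  \<open>E_mult\<close> applies.\<close>

lemma E_forms_mult_\<sigma>:
  assumes gen: "sprod (forms N (d - 1)) U' = forms N (2 * d - 1)"
  assumes "j \<le> d" "f \<in> forms n j" "p \<in> forms N (2 * d - j)"
  shows "f * subst.ev b p \<in> E"
  using assms(2-)
proof (induction j arbitrary: f p)
  case 0
  then obtain a where "f = Poly_Mapping.single 0 a" by (auto simp: forms_0_iff)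
  then have "f * subst.ev b p = cscale a (subst.ev b p)" by (simp add: cscale_def)
  then show ?case using 0 cpoly.subspace_scale[OF subspace_E E_\<sigma>] by simp
next
  case (Suc j)
  have one: "f * subst.ev b p \<in> E" if f: "f \<in> forms n 1" and p: "p \<in> forms N (2 * d - 1)" for f p
  proof -
    have "sprod (forms N (d - 1)) U' \<subseteq> {p. subst.ev b p \<in> {q. f * q \<in> E}}"
    proof (rule sprod_subset[OF subspace_subst_vimage[OF subspace_mult_vimage[OF subspace_E]]])
      fix q u assume q: "q \<in> forms N (d - 1)" and u: "u \<in> U'"
      have "f * subst.ev b q \<in> forms n (1 + (d - 1))" using f \<sigma>_forms[OF q] by (rule forms_mult)
      then obtain g where g: "g \<in> forms N d" "f * subst.ev b q - subst.ev b g \<in> U" using reg d by auto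
      have u': "u \<in> forms N d" "subst.ev b u \<in> U" using u by (auto simp: U'_def)
      have "(f * subst.ev b q - subst.ev b g) * subst.ev b u + subst.ev b (g * u) \<in> E"
        using E_square[OF g(2) u'(2)] E_\<sigma>[of "g * u"] forms_mult[OF g(1) u'(1)]
        by (intro cpoly.subspace_add subspace_E) (simp_all add: mult_2)
      moreover have "(f * subst.ev b q - subst.ev b g) * subst.ev b u + subst.ev b (g * u) = f * subst.ev b (q * u)"
        by (simp add: subst.ev_mult algebra_simps)
      ultimately show "q * u \<in> {p. subst.ev b p \<in> {q. f * q \<in> E}}" by simp
    qed
    then show ?thesis using p gen by blast
  qed
  show ?case
  proof (cases "j = 0")
    case True
    then show ?thesis using one Suc.prems by simp
  next
    case False
    have "forms N ((d - j) + (d - 1)) \<subseteq> {p. subst.ev b p \<in> {q. f * q \<in> E}}" if "f \<in> forms n (1 + j)" for f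
    proof (rule sprod_forms_subsetI[OF subspace_subst_vimage[OF subspace_mult_vimage[OF subspace_E]]])
      fix q q' assume q: "q \<in> forms N (d - j)" "q' \<in> forms N (d - 1)"
      have "forms n (1 + j) \<subseteq> {f. subst.ev b (q * q') * f \<in> E}"
      proof (rule sprod_forms_subsetI[OF subspace_mult_vimage[OF subspace_E]])
        fix a f' assume a: "a \<in> forms n 1" and f': "f' \<in> forms n j"
        \<comment> \<open>The degrees are j + (d - j) and 1 + (d - 1). The mixed products demanded
          by \<open>E_mult\<close> are the induction hypothesis and the linear case.\<close>
        have "(f' * subst.ev b q) * (a * subst.ev b q') \<in> E"
        proof (rule E_mult)
          show "f' * subst.ev b q \<in> forms n d" using forms_mult[OF f' \<sigma>_forms[OF q(1)]] Suc.prems by simp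
          show "a * subst.ev b q' \<in> forms n d" using forms_mult[OF a \<sigma>_forms[OF q(2)]] d by simp
          fix g assume g: "g \<in> forms N d"
          have "q' * g \<in> forms N (2 * d - 1)" using forms_mult[OF q(2) g] d by (simp add: mult_2)
          from one[OF a this] show "a * subst.ev b q' * subst.ev b g \<in> E" by (simp add: subst.ev_mult mult.assoc)
          have "q * g \<in> forms N (2 * d - j)" using forms_mult[OF q(1) g] Suc.prems by (simp add: mult_2)
          from Suc.IH[OF _ f' this] show "f' * subst.ev b q * subst.ev b g \<in> E"
            using Suc.prems by (simp add: subst.ev_mult mult.assoc)
        qed
        then show "a * f' \<in> {f. subst.ev b (q * q') * f \<in> E}" by (simp add: subst.ev_mult mult_ac)
      qed
      then show "q * q' \<in> {p. subst.ev b p \<in> {q. f * q \<in> E}}" using that by (auto simp: mult.commute)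
    qed
    moreover have "(d - j) + (d - 1) = 2 * d - Suc j" using Suc.prems by simp
    ultimately show ?thesis using Suc.prems by auto
  qed
qed

lemma forms_subset_E:
  assumes "sprod (forms N (d - 1)) U' = forms N (2 * d - 1)"
  shows "forms n (2 * d) \<subseteq> E"
proof -
  have fg: "f * subst.ev b g \<in> E" if "f \<in> forms n d" "g \<in> forms N d" for f g
    using E_forms_mult_\<sigma>[OF assms order_refl that(1), of g] that(2) by simp
  have "forms n (d + d) \<subseteq> E"
    by (rule sprod_forms_subsetI[OF subspace_E], rule E_mult) (simp_all add: fg)
  then show ?thesis by (simp add: mult_2)
qed

text \<open>As \<open>E\<close> contains A_(2d), the substitution carries a complement of the square
  of \<open>U'\<close> to a set spanning A_(2d) modulo U^2.\<close>

lemma codim_square_le: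
  assumes "sprod (forms N (d - 1)) U' = forms N (2 * d - 1)"
  shows "codim_in (forms n (2 * d)) (square_space U) \<le> codim_in (forms N (2 * d)) (square_space U')"
proof -
  obtain S where S: "S \<subseteq> forms N (2 * d)" "finite S" "card S = cpoly.dim (forms N (2 * d)) - cpoly.dim (square_space U')"
    "forms N (2 * d) \<subseteq> cpoly.span (square_space U' \<union> S)"
    using complement_exists[OF square_space_forms[OF U'(2)] order_refl] by metis
  define H where "H = cpoly.span (square_space U \<union> subst.ev b ` S)"
  have sH: "cpoly.subspace H" by (simp add: H_def)
  have sub: "square_space U \<subseteq> H" "subst.ev b ` S \<subseteq> H" unfolding H_def by (auto intro: cpoly.span_base)
  have "square_space U' \<subseteq> {p. subst.ev b p \<in> H}"
    unfolding square_space_eq_sprod[of U']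
  proof (rule sprod_subset[OF subspace_subst_vimage[OF sH]])
    fix p q assume "p \<in> U'" "q \<in> U'"
    then have "subst.ev b p * subst.ev b q \<in> square_space U" unfolding square_space_eq_sprod by (intro sprodI) (auto simp: U'_def)
    then show "p * q \<in> {p. subst.ev b p \<in> H}" using sub(1) by (auto simp: subst.ev_mult)
  qed
  then have "square_space U' \<union> S \<subseteq> {p. subst.ev b p \<in> H}" using sub(2) by auto
  then have "forms N (2 * d) \<subseteq> {p. subst.ev b p \<in> H}"
    using S(4) cpoly.span_minimal[OF _ subspace_subst_vimage[OF sH]] by blast
  then have "E \<subseteq> H" unfolding E_def using sub(1) by (intro cpoly.span_minimal[OF _ sH]) auto
  then have "forms n (2 * d) \<subseteq> H" using forms_subset_E[OF assms] by blast
  then have "cpoly.dim (forms n (2 * d)) \<le> cpoly.dim (square_space U) + card (subst.ev b ` S)"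
    using square_space_forms[OF U(2)] S(2) by (intro dim_le_dim_add_card[of _ n "2 * d"]) (auto simp: H_def)
  then show ?thesis
    using card_image_le[OF S(2), of "subst.ev b"] S(3) by (simp add: codim_in_def)
qed

end

section \<open>Leading monomials\<close>

abbreviation (input) lk where "lk \<equiv> Poly_Mapping.lookup"

text \<open>The monomial order is the linear order on exponent vectors, which is compatible with
  addition.\<close>

definition lead :: "cpoly \<Rightarrow> (nat \<Rightarrow>\<^sub>0 nat)" where
  "lead p = Max (Poly_Mapping.keys p)"

definition msum :: "(nat \<Rightarrow>\<^sub>0 nat) set \<Rightarrow> (nat \<Rightarrow>\<^sub>0 nat) set" where
  "msum M = {a + b | a b. a \<in> M \<and> b \<in> M}"

lemma lead_in_keys: "p \<noteq> 0 \<Longrightarrow> lead p \<in> Poly_Mapping.keys p"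
  unfolding lead_def by (rule Max_in) auto

lemma keys_le_lead: "m \<in> Poly_Mapping.keys p \<Longrightarrow> m \<le> lead p"
  unfolding lead_def by (rule Max_ge) auto

lemma lead_eqI:
  "m \<in> Poly_Mapping.keys p \<Longrightarrow> (\<And>m'. m' \<in> Poly_Mapping.keys p \<Longrightarrow> m' \<le> m) \<Longrightarrow> lead p = m"
  unfolding lead_def by (rule Max_eqI) auto

text \<open>Once the leading terms are stripped off, all remaining products lie strictly below
  \<open>lead p + lead q\<close>, where the coefficient is thus the product of the leading
  coefficients.\<close>

lemma lead_mult:
  assumes "p \<noteq> 0" "q \<noteq> 0"
  shows "p * q \<noteq> 0" "lead (p * q) = lead p + lead q"
proof -
  let ?u = "lead p" and ?v = "lead q"
  define p' where "p' = p - Poly_Mapping.single ?u (lk p ?u)"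
  define q' where "q' = q - Poly_Mapping.single ?v (lk q ?v)"
  have p': "m < ?u" if "m \<in> Poly_Mapping.keys p'" for m
  proof -
    have "m \<noteq> ?u" "m \<in> Poly_Mapping.keys p"
      using that by (auto simp: p'_def in_keys_iff lookup_minus lookup_single when_def split: if_splits)
    then show ?thesis using keys_le_lead[of m p] by simp
  qed
  have q': "m < ?v" if "m \<in> Poly_Mapping.keys q'" for m
  proof -
    have "m \<noteq> ?v" "m \<in> Poly_Mapping.keys q"
      using that by (auto simp: q'_def in_keys_iff lookup_minus lookup_single when_def split: if_splits)
    then show ?thesis using keys_le_lead[of m q] by simp
  qed
  have "?u + ?v \<notin> Poly_Mapping.keys (p' * q)"
  proof
    assume "?u + ?v \<in> Poly_Mapping.keys (p' * q)"
    then obtain a b where "?u + ?v = a + b" "a \<in> Poly_Mapping.keys p'" "b \<in> Poly_Mapping.keys q"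
      using keys_mult[of p' q] by blast
    then show False using add_less_le_mono[OF p' keys_le_lead, of a b q] by simp
  qed
  moreover have "?u + ?v \<notin> Poly_Mapping.keys (Poly_Mapping.single ?u (lk p ?u) * q')"
  proof
    assume "?u + ?v \<in> Poly_Mapping.keys (Poly_Mapping.single ?u (lk p ?u) * q')"
    then obtain a b where "?u + ?v = a + b" "a \<in> Poly_Mapping.keys (Poly_Mapping.single ?u (lk p ?u))" "b \<in> Poly_Mapping.keys q'"
      using keys_mult[of "Poly_Mapping.single ?u (lk p ?u)" q'] by blast
    then show False using q'[of b] by (auto split: if_splits)
  qed
  moreover have "p * q = p' * q + (Poly_Mapping.single ?u (lk p ?u) * q' + Poly_Mapping.single (?u + ?v) (lk p ?u * lk q ?v))"
    unfolding p'_def q'_def mult_single[symmetric] by (simp add: algebra_simps)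
  then have "lk (p * q) (?u + ?v) = lk (p' * q) (?u + ?v) + (lk (Poly_Mapping.single ?u (lk p ?u) * q') (?u + ?v) + lk p ?u * lk q ?v)"
    by (simp add: lookup_add)
  ultimately have "lk (p * q) (?u + ?v) = lk p ?u * lk q ?v" by (simp add: in_keys_iff)
  moreover have "lk p ?u \<noteq> 0" "lk q ?v \<noteq> 0"
    using lead_in_keys[OF assms(1)] lead_in_keys[OF assms(2)] by (simp_all add: in_keys_iff)
  ultimately have key: "?u + ?v \<in> Poly_Mapping.keys (p * q)" by (simp add: in_keys_iff)
  then show "p * q \<noteq> 0" by auto
  show "lead (p * q) = ?u + ?v"
  proof (rule lead_eqI[OF key])
    fix m assume "m \<in> Poly_Mapping.keys (p * q)"
    then obtain a b where "m = a + b" "a \<in> Poly_Mapping.keys p" "b \<in> Poly_Mapping.keys q"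
      using keys_mult[of p q] by blast
    then show "m \<le> ?u + ?v" using keys_le_lead by (simp add: add_mono)
  qed
qed

definition leads :: "cpoly set \<Rightarrow> (nat \<Rightarrow>\<^sub>0 nat) set" where
  "leads U = lead ` (U - {0})"

lemma leads_exponents: "U \<subseteq> forms n d \<Longrightarrow> leads U \<subseteq> exponents n d"
  using lead_in_keys unfolding leads_def forms_def by blast

text \<open>One polynomial per leading monomial gives a basis: distinct leading monomials are
  independent, and an element outside the span with smallest leading monomial could be reduced
  further.\<close>

lemma card_leads:
  assumes U: "cpoly.subspace U" "U \<subseteq> forms n d"
  shows "card (leads U) = cpoly.dim U"
proof -
  have fin: "finite (leads U)" using leads_exponents[OF U(2)] finite_exponents by (rule finite_subset)
  have "\<exists>p. p \<in> U \<and> p \<noteq> 0 \<and> lead p = m" if "m \<in> leads U" for m using that by (auto simp: leads_def)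
  then obtain P where P: "\<And>m. m \<in> leads U \<Longrightarrow> P m \<in> U \<and> P m \<noteq> 0 \<and> lead (P m) = m" by metis
  have injP: "inj_on P (leads U)" using P by (metis inj_onI)
  have cP: "lk (P m) m \<noteq> 0" if "m \<in> leads U" for m
    using lead_in_keys[of "P m"] P[OF that] by (simp add: in_keys_iff)
  have "cpoly.independent (P ` leads U)"
  proof (rule cpoly.independent_if_scalars_zero)
    fix f x assume s: "(\<Sum>x\<in>P ` leads U. cscale (f x) x) = 0" and x: "x \<in> P ` leads U"
    show "f x = 0"
    proof (rule ccontr)
      assume "f x \<noteq> 0"
      define K where "K = {m \<in> leads U. f (P m) \<noteq> 0}"
      have K: "finite K" "K \<noteq> {}" using fin x \<open>f x \<noteq> 0\<close> by (auto simp: K_def)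
      define m0 where "m0 = Max K"
      have m0: "m0 \<in> leads U" "f (P m0) \<noteq> 0" using Max_in[OF K] by (auto simp: K_def m0_def)
      have zero: "f (P m) * lk (P m) m0 = 0" if "m \<in> leads U" "m \<noteq> m0" for m
      proof (rule ccontr)
        assume nz: "f (P m) * lk (P m) m0 \<noteq> 0"
        then have "m \<in> K" using that by (auto simp: K_def)
        then have "m < m0" using Max_ge[OF K(1)] that(2) by (simp add: m0_def order_less_le)
        moreover have "m0 \<in> Poly_Mapping.keys (P m)" using nz by (auto simp: in_keys_iff)
        then have "m0 \<le> m" using keys_le_lead[of m0 "P m"] P[OF that(1)] by simp
        ultimately show False by simp
      qed
      have "0 = lk (\<Sum>x\<in>P ` leads U. cscale (f x) x) m0" using s by simp
      also have "\<dots> = (\<Sum>m\<in>leads U. f (P m) * lk (P m) m0)"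
        using injP by (simp add: sum.reindex lookup_sum lookup_cscale)
      also have "\<dots> = (\<Sum>m\<in>{m0}. f (P m) * lk (P m) m0)"
        using fin m0(1) zero by (intro sum.mono_neutral_right) auto
      finally show False using m0 cP by simp
    qed
  qed (use fin in auto)
  moreover have "U \<subseteq> cpoly.span (P ` leads U)"
  proof (rule ccontr)
    assume neg: "\<not> U \<subseteq> cpoly.span (P ` leads U)"
    define K where "K = lead ` (U - cpoly.span (P ` leads U))"
    have "K \<subseteq> leads U" unfolding K_def leads_def using cpoly.span_zero by blast
    then have "finite K" using fin by (rule finite_subset)
    moreover have "K \<noteq> {}" using neg by (auto simp: K_def)
    ultimately have minK: "Min K \<in> K" "\<And>m. m \<in> K \<Longrightarrow> Min K \<le> m" by auto
    then obtain p where p: "p \<in> U" "p \<notin> cpoly.span (P ` leads U)" "lead p = Min K" by (auto simp: K_def)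
    have p0: "p \<noteq> 0" using p(2) cpoly.span_zero by metis
    let ?m = "lead p"
    have m: "?m \<in> leads U" using p(1) p0 by (auto simp: leads_def)
    define q where "q = p - cscale (lk p ?m / lk (P ?m) ?m) (P ?m)"
    have "q \<in> U" unfolding q_def using p(1) P[OF m] U(1) by (intro cpoly.subspace_diff cpoly.subspace_scale) auto
    moreover have q: "q \<notin> cpoly.span (P ` leads U)"
    proof
      assume "q \<in> cpoly.span (P ` leads U)"
      moreover have "cscale (lk p ?m / lk (P ?m) ?m) (P ?m) \<in> cpoly.span (P ` leads U)"
        using m by (intro cpoly.span_scale cpoly.span_base) auto
      ultimately have "q + cscale (lk p ?m / lk (P ?m) ?m) (P ?m) \<in> cpoly.span (P ` leads U)" by (rule cpoly.span_add)
      then show False using p(2) by (simp add: q_def)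
    qed
    ultimately have "?m \<le> lead q" using minK(2) p(3) by (auto simp: K_def)
    moreover have "lead q \<in> Poly_Mapping.keys q" using q cpoly.span_zero by (intro lead_in_keys) metis
    moreover have "lk q ?m = 0" using cP[OF m] by (simp add: q_def lookup_minus lookup_cscale)
    moreover have "k \<le> ?m" if "k \<in> Poly_Mapping.keys q" for k
    proof -
      have "k \<in> Poly_Mapping.keys p \<or> k \<in> Poly_Mapping.keys (P ?m)"
        using that by (auto simp: q_def in_keys_iff lookup_minus lookup_cscale)
      then show ?thesis using keys_le_lead[of k p] keys_le_lead[of k "P ?m"] P[OF m] by auto
    qed
    ultimately show False by (metis antisym in_keys_iff)
  qed
  ultimately have "card (P ` leads U) = cpoly.dim U"
    using P by (intro cpoly.basis_card_eq_dim) auto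
  then show ?thesis using injP by (simp add: card_image)
qed

lemma msum_exponents: "M \<subseteq> exponents n d \<Longrightarrow> msum M \<subseteq> exponents n (2 * d)"
  unfolding msum_def using exponents_add[of _ n d _ d] by (auto simp: mult_2)

text \<open>Bounds dim U^2 from below by the size of the sumset, so the codimension of U^2 is at
  most the number of monomials outside the sumset.\<close>

lemma leads_square_space: "msum (leads U) \<subseteq> leads (square_space U)"
proof
  fix m assume "m \<in> msum (leads U)"
  then obtain p q where "m = lead p + lead q" "p \<in> U" "q \<in> U" "p \<noteq> 0" "q \<noteq> 0"
    by (auto simp: msum_def leads_def)
  moreover from this have "p * q \<in> square_space U" unfolding square_space_eq_sprod by (intro sprodI)
  ultimately show "m \<in> leads (square_space U)"
    using lead_mult[of p q] unfolding leads_def by (metis DiffI imageI singletonD)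
qed

section \<open>Subspaces spanned by monomials\<close>

definition monomial_space :: "(nat \<Rightarrow>\<^sub>0 nat) set \<Rightarrow> cpoly set" where
  "monomial_space M = {p. Poly_Mapping.keys p \<subseteq> M}"

lemma subspace_monomial_space: "cpoly.subspace (monomial_space M)"
proof (rule cpoly.subspaceI)
  show "x + y \<in> monomial_space M" if "x \<in> monomial_space M" "y \<in> monomial_space M" for x y
    using that keys_add[of x y] unfolding monomial_space_def by blast
qed (auto simp: monomial_space_def in_keys_iff lookup_cscale subset_iff)

lemma dim_monomial_space:
  assumes "M \<subseteq> exponents n d"
  shows "cpoly.dim (monomial_space M) = card M"
proof -
  have "leads (monomial_space M) = M"
  proof
    show "leads (monomial_space M) \<subseteq> M"
      using lead_in_keys unfolding leads_def monomial_space_def by blast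
    show "M \<subseteq> leads (monomial_space M)"
    proof
      fix m assume "m \<in> M"
      moreover have "lead (Poly_Mapping.single m 1) = m" by (simp add: lead_def)
      moreover have "Poly_Mapping.single m (1::complex) \<noteq> 0"
        by (metis keys_single keys_zero empty_not_insert zero_neq_one)
      ultimately show "m \<in> leads (monomial_space M)"
        unfolding leads_def monomial_space_def by (intro image_eqI[of _ _ "Poly_Mapping.single m 1"]) auto
    qed
  qed
  moreover have "monomial_space M \<subseteq> forms n d" using assms by (auto simp: monomial_space_def forms_def)
  ultimately show ?thesis using card_leads[OF subspace_monomial_space, of M n d] by simp
qed

lemma forms_eq_monomial_space: "forms n d = monomial_space (exponents n d)"
  by (simp add: forms_def monomial_space_def)

lemma dim_forms: "cpoly.dim (forms n d) = card (exponents n d)"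
  unfolding forms_eq_monomial_space by (rule dim_monomial_space[OF order_refl])

lemma square_monomial_space: "square_space (monomial_space M) \<subseteq> monomial_space (msum M)"
  unfolding square_space_eq_sprod
proof (rule sprod_subset[OF subspace_monomial_space])
  fix p q assume "p \<in> monomial_space M" "q \<in> monomial_space M"
  then show "p * q \<in> monomial_space (msum M)"
    using keys_mult[of p q] unfolding monomial_space_def msum_def by blast
qed

section \<open>Sumsets and sums of finite sets of naturals\<close>

lemma card_sumset_nat:
  fixes A B :: "nat set"
  assumes "finite A" "finite B" "A \<noteq> {}" "B \<noteq> {}"
  shows "card A + card B \<le> Suc (card {a + b | a b. a \<in> A \<and> b \<in> B})"
proof -
  let ?X = "(\<lambda>b. Min A + b) ` B" and ?Y = "(\<lambda>a. a + Max B) ` A"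
  let ?S = "{a + b | a b. a \<in> A \<and> b \<in> B}"
  have S: "?S = (\<lambda>(a, b). a + b) ` (A \<times> B)" by auto
  \<comment> \<open>The translates Min A + B and A + Max B lie in the sumset and can meet only at
    Min A + Max B.\<close>
  have "?X \<inter> ?Y \<subseteq> {Min A + Max B}"
  proof
    fix x assume "x \<in> ?X \<inter> ?Y"
    then obtain a b where "x = Min A + b" "x = a + Max B" "a \<in> A" "b \<in> B" by (elim IntE imageE)
    then show "x \<in> {Min A + Max B}" using Min_le[OF assms(1), of a] Max_ge[OF assms(2), of b] by simp
  qed
  then have "card (?X \<inter> ?Y) \<le> 1" using card_mono[of "{Min A + Max B}" "?X \<inter> ?Y"] by simp
  moreover have "card ?X = card B" "card ?Y = card A" by (simp_all add: card_image)
  moreover have "card (?X \<union> ?Y) + card (?X \<inter> ?Y) = card ?X + card ?Y"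
    using card_Un_Int[of ?X ?Y] assms by simp
  moreover have "?X \<union> ?Y \<subseteq> ?S" using Min_in[OF assms(1,3)] Max_in[OF assms(2,4)] by auto
  then have "card (?X \<union> ?Y) \<le> card ?S" using assms(1,2) by (intro card_mono) (auto simp: S)
  ultimately show ?thesis by linarith
qed

text \<open>Remove the maximum, which is at least \<open>card A - 1\<close>. The strict part makes
  compression lower a weight.\<close>

lemma sum_initial_segment_le:
  fixes A :: "nat set"
  assumes "finite A"
  shows "\<Sum>{..<card A} \<le> \<Sum>A" "A \<noteq> {..<card A} \<Longrightarrow> \<Sum>{..<card A} < \<Sum>A"
proof -
  have "\<Sum>{..<card A} \<le> \<Sum>A \<and> (A \<noteq> {..<card A} \<longrightarrow> \<Sum>{..<card A} < \<Sum>A)"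
    using assms
  proof (induction "card A" arbitrary: A)
    case 0 then show ?case by simp
  next
    case (Suc c)
    then have A: "A \<noteq> {}" by auto
    let ?B = "A - {Max A}"
    have cB: "card ?B = c" using Suc A by (simp add: card_Diff_singleton)
    have IH: "\<Sum>{..<c} \<le> \<Sum>?B" using Suc.hyps(1)[of ?B] cB Suc.prems by simp
    have sumA: "\<Sum>A = Max A + \<Sum>?B" using sum.remove[OF Suc.prems Max_in[OF Suc.prems A], of "\<lambda>x. x"] by simp
    have sub: "A \<subseteq> {..Max A}" using Suc.prems by auto
    have "Suc c \<le> Suc (Max A)" using card_mono[OF _ sub] Suc.hyps(2) by simp
    moreover have "Max A \<noteq> c" if "A \<noteq> {..<Suc c}"
    proof
      assume "Max A = c"
      then have "A \<subseteq> {..<Suc c}" using sub by auto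
      then have "A = {..<Suc c}" using Suc.hyps(2) by (intro card_subset_eq) auto
      then show False using that by simp
    qed
    moreover have "\<Sum>{..<Suc c} = c + \<Sum>{..<c}" by (simp add: lessThan_Suc)
    ultimately show ?case unfolding Suc.hyps(2)[symmetric] using IH sumA by linarith
  qed
  then show "\<Sum>{..<card A} \<le> \<Sum>A" "A \<noteq> {..<card A} \<Longrightarrow> \<Sum>{..<card A} < \<Sum>A" by auto
qed

section \<open>Compression of sets of monomials\<close>

lemma exponents_remove_all:
  assumes "m \<in> exponents n d"
  obtains v where "m = Poly_Mapping.single z (lk m z) + v" "v \<in> exponents n (d - lk m z)" "lk v z = 0" "lk m z \<le> d"
proof -
  define v where "v = m - Poly_Mapping.single z (lk m z)"
  have m: "m = Poly_Mapping.single z (lk m z) + v"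
    by (rule poly_mapping_eqI) (simp add: v_def lookup_add lookup_minus lookup_single when_def)
  have "mon_degree m = lk m z + mon_degree v" using arg_cong[OF m, of mon_degree] by (simp add: mon_degree_add)
  moreover have "Poly_Mapping.keys v \<subseteq> Poly_Mapping.keys m" by (auto simp: v_def in_keys_iff lookup_minus)
  ultimately have "v \<in> exponents n (d - lk m z)" "lk m z \<le> d" using assms by (auto simp: exponents_def)
  then show ?thesis using that m by (simp add: v_def lookup_minus)
qed

locale compression =
  fixes N i z :: nat
  assumes iz: "i < N" "z < N" "i \<noteq> z"
begin

text \<open>A fibre consists of monomials that share a fixed total exponent differently between x_i
  and z, so the z-exponent is a coordinate on it.\<close>

definition \<kappa> :: "(nat \<Rightarrow>\<^sub>0 nat) \<Rightarrow> (nat \<Rightarrow>\<^sub>0 nat)" where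
  "\<kappa> m = m - Poly_Mapping.single i (lk m i) + Poly_Mapping.single z (lk m i)"

lemma lk_\<kappa>: "lk (\<kappa> m) j = (if j = i then 0 else if j = z then lk m z + lk m i else lk m j)"
  using iz by (auto simp: \<kappa>_def lookup_add lookup_minus lookup_single when_def)

lemma \<kappa>_add: "\<kappa> (m + m') = \<kappa> m + \<kappa> m'"
  by (rule poly_mapping_eqI) (simp add: lk_\<kappa> lookup_add)

lemma \<kappa>_inj: "\<kappa> m = \<kappa> m' \<Longrightarrow> lk m z = lk m' z \<Longrightarrow> m = m'"
proof (rule poly_mapping_eqI)
  fix j assume "\<kappa> m = \<kappa> m'" "lk m z = lk m' z"
  then have "lk (\<kappa> m) j = lk (\<kappa> m') j" "lk (\<kappa> m) z = lk (\<kappa> m') z" "lk m z = lk m' z" by auto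
  then show "lk m j = lk m' j" using iz by (auto simp: lk_\<kappa> split: if_splits)
qed

definition levels :: "(nat \<Rightarrow>\<^sub>0 nat) set \<Rightarrow> (nat \<Rightarrow>\<^sub>0 nat) \<Rightarrow> nat set" where
  "levels M q = (\<lambda>m. lk m z) ` {m \<in> M. \<kappa> m = q}"

lemma inj_on_fibre: "inj_on (\<lambda>m. lk m z) {m \<in> M. \<kappa> m = q}"
  by (rule inj_onI) (auto intro: \<kappa>_inj)

lemma levels_le: "t \<in> levels M q \<Longrightarrow> t \<le> lk q z"
  using iz by (auto simp: levels_def lk_\<kappa>)

lemma finite_levels: "finite (levels M q)"
  by (rule finite_subset[of _ "{..lk q z}"]) (auto dest: levels_le)

text \<open>In each fibre the z-exponents become an initial segment of the same size.\<close>

definition compress :: "nat \<Rightarrow> (nat \<Rightarrow>\<^sub>0 nat) set \<Rightarrow> (nat \<Rightarrow>\<^sub>0 nat) set" where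
  "compress d M = {m \<in> exponents N d. lk m z < card (levels M (\<kappa> m))}"

lemma exponents_move:
  assumes "m \<in> exponents N d" "i' < N" "z' < N" "t \<le> lk m i'"
  shows "m - Poly_Mapping.single i' t + Poly_Mapping.single z' t \<in> exponents N d"
proof -
  define v where "v = m - Poly_Mapping.single i' t"
  have m: "m = Poly_Mapping.single i' t + v"
    using assms(4) by (intro poly_mapping_eqI) (auto simp: v_def lookup_add lookup_minus lookup_single when_def)
  have "mon_degree m = t + mon_degree v" using arg_cong[OF m, of mon_degree] by (simp add: mon_degree_add)
  moreover have "Poly_Mapping.keys v \<subseteq> Poly_Mapping.keys m" by (auto simp: v_def in_keys_iff lookup_minus)
  moreover have "Poly_Mapping.keys (v + Poly_Mapping.single z' t) \<subseteq> Poly_Mapping.keys v \<union> {z'}"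
    using keys_add[of v "Poly_Mapping.single z' t"] by (auto split: if_splits)
  ultimately show ?thesis using assms(1,3) unfolding v_def[symmetric] by (auto simp: exponents_def mon_degree_add)
qed

lemma \<kappa>_exponents: "m \<in> exponents N d \<Longrightarrow> \<kappa> m \<in> exponents N d"
  unfolding \<kappa>_def using iz by (intro exponents_move) auto

lemma levels_compress:
  assumes "M \<subseteq> exponents N d" "q \<in> \<kappa> ` exponents N d"
  shows "levels (compress d M) q = {..<card (levels M q)}"
proof
  show "levels (compress d M) q \<subseteq> {..<card (levels M q)}" by (auto simp: levels_def compress_def)
  show "{..<card (levels M q)} \<subseteq> levels (compress d M) q"
  proof
    fix t assume t: "t \<in> {..<card (levels M q)}"
    have "card (levels M q) \<le> Suc (lk q z)"
      using card_mono[of "{..lk q z}" "levels M q"] levels_le by auto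
    then have tq: "t \<le> lk q z" using t by simp
    obtain m0 where m0: "m0 \<in> exponents N d" "q = \<kappa> m0" using assms(2) by blast
    then have q: "q \<in> exponents N d" "lk q i = 0" using \<kappa>_exponents by (auto simp: lk_\<kappa>)
    \<comment> \<open>The point of the fibre over q with z-exponent t; q itself has the whole total
      in z.\<close>
    define m where "m = q - Poly_Mapping.single z (lk q z - t) + Poly_Mapping.single i (lk q z - t)"
    have m: "m \<in> exponents N d" unfolding m_def using q iz by (intro exponents_move) auto
    have "lk m z = t" "\<kappa> m = q"
      using tq q(2) iz by (auto simp: m_def lk_\<kappa> lookup_add lookup_minus lookup_single when_def intro!: poly_mapping_eqI)
    then show "t \<in> levels (compress d M) q"
      using m t by (auto simp: levels_def compress_def intro!: image_eqI[of _ _ m])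
  qed
qed

text \<open>Weight 1 counts monomials; the identity gives the total z-exponent, the measure of
  progress.\<close>

lemma sum_over_fibres:
  assumes "M \<subseteq> exponents N d"
  shows "(\<Sum>m\<in>M. g (lk m z)) = (\<Sum>q\<in>\<kappa> ` exponents N d. \<Sum>t\<in>levels M q. g t :: nat)"
proof -
  have fin: "finite M" using assms finite_exponents by (rule finite_subset)
  have "(\<Sum>q\<in>\<kappa> ` exponents N d. \<Sum>m\<in>{m \<in> M. \<kappa> m = q}. g (lk m z)) = (\<Sum>m\<in>M. g (lk m z))"
    using assms fin finite_exponents by (intro sum.group) auto
  moreover have "(\<Sum>m\<in>{m \<in> M. \<kappa> m = q}. g (lk m z)) = (\<Sum>t\<in>levels M q. g t)" for q
    unfolding levels_def by (simp add: sum.reindex[OF inj_on_fibre] o_def)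
  ultimately show ?thesis by simp
qed

lemma compress_exponents: "compress d M \<subseteq> exponents N d"
  by (auto simp: compress_def)

lemma card_compress:
  assumes "M \<subseteq> exponents N d"
  shows "card (compress d M) = card M"
  using sum_over_fibres[OF assms, of "\<lambda>_. 1"] sum_over_fibres[OF compress_exponents[of d M], of "\<lambda>_. 1"]
    levels_compress[OF assms] by simp

text \<open>The z-exponents of a and b are at most |A| - 1 and |B| - 1 for the level sets A, B of
  their fibres, while the sumset of M has at least |A| + |B| - 1 levels over the sum. So a + b stays
  within the initial segment.\<close>

lemma msum_compress:
  assumes "M \<subseteq> exponents N d"
  shows "msum (compress d M) \<subseteq> compress (2 * d) (msum M)"
proof
  fix m assume "m \<in> msum (compress d M)"
  then obtain a b where m: "m = a + b" and a: "a \<in> compress d M" and b: "b \<in> compress d M"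
    by (auto simp: msum_def)
  let ?A = "levels M (\<kappa> a)" and ?B = "levels M (\<kappa> b)"
  have ne: "?A \<noteq> {}" "?B \<noteq> {}" using a b by (auto simp: compress_def)
  have "{s + t | s t. s \<in> ?A \<and> t \<in> ?B} \<subseteq> levels (msum M) (\<kappa> m)"
  proof clarify
    fix s t assume "s \<in> ?A" "t \<in> ?B"
    then obtain a' b' where "a' \<in> M" "b' \<in> M" "\<kappa> a' = \<kappa> a" "\<kappa> b' = \<kappa> b" "s = lk a' z" "t = lk b' z"
      by (auto simp: levels_def)
    then show "s + t \<in> levels (msum M) (\<kappa> m)"
      unfolding levels_def msum_def
      by (intro image_eqI[of _ _ "a' + b'"]) (auto simp: lookup_add \<kappa>_add m)
  qed
  then have "card {s + t | s t. s \<in> ?A \<and> t \<in> ?B} \<le> card (levels (msum M) (\<kappa> m))"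
    by (intro card_mono finite_levels)
  then have "card ?A + card ?B \<le> Suc (card (levels (msum M) (\<kappa> m)))"
    using card_sumset_nat[OF finite_levels finite_levels ne] by linarith
  moreover have "lk a z < card ?A" "lk b z < card ?B" using a b by (auto simp: compress_def)
  ultimately have "lk m z < card (levels (msum M) (\<kappa> m))" by (simp add: m lookup_add)
  moreover have "m \<in> exponents N (2 * d)"
    using exponents_add[of a N d b d] a b by (auto simp: m compress_def mult_2)
  ultimately show "m \<in> compress (2 * d) (msum M)" by (simp add: compress_def)
qed

lemma card_msum_compress:
  assumes "M \<subseteq> exponents N d"
  shows "card (msum (compress d M)) \<le> card (msum M)"
proof -
  have "card (msum (compress d M)) \<le> card (compress (2 * d) (msum M))"
    using finite_subset[OF compress_exponents finite_exponents] msum_compress[OF assms] by (intro card_mono)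
  then show ?thesis using card_compress[OF msum_exponents[OF assms]] by simp
qed

text \<open>The failing swap is a gap directly below an occupied level, so that fibre is no initial
  segment and its sum drops.\<close>

lemma compress_decreases:
  assumes M: "M \<subseteq> exponents N d" and m: "m \<in> M" "lk m z > 0"
    "m - Poly_Mapping.single z 1 + Poly_Mapping.single i 1 \<notin> M"
  shows "(\<Sum>m\<in>compress d M. lk m z) < (\<Sum>m\<in>M. lk m z)"
proof -
  let ?Q = "\<kappa> ` exponents N d" and ?m' = "m - Poly_Mapping.single z 1 + Poly_Mapping.single i 1"
  let ?q = "\<kappa> m"
  have m': "\<kappa> ?m' = ?q" "lk ?m' z = lk m z - 1"
    using iz m(2) by (auto intro!: poly_mapping_eqI simp: lk_\<kappa> lookup_add lookup_minus lookup_single when_def)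
  have "lk m z - 1 \<notin> levels M ?q"
  proof
    assume "lk m z - 1 \<in> levels M ?q"
    then obtain m'' where "m'' \<in> M" "\<kappa> m'' = ?q" "lk m'' z = lk m z - 1" by (auto simp: levels_def)
    then show False using \<kappa>_inj[of m'' ?m'] m' m(3) by simp
  qed
  moreover have "lk m z \<in> levels M ?q" using m(1) by (auto simp: levels_def)
  ultimately have ne: "levels M ?q \<noteq> {..<card (levels M ?q)}"
    by (metis lessThan_iff less_imp_diff_less)
  have "(\<Sum>q\<in>?Q. \<Sum>t\<in>levels (compress d M) q. t) < (\<Sum>q\<in>?Q. \<Sum>t\<in>levels M q. t)"
  proof (rule sum_strict_mono_ex1)
    show "finite ?Q" by (simp add: finite_exponents)
    show "\<forall>q\<in>?Q. (\<Sum>t\<in>levels (compress d M) q. t) \<le> (\<Sum>t\<in>levels M q. t)"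
      using sum_initial_segment_le(1)[OF finite_levels] levels_compress[OF M] by simp
    have "?q \<in> ?Q" using m(1) M by blast
    then show "\<exists>q\<in>?Q. (\<Sum>t\<in>levels (compress d M) q. t) < (\<Sum>t\<in>levels M q. t)"
      using sum_initial_segment_le(2)[OF finite_levels ne] levels_compress[OF M] by (intro bexI[of _ ?q]) auto
  qed
  then show ?thesis
    using sum_over_fibres[OF M, of "\<lambda>t. t"] sum_over_fibres[OF compress_exponents[of d M], of "\<lambda>t. t"] by simp
qed

end

section \<open>Shifted sets and the reduction of the degree\<close>

lemma exists_shifted:
  assumes M: "M \<subseteq> exponents N d" and z: "z < N"
  obtains M' where "M' \<subseteq> exponents N d" "card M' = card M" "card (msum M') \<le> card (msum M)"
    "\<And>m i. m \<in> M' \<Longrightarrow> lk m z > 0 \<Longrightarrow> i < N \<Longrightarrow> i \<noteq> z \<Longrightarrow>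
       m - Poly_Mapping.single z 1 + Poly_Mapping.single i 1 \<in> M'"
proof -
  define P where "P M' \<longleftrightarrow> M' \<subseteq> exponents N d \<and> card M' = card M \<and> card (msum M') \<le> card (msum M)" for M'
  have "P M" using M by (simp add: P_def)
  \<comment> \<open>Least total z-exponent: a missing swap would allow a compression that lowers it
    further.\<close>
  then obtain M' where M': "P M'" "\<And>M''. P M'' \<Longrightarrow> (\<Sum>m\<in>M'. lk m z) \<le> (\<Sum>m\<in>M''. lk m z)"
    using ex_has_least_nat[of P M "\<lambda>M. \<Sum>m\<in>M. lk m z"] by blast
  show ?thesis
  proof (rule that)
    fix m i assume m: "m \<in> M'" "lk m z > 0" and i: "i < N" "i \<noteq> z"
    interpret compression N i z using z i by unfold_locales
    show "m - Poly_Mapping.single z 1 + Poly_Mapping.single i 1 \<in> M'"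
    proof (rule ccontr)
      assume "m - Poly_Mapping.single z 1 + Poly_Mapping.single i 1 \<notin> M'"
      then have "(\<Sum>m\<in>compress d M'. lk m z) < (\<Sum>m\<in>M'. lk m z)"
        using compress_decreases[of M' d m] M'(1) m by (auto simp: P_def)
      moreover have "P (compress d M')"
        using M'(1) card_compress[of M' d] card_msum_compress[of M' d] compress_exponents by (auto simp: P_def)
      ultimately show False using M'(2) by (metis not_le)
    qed
  qed (use M'(1) in \<open>auto simp: P_def\<close>)
qed

text \<open>Moving a unit from another variable into z cannot lead from the complement into M, since
  the shift would move it back. So m starts a chain of missing monomials with every z-exponent up to
  d.\<close>

lemma shifted_complement:
  assumes M: "M \<subseteq> exponents N d"
    and shift: "\<And>m i. m \<in> M \<Longrightarrow> lk m z > 0 \<Longrightarrow> i < N \<Longrightarrow> i \<noteq> z \<Longrightarrow>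
       m - Poly_Mapping.single z 1 + Poly_Mapping.single i 1 \<in> M"
    and z: "z < N" and m: "m \<in> exponents N d - M"
  shows "d < lk m z + card (exponents N d - M)"
proof -
  let ?S = "exponents N d - M"
  have "\<exists>m'\<in>?S. lk m' z = lk m z + j" if "lk m z + j \<le> d" for j
    using that
  proof (induction j)
    case 0 then show ?case using m by auto
  next
    case (Suc j)
    then obtain m' where m': "m' \<in> ?S" "lk m' z = lk m z + j" by auto
    obtain v where v: "m' = Poly_Mapping.single z (lk m' z) + v" "v \<in> exponents N (d - lk m' z)" "lk v z = 0"
      using exponents_remove_all[of m' N d z] m'(1) by blast
    have "d - lk m' z = Suc (d - Suc (lk m' z))" using m'(2) Suc.prems by simp
    then obtain i w where i: "i < N" "v = Poly_Mapping.single i 1 + w"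
      using v(2) by (metis exponents_SucE)
    have "i \<noteq> z" using v(3) i(2) by (auto simp: lookup_add)
    have li: "lk m' i > 0" by (subst v(1)) (simp add: i(2) lookup_add)
    define m'' where "m'' = m' - Poly_Mapping.single i 1 + Poly_Mapping.single z 1"
    interpret compression N i z using z i \<open>i \<noteq> z\<close> by unfold_locales
    have e: "m'' \<in> exponents N d" unfolding m''_def using m'(1) i(1) z li by (intro exponents_move) auto
    have lz: "lk m'' z = lk m z + Suc j"
      using \<open>i \<noteq> z\<close> m'(2) by (simp add: m''_def lookup_add lookup_minus lookup_single when_def)
    have undo: "m'' - Poly_Mapping.single z 1 + Poly_Mapping.single i 1 = m'"
      using li \<open>i \<noteq> z\<close>
      by (intro poly_mapping_eqI) (auto simp: m''_def lookup_add lookup_minus lookup_single when_def)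
    have "m'' \<notin> M" using shift[of m'' i] lz i(1) \<open>i \<noteq> z\<close> m'(1) unfolding undo by auto
    then show ?case using e lz by blast
  qed
  then have "{lk m z..d} \<subseteq> (\<lambda>m. lk m z) ` ?S"
  proof (intro subsetI)
    fix t assume IH: "\<And>j. lk m z + j \<le> d \<Longrightarrow> \<exists>m'\<in>?S. lk m' z = lk m z + j" and t: "t \<in> {lk m z..d}"
    then show "t \<in> (\<lambda>m. lk m z) ` ?S" using IH[of "t - lk m z"] by force
  qed
  then have "card {lk m z..d} \<le> card ((\<lambda>m. lk m z) ` ?S)" using finite_exponents by (intro card_mono) auto
  also have "\<dots> \<le> card ?S" using finite_exponents by (intro card_image_le) auto
  finally show ?thesis by simp
qed

text \<open>Put s = d - k. After shifting, all missing monomials of degree d are divisible by z^s,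
  and those of degree 2d outside the sumset by z^(2s). Dividing by z^s matches the missing monomials
  with those of \<open>V\<close>; dividing by z^(2s) stays outside the sumset of
  \<open>V\<close>.\<close>

lemma reduce_degree:
  assumes M: "M \<subseteq> exponents N d" and z: "z < N" and k: "k \<le> d" "card (exponents N d - M) = k"
  obtains V where "V \<subseteq> exponents N k" "card (exponents N k - V) = k"
    "card (exponents N (2 * d) - msum M) \<le> card (exponents N (2 * k) - msum V)"
proof -
  have fin: "finite A" if "A \<subseteq> exponents N e" for A e using that finite_exponents by (rule finite_subset)
  have card_diff: "card (exponents N e - A) = card (exponents N e) - card A" if "A \<subseteq> exponents N e" for A e
    using that by (intro card_Diff_subset fin)
  obtain M' where M': "M' \<subseteq> exponents N d" "card M' = card M" "card (msum M') \<le> card (msum M)"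
    "\<And>m i. m \<in> M' \<Longrightarrow> lk m z > 0 \<Longrightarrow> i < N \<Longrightarrow> i \<noteq> z \<Longrightarrow>
       m - Poly_Mapping.single z 1 + Poly_Mapping.single i 1 \<in> M'"
    by (rule exists_shifted[OF M z]) blast
  define s where "s = d - k"
  have cM': "card (exponents N d - M') = k" using M'(2) k(2) card_diff[OF M] card_diff[OF M'(1)] by simp
  have inM': "m \<in> M'" if "m \<in> exponents N d" "lk m z \<le> s" for m
    using shifted_complement[OF M'(1,4) z, of m] that cM' k(1) by (force simp: s_def)
  define \<tau> where "\<tau> e m = m + Poly_Mapping.single z e" for e and m :: "nat \<Rightarrow>\<^sub>0 nat"
  have \<tau>_exp: "\<tau> e m \<in> exponents N (a + e)" if "m \<in> exponents N a" for e m a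
    unfolding \<tau>_def using exponents_add[OF that single_in_exponents[OF z]] .
  have \<tau>_inj: "inj (\<tau> e)" for e unfolding \<tau>_def by (rule injI) simp
  have \<tau>_surj: "\<exists>v\<in>exponents N a. m = \<tau> e v" if m: "m \<in> exponents N (a + e)" "e \<le> lk m z" for m a e
  proof -
    obtain v where v: "m = Poly_Mapping.single z (lk m z) + v" "v \<in> exponents N (a + e - lk m z)" "lk m z \<le> a + e"
      using exponents_remove_all[OF m(1), of z] by blast
    have "v + Poly_Mapping.single z (lk m z - e) \<in> exponents N ((a + e - lk m z) + (lk m z - e))"
      by (intro exponents_add v single_in_exponents z)
    moreover have "(a + e - lk m z) + (lk m z - e) = a" using m(2) v(3) by simp
    moreover have "Poly_Mapping.single z (lk m z) = Poly_Mapping.single z (lk m z - e) + Poly_Mapping.single z e"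
      using m(2) by (simp add: single_add[symmetric])
    then have "m = \<tau> e (v + Poly_Mapping.single z (lk m z - e))"
      unfolding \<tau>_def using v(1) by (metis add.assoc add.commute)
    ultimately show ?thesis by metis
  qed
  define V where "V = {m \<in> exponents N k. \<tau> s m \<in> M'}"
  have ks: "k + s = d" "2 * k + 2 * s = 2 * d" using k(1) by (auto simp: s_def)
  have "\<tau> s ` (exponents N k - V) = exponents N d - M'"
  proof
    show "\<tau> s ` (exponents N k - V) \<subseteq> exponents N d - M'"
      using \<tau>_exp[of _ k s] ks by (auto simp: V_def)
    show "exponents N d - M' \<subseteq> \<tau> s ` (exponents N k - V)"
    proof
      fix m assume m: "m \<in> exponents N d - M'"
      then have "s \<le> lk m z" using inM'[of m] by force
      then obtain v where "v \<in> exponents N k" "m = \<tau> s v" using \<tau>_surj[of m k s] m ks by auto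
      then show "m \<in> \<tau> s ` (exponents N k - V)" using m by (auto simp: V_def)
    qed
  qed
  then have cV: "card (exponents N k - V) = k"
    using card_image[OF inj_on_subset[OF \<tau>_inj subset_UNIV], of s "exponents N k - V"] cM' by simp
  have big: "2 * s < lk u z" if u: "u \<in> exponents N (2 * d) - msum M'" for u
  proof (rule ccontr)
    assume neg: "\<not> 2 * s < lk u z"
    define t where "t = lk u z"
    obtain v where v: "u = Poly_Mapping.single z t + v" "v \<in> exponents N (2 * d - t)" "lk v z = 0"
      using exponents_remove_all[of u N "2 * d" z] u unfolding t_def by blast
    \<comment> \<open>Halving a z-exponent of at most 2s and splitting the rest of \<open>u\<close>
      to match gives two monomials of z-exponent at most s, both in \<open>M'\<close>.\<close>
    define t1 where "t1 = t div 2"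
    define t2 where "t2 = t - t div 2"
    have t: "t = t1 + t2" "t1 \<le> s" "t2 \<le> s" using neg by (auto simp: t_def t1_def t2_def)
    have sd: "s \<le> d" using ks by simp
    have "2 * d - t = (d - t1) + (d - t2)" using t sd by simp
    then obtain v1 v2 where v12: "v = v1 + v2" "v1 \<in> exponents N (d - t1)" "v2 \<in> exponents N (d - t2)"
      using v(2) by (metis exponents_split)
    have z0: "lk v1 z = 0" "lk v2 z = 0" using v(3) v12(1) by (auto simp: lookup_add)
    have "\<tau> t1 v1 \<in> exponents N d" "\<tau> t2 v2 \<in> exponents N d"
      using \<tau>_exp[OF v12(2), of t1] \<tau>_exp[OF v12(3), of t2] t sd by auto
    moreover have "lk (\<tau> t1 v1) z \<le> s" "lk (\<tau> t2 v2) z \<le> s" using z0 t by (auto simp: \<tau>_def lookup_add)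
    ultimately have "\<tau> t1 v1 \<in> M'" "\<tau> t2 v2 \<in> M'" using inM' by auto
    moreover have "u = \<tau> t1 v1 + \<tau> t2 v2"
      unfolding v(1) v12(1) t(1) \<tau>_def by (simp add: single_add ac_simps)
    ultimately have "u \<in> msum M'" unfolding msum_def by blast
    then show False using u by blast
  qed
  have "exponents N (2 * d) - msum M' \<subseteq> \<tau> (2 * s) ` (exponents N (2 * k) - msum V)"
  proof
    fix u assume u: "u \<in> exponents N (2 * d) - msum M'"
    then obtain w where w: "w \<in> exponents N (2 * k)" "u = \<tau> (2 * s) w"
      using \<tau>_surj[of u "2 * k" "2 * s"] big[OF u] ks by auto
    moreover have "w \<notin> msum V"
    proof
      assume "w \<in> msum V"
      then obtain a b where "w = a + b" "\<tau> s a \<in> M'" "\<tau> s b \<in> M'" by (auto simp: msum_def V_def)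
      moreover from this have "u = \<tau> s a + \<tau> s b" unfolding w(2) \<tau>_def mult_2 by (simp add: single_add ac_simps)
      ultimately show False using u unfolding msum_def by blast
    qed
    ultimately show "u \<in> \<tau> (2 * s) ` (exponents N (2 * k) - msum V)" by blast
  qed
  then have "card (exponents N (2 * d) - msum M') \<le> card (\<tau> (2 * s) ` (exponents N (2 * k) - msum V))"
    using finite_exponents by (intro card_mono) auto
  also have "\<dots> \<le> card (exponents N (2 * k) - msum V)"
    using finite_exponents by (intro card_image_le) auto
  also have "card (exponents N (2 * d) - msum M') = card (exponents N (2 * d)) - card (msum M')"
    by (rule card_diff[OF msum_exponents[OF M'(1)]])
  finally have "card (exponents N (2 * d) - msum M) \<le> card (exponents N (2 * k) - msum V)"
    using M'(3) card_diff[OF msum_exponents[OF M]] by simp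
  then show ?thesis using that[of V] cV by (auto simp: V_def)
qed

text \<open>Leading monomials followed by \<open>reduce_degree\<close> give a monomial space that
  competes in the maximum. Its square lies in the span of the sumset, so its codimension is at least
  the number of monomials outside that sumset.\<close>

lemma codim_square_le_max_codim_sq:
  assumes U: "cpoly.subspace U" "U \<subseteq> forms N d" "codim_in (forms N d) U = k" and "k \<le> d" "0 < N"
  shows "codim_in (forms N (2 * d)) (square_space U) \<le> max_codim_sq N k k"
proof -
  let ?M = "leads U"
  have M: "?M \<subseteq> exponents N d" by (rule leads_exponents[OF U(2)])
  have card_diff: "card (exponents N e - A) = card (exponents N e) - card A" if "A \<subseteq> exponents N e" for A e
    using that finite_subset[OF that finite_exponents] by (intro card_Diff_subset)
  have "card (exponents N d - ?M) = k"
    using U(3) by (simp add: card_diff[OF M] card_leads[OF U(1,2)] codim_in_def dim_forms)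
  then obtain V where V: "V \<subseteq> exponents N k" "card (exponents N k - V) = k"
    "card (exponents N (2 * d) - msum ?M) \<le> card (exponents N (2 * k) - msum V)"
    using reduce_degree[OF M assms(5,4)] by metis
  let ?V = "monomial_space V"
  have sV: "?V \<subseteq> forms N k" using V(1) by (auto simp: monomial_space_def forms_def)
  have cV: "codim_in (forms N k) ?V = k"
    using V(2) by (simp add: codim_in_def dim_forms dim_monomial_space[OF V(1)] card_diff[OF V(1)])
  have "codim_in (forms N (2 * d)) (square_space U) \<le> card (exponents N (2 * d) - msum ?M)"
  proof -
    have sq: "square_space U \<subseteq> forms N (2 * d)" "cpoly.subspace (square_space U)"
      using square_space_forms[OF U(2)] by (auto simp: square_space_def)
    have "card (msum ?M) \<le> card (leads (square_space U))"
      using finite_subset[OF leads_exponents[OF sq(1)] finite_exponents] leads_square_space by (intro card_mono)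
    then show ?thesis
      by (simp add: codim_in_def dim_forms card_diff[OF msum_exponents[OF M]] card_leads[OF sq(2,1)])
  qed
  also have "\<dots> \<le> card (exponents N (2 * k) - msum V)" by (rule V(3))
  also have "\<dots> \<le> codim_in (forms N (2 * k)) (square_space ?V)"
  proof -
    have "monomial_space (msum V) \<subseteq> forms N (2 * k)"
      using msum_exponents[OF V(1)] by (auto simp: monomial_space_def forms_def)
    then have "cpoly.dim (square_space ?V) \<le> card (msum V)"
      using dim_mono_forms[OF square_monomial_space] dim_monomial_space[OF msum_exponents[OF V(1)]] by metis
    then show ?thesis by (simp add: codim_in_def dim_forms card_diff[OF msum_exponents[OF V(1)]])
  qed
  also have "\<dots> \<le> max_codim_sq N k k"
    unfolding max_codim_sq_def
    by (rule Max_ge[OF max_codim_sq_finite]) (use sV cV subspace_monomial_space in blast)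
  finally show ?thesis .
qed

section \<open>The bound\<close>

theorem theorem8p11:
  fixes d k :: nat
  assumes "d \<ge> 2" and "k \<ge> 1" and "k \<le> d - 1"
  shows "\<forall>n::nat. n \<ge> 2 \<longrightarrow>
           (\<forall>U. cpoly.subspace U \<and> U \<subseteq> forms n d \<and> base_point_free n U \<and>
                codim_in (forms n d) U = k \<longrightarrow>
                codim_in (forms n (2 * d)) (square_space U) \<le> max_codim_sq (3 * k) k k)"
proof (intro allI impI, elim conjE)
  fix n U
  assume hU: "cpoly.subspace U" "U \<subseteq> forms n d" "base_point_free n U" "codim_in (forms n d) U = k"
  obtain l where hl: "\<And>i. i < k \<Longrightarrow> l i \<in> forms n 1"
    "\<And>f. f \<in> forms n d \<Longrightarrow> \<exists>c. f - (\<Sum>i<k. cscale (c i) (l i ^ d)) \<in> U"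
    by (rule exists_power_complement[OF hU(1,2,4)]) blast
  then obtain c where hc: "\<And>f. f \<in> forms n d \<Longrightarrow> f - (\<Sum>i<k. cscale (c f i) (l i ^ d)) \<in> U" by metis
  interpret power_complement n d k U l c
    using assms hU hl(1) hc by unfold_locales auto
  obtain b where hb: "\<And>i. b i \<in> forms n 1" "\<And>f. f \<in> forms n d \<Longrightarrow> \<exists>g\<in>forms (3 * k) d. f - subst.ev b g \<in> U"
    "base_point_free (3 * k) {g \<in> forms (3 * k) d. subst.ev b g \<in> U}"
    using exists_substitution[of "3 * k"] by auto
  interpret substitution n d "3 * k" U b
    using assms hU hb(1,2) by unfold_locales auto
  have cU': "codim_in (forms (3 * k) d) U' = k" using codim_U' hU(4) by simp
  have "base_point_free (3 * k) U'" using hb(3) by (simp add: U'_def)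
  \<comment> \<open>The strict inequality k < d is what permits multiplication by forms of degree
    only d - 1.\<close>
  from base_point_free_generates[OF U' this, of "d - 1"]
  have "sprod (forms (3 * k) (d - 1)) U' = forms (3 * k) (2 * d - 1)"
    using assms cU' by (simp add: mult_2)
  then have "codim_in (forms n (2 * d)) (square_space U) \<le> codim_in (forms (3 * k) (2 * d)) (square_space U')"
    by (rule codim_square_le)
  also have "\<dots> \<le> max_codim_sq (3 * k) k k"
    using assms by (intro codim_square_le_max_codim_sq U' cU') auto
  finally show "codim_in (forms n (2 * d)) (square_space U) \<le> max_codim_sq (3 * k) k k" .
qed

end
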